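(* Let $W$ be one of $A_n,B_n,D_n,\widetilde A_n,\widetilde B_n,\widetilde C_n,\widetilde D_n$. Let $G$ be a nested bracketing of a configuration space diagram associated to the Coxeter moduli space $\mathcal C(W)_\#$, written $$G=H\circ_{i_1}G_1\circ_{i_2}\cdots\circ_{i_k}G_k .$$ Then all bracketings in the image of $G$ under $\hat\sigma(G_1)\times\cdots\times\hat\sigma(G_k)$ represent the same cell of $\mathcal C(W)_\#$.
   Context: Complexes and particles. Spherical: $A_n$: unit sphere of $\mathbb R^{n+1}/\mathbb R(1,\dots,1)$ with hyperplanes $x_i=x_j$ ($n+1$ labeled particles on the line); $B_n$: unit sphere of $\mathbb R^n$ with hyperplanes $x_i=\pm x_j$, $x_i=0$ ($n$ symmetric pairs $\{x_i,-x_i\}$ on the line with a fixed particle at $0$); $D_n$: unit sphere of $\mathbb R^n$ with hyperplanes $x_i=\pm x_j$ ($n$ symmetric pairs, no fixed particle). Toroidal, with $\mathbb S=\mathbb R/2\mathbb Z$: $\widetilde A_n$: $\mathbb S^{n+1}$ modulo rotations, hyperplanes $x_i=x_j$; on $\mathbb S^n$ (symmetric pairs on the circle, axis points $0,1$): $\widetilde B_n$: $x_i=\pm x_j$, $x_i=1$; $\widetilde C_n$: $x_i=\pm x_j$, $x_i=1$, $x_i=0$; $\widetilde D_n$: $x_i=\pm x_j$. Chambers of the complex correspond to orderings (diagrams) of the labeled particles. Coxeter moduli space: for an intersection $\alpha$ of hyperplanes let $\mathcal H_s\alpha$ be the set of hyperplanes containing $\alpha$; it is reducible if it is a disjoint union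 $\mathcal H_s\beta\sqcup\mathcal H_s\gamma$ with $\alpha=\beta\cap\gamma$ (locally), otherwise irreducible. The minimal building set consists of the $\alpha$ with $\mathcal H_s\alpha$ irreducible. $\mathcal C(W)_\#$ is obtained from the spherical (resp. toroidal) complex by real blow-ups along elements of the minimal building set in increasing order of dimension; blowing up $\alpha$ replaces $\alpha$ by the real projectivization of its normal bundle. Bracketings: a bracket around adjacent particles of a diagram represents their collision; for symmetric particles a bracket off the axis is drawn with its mirror image (the pair counting as one bracket) and a bracket meeting the axis is a single symmetric bracket. Brackets may be nested, but two brackets never partially overlap. The composition $H\circ_iG'$ replaces the particle $i$ of the diagram $H$ by a bracket containing $G'$ (and, for symmetric particles, replaces the particle $-i$ by a bracket containing the mirror image of $G'$; if $i$ is a fixed particle, it is replaced by a bracket containing a symmetric diagram of type $B$ or $D$). If $H$ is an $m_0$-bracketing and each $G_j$ is a nested $m_j$-bracketing, then $G=H\circ_{i_1}G_1\circ_{i_2}\cdots\circ_{i_k}G_k$, each $i_j$ a particle of $H$, is a nested $(k+m_0+\cdots+m_k)$-bracketing. The codimension $k$ faces of a chamber of $\mathcal C(W)_\#$ are the nested $k$-bracketings of its diagram; each such nested bracketing thus represents a cell of $\mathcal C(W)_\#$. Flip action: for an unbracketed diagram $G'$, $\hat\sigma(G')$ consists of the identity and the reflection reversing the order of the particles of $G'$. For a nested bracketing $G'$, $\hat\sigma(G')$ acts independently in this way on each bracketed component. *)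

theory Defs
  imports "HOL-Analysis.Analysis"
begin

section \<open>Real blow-ups\<close>

text \<open>
  The component of \<open>x\<close> normal to \<open>\<alpha>\<close>.  Every centre \<open>\<alpha>\<close> used below is the
  section of the ambient complex \<open>X\<close> by the affine hull of \<open>\<alpha>\<close>, and that section is clean
  (\<open>T\<^sub>p X\<close> meets the direction space of the affine hull exactly in \<open>T\<^sub>p \<alpha>\<close>).  Hence on \<open>X\<close> the map
  \<open>normal_part \<alpha>\<close> vanishes exactly on \<open>\<alpha>\<close>, and its derivative identifies the normal space
  \<open>T\<^sub>p X / T\<^sub>p \<alpha>\<close> with a subspace of the Euclidean space.
\<close>

definition normal_part :: "'e::euclidean_space set \<Rightarrow> 'e \<Rightarrow> 'e" where
  "normal_part \<alpha> x = x - closest_point (affine hull \<alpha>) x"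

text \<open>
  The point \<open>[v]\<close> of the real projective space of \<open>'e\<close> is encoded by the orthogonal projection onto
  the line spanned by \<open>v\<close>; the topology of pointwise convergence on these projections is the usual
  topology of the projective space.
\<close>

definition line :: "'e::euclidean_space \<Rightarrow> ('e \<Rightarrow> 'e)" where
  "line v = (\<lambda>u. ((u \<bullet> v) / (v \<bullet> v)) *\<^sub>R v)"

text \<open>
  A point of an iterated blow-up: the underlying point, and for each centre already blown up a
  normal direction (the entries at all other sets are \<open>0\<close>).
\<close>

type_synonym 'e bpoint = "'e \<times> ('e set \<Rightarrow> ('e \<Rightarrow> 'e))"

text \<open>
  Blowing up \<open>\<alpha>\<close>: the closure of the graph of the normal direction map on the complement of \<open>\<alpha>\<close>.
  For \<open>Y = X\<close> the points off \<open>\<alpha>\<close> keep one preimage, and \<open>p \<in> \<alpha>\<close> is replaced by all \<open>[v]\<close> with \<open>v\<close>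
  in the normal space of \<open>\<alpha>\<close> at \<open>p\<close>.  In an iteration this is the blow-up along the proper transform
  of \<open>\<alpha>\<close>: at points that lie over \<open>\<alpha>\<close> but off its proper transform, the normal direction extends
  continuously over the exceptional sets of the earlier, smaller centres, so that the closure adds
  a single preimage there; over the proper transform the normal bundle is, up to a twist by a line
  bundle which does not affect the projectivization, the pull-back of the normal bundle of \<open>\<alpha>\<close>.
\<close>

definition blow_up :: "'e::euclidean_space set \<Rightarrow> 'e bpoint set \<Rightarrow> 'e bpoint set" where
  "blow_up \<alpha> Y = closure {(x, l(\<alpha> := line (normal_part \<alpha> x))) | x l. (x, l) \<in> Y \<and> x \<notin> \<alpha>}"

text \<open>The head of the list is blown up first.\<close>

definition iterated_blow_up :: "'e::euclidean_space set \<Rightarrow> 'e set list \<Rightarrow> 'e bpoint set" where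
  "iterated_blow_up X \<alpha>s = fold blow_up \<alpha>s ((\<lambda>x. (x, \<lambda>_ _. 0)) ` X)"


section \<open>The spherical and toroidal complexes\<close>

text \<open>The last four are the affine types.\<close>

datatype coxeter = TypeA | TypeB | TypeD | AffA | AffB | AffC | AffD

definition toroidal :: "coxeter \<Rightarrow> bool" where
  "toroidal W \<longleftrightarrow> W \<in> {AffA, AffB, AffC, AffD}"

definition fixed_at_0 :: "coxeter \<Rightarrow> bool" where
  "fixed_at_0 W \<longleftrightarrow> W \<in> {TypeB, AffC}"

definition fixed_at_1 :: "coxeter \<Rightarrow> bool" where
  "fixed_at_1 W \<longleftrightarrow> W \<in> {AffB, AffC}"

definition particles :: "coxeter \<Rightarrow> nat \<Rightarrow> nat" where
  "particles W n = (if W \<in> {TypeA, AffA} then n + 1 else n)"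

text \<open>
  Below these ranks the hyperplanes listed for the type do not cut the complex into the chambers
  of the corresponding diagrams.
\<close>

definition min_rank :: "coxeter \<Rightarrow> nat" where
  "min_rank W = (if W = AffD then 3 else if W \<in> {TypeD, AffB} then 2 else 1)"

text \<open>
  Configurations are given by real coordinates \<open>x\<close>, taken modulo \<open>2\<close> in the toroidal case.  The
  quotient of \<open>\<real>\<^sup>n\<^sup>+\<^sup>1\<close> by the diagonal is identified with the hyperplane \<open>\<Sum>x\<^sub>i = 0\<close>.
\<close>

definition coords :: "coxeter \<Rightarrow> (real^'n) set" where
  "coords W =
     (if toroidal W then UNIV
      else if W = TypeA then {x. norm x = 1 \<and> (\<Sum>i\<in>UNIV. x $ i) = 0}
      else {x. norm x = 1})"

text \<open>
  The point of the complex with coordinates \<open>x\<close>.  One ambient space of matrices serves all types: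
  for \<open>AffA\<close> the entries \<open>z\<^sub>i / z\<^sub>j\<close> with \<open>z\<^sub>i = e^(\<i> \<pi> x\<^sub>i)\<close> embed the torus modulo
  rotations; for the other types every column is just the vector of positions on the line or on
  the circle.
\<close>

definition place :: "coxeter \<Rightarrow> real^'n \<Rightarrow> complex^'n^'n" where
  "place W x = (\<chi> i j.
     if W = AffA then cis (pi * (x $ i - x $ j))
     else if toroidal W then cis (pi * x $ i)
     else of_real (x $ i))"

definition complex_of :: "coxeter \<Rightarrow> (complex^'n^'n) set" where
  "complex_of W = place W ` coords W"

text \<open>Equality of positions on the line, or on the circle \<open>\<real> / 2\<int>\<close>.\<close>

definition same_pos :: "coxeter \<Rightarrow> real \<Rightarrow> real \<Rightarrow> bool" where
  "same_pos W s t \<longleftrightarrow> (if toroidal W then \<exists>k::int. s - t = 2 * of_int k else s = t)"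

definition hyperplanes :: "coxeter \<Rightarrow> (complex^'n^'n) set set" where
  "hyperplanes W =
     {place W ` {x \<in> coords W. same_pos W (x $ i) (x $ j)} | i j. i \<noteq> j}
   \<union> {place W ` {x \<in> coords W. same_pos W (x $ i) (- x $ j)} | i j. i \<noteq> j \<and> W \<notin> {TypeA, AffA}}
   \<union> {place W ` {x \<in> coords W. same_pos W (x $ i) 0} | i. fixed_at_0 W}
   \<union> {place W ` {x \<in> coords W. same_pos W (x $ i) 1} | i. fixed_at_1 W}"


section \<open>The minimal building set and the Coxeter moduli space\<close>

text \<open>
  An intersection of toroidal hyperplanes may be disconnected, with different hyperplanes through
  its different components, so there the intersections are taken locally, i.e. componentwise.
\<close>

definition pieces :: "coxeter \<Rightarrow> (complex^'n^'n) set \<Rightarrow> (complex^'n^'n) set set" where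
  "pieces W S = (if toroidal W then components S else {S})"

definition intersections :: "coxeter \<Rightarrow> (complex^'n^'n) set set" where
  "intersections W =
     {\<alpha>. \<alpha> \<noteq> {} \<and> (\<exists>F \<subseteq> hyperplanes W. F \<noteq> {} \<and> \<alpha> \<in> pieces W (\<Inter>F))}"

definition Hs :: "coxeter \<Rightarrow> (complex^'n^'n) set \<Rightarrow> (complex^'n^'n) set set" where
  "Hs W \<alpha> = {h \<in> hyperplanes W. \<alpha> \<subseteq> h}"

definition reducible :: "coxeter \<Rightarrow> (complex^'n^'n) set \<Rightarrow> bool" where
  "reducible W \<alpha> \<longleftrightarrow>
     (\<exists>\<beta> \<in> intersections W. \<exists>\<gamma> \<in> intersections W.
        Hs W \<alpha> = Hs W \<beta> \<union> Hs W \<gamma> \<and> Hs W \<beta> \<inter> Hs W \<gamma> = {} \<and> \<alpha> \<in> pieces W (\<beta> \<inter> \<gamma>))"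

definition min_building_set :: "coxeter \<Rightarrow> (complex^'n^'n) set set" where
  "min_building_set W = {\<alpha> \<in> intersections W. \<not> reducible W \<alpha>}"

text \<open>The codimension of \<open>\<alpha>\<close> is the least number of hyperplanes that cut out \<open>\<alpha>\<close>.\<close>

definition codim :: "coxeter \<Rightarrow> (complex^'n^'n) set \<Rightarrow> nat" where
  "codim W \<alpha> =
     (LEAST k. \<exists>F \<subseteq> hyperplanes W. F \<noteq> {} \<and> card F = k \<and> \<alpha> \<in> pieces W (\<Inter>F))"

text \<open>Enumerations of the minimal building set by increasing dimension.\<close>

definition blow_up_order :: "coxeter \<Rightarrow> (complex^'n^'n) set list \<Rightarrow> bool" where
  "blow_up_order W \<alpha>s \<longleftrightarrow>
     distinct \<alpha>s \<and> set \<alpha>s = min_building_set W \<and> sorted_wrt (\<lambda>\<alpha> \<beta>. codim W \<beta> \<le> codim W \<alpha>) \<alpha>s"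

definition moduli_space ::
    "coxeter \<Rightarrow> (complex^'n^'n) set list \<Rightarrow> (complex^'n^'n) bpoint set" where
  "moduli_space W \<alpha>s = iterated_blow_up (complex_of W) \<alpha>s"

text \<open>
  The divisor that replaces \<open>\<alpha>\<close>: the closure of the part of the moduli space lying over the generic
  points of \<open>\<alpha>\<close>.  If \<open>\<alpha>\<close> is a hyperplane this is its proper transform.
\<close>

definition divisor ::
    "coxeter \<Rightarrow> (complex^'n^'n) set list \<Rightarrow> (complex^'n^'n) set \<Rightarrow> (complex^'n^'n) bpoint set" where
  "divisor W \<alpha>s \<alpha> =
     closure {p \<in> moduli_space W \<alpha>s. fst p \<in> \<alpha> \<and> (\<forall>h \<in> hyperplanes W. \<not> \<alpha> \<subseteq> h \<longrightarrow> fst p \<notin> h)}"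


section \<open>Bracketed diagrams\<close>

text \<open>The particle at \<open>x\<^sub>i\<close>, and its mirror image at \<open>- x\<^sub>i\<close> (symmetric types only).\<close>

datatype 'a particle = Plus 'a | Minus 'a

fun label :: "'a particle \<Rightarrow> 'a" where
  "label (Plus i) = i"
| "label (Minus i) = i"

fun opp :: "'a particle \<Rightarrow> 'a particle" where
  "opp (Plus i) = Minus i"
| "opp (Minus i) = Plus i"

datatype 'a node = Pt "'a particle" | Br "'a node list"

text \<open>
  What sits at an axis point: a fixed particle, nothing, or a symmetric bracket.
  \<open>AxisBr c ns\<close> is the bracket around the symmetric diagram whose centre is \<open>c\<close> and whose right
  half, read outwards from the centre, is \<open>ns\<close>.
\<close>

datatype 'a center = Fixed | Free | AxisBr "'a center" "'a node list"

text \<open>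
  Symmetric diagrams are recorded by one half.  \<open>SymCirc c\<^sub>0 ns c\<^sub>1\<close> has the centres \<open>c\<^sub>0\<close> and \<open>c\<^sub>1\<close>
  at \<open>0\<close> and \<open>1\<close>, and \<open>ns\<close> on the arc from \<open>0\<close> to \<open>1\<close>; the right half of \<open>c\<^sub>1\<close> lies beyond \<open>1\<close>.
  \<open>Circ ns\<close> is read cyclically.
\<close>

datatype 'a diagram =
    Lin "'a node list"
  | Circ "'a node list"
  | SymLin "'a center" "'a node list"
  | SymCirc "'a center" "'a node list" "'a center"

fun mirror :: "'a node \<Rightarrow> 'a node" where
  "mirror (Pt a) = Pt (opp a)"
| "mirror (Br ns) = Br (rev (map mirror ns))"

fun leaves :: "'a node \<Rightarrow> 'a particle list" where
  "leaves (Pt a) = [a]"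
| "leaves (Br ns) = concat (map leaves ns)"

fun center_half :: "'a center \<Rightarrow> 'a node list" where
  "center_half (AxisBr c ns) = center_half c @ ns"
| "center_half _ = []"

fun has_fixed :: "'a center \<Rightarrow> bool" where
  "has_fixed Fixed = True"
| "has_fixed Free = False"
| "has_fixed (AxisBr c ns) = has_fixed c"

text \<open>For \<open>SymCirc\<close> the half is the one on the arc from \<open>0\<close> to \<open>1\<close>.\<close>

fun half :: "'a diagram \<Rightarrow> 'a node list" where
  "half (Lin ns) = ns"
| "half (Circ ns) = ns"
| "half (SymLin c ns) = center_half c @ ns"
| "half (SymCirc c0 ns c1) = center_half c0 @ ns @ rev (map mirror (center_half c1))"

definition ordering :: "'a diagram \<Rightarrow> 'a particle list" where
  "ordering G = concat (map leaves (half G))"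

text \<open>
  The set of particles in a bracket off the axis, or in one half of a symmetric bracket at the
  axis point \<open>0\<close> or \<open>1\<close>.
\<close>

datatype 'a bracket = Off "'a particle set" | Axis real "'a particle set"

fun node_brackets :: "'a node \<Rightarrow> 'a bracket set" where
  "node_brackets (Pt a) = {}"
| "node_brackets (Br ns) = insert (Off (set (leaves (Br ns)))) (\<Union>(set (map node_brackets ns)))"

fun axis_halves :: "'a center \<Rightarrow> 'a particle set set" where
  "axis_halves (AxisBr c ns) =
     insert (set (concat (map leaves (center_half c @ ns)))) (axis_halves c)"
| "axis_halves _ = {}"

fun axis_brackets :: "'a diagram \<Rightarrow> 'a bracket set" where
  "axis_brackets (SymLin c ns) = Axis 0 ` axis_halves c"
| "axis_brackets (SymCirc c0 ns c1) =
     Axis 0 ` axis_halves c0 \<union> (\<lambda>S. Axis 1 (opp ` S)) ` axis_halves c1"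
| "axis_brackets _ = {}"

definition brackets :: "'a diagram \<Rightarrow> 'a bracket set" where
  "brackets G = (\<Union>N \<in> set (half G). node_brackets N) \<union> axis_brackets G"

fun pos :: "real^'n \<Rightarrow> 'n particle \<Rightarrow> real" where
  "pos x (Plus i) = x $ i"
| "pos x (Minus i) = - x $ i"

text \<open>The collision represented by a bracket.\<close>

fun locus :: "coxeter \<Rightarrow> 'n::finite bracket \<Rightarrow> (complex^'n^'n) set" where
  "locus W (Off S) = place W ` {x \<in> coords W. \<forall>a\<in>S. \<forall>b\<in>S. same_pos W (pos x a) (pos x b)}"
| "locus W (Axis t S) = place W ` {x \<in> coords W. \<forall>a\<in>S. same_pos W (pos x a) t}"

text \<open>
  Each bracket encloses at least two items, so that no bracket is drawn twice.
\<close>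

fun proper_node :: "'a node \<Rightarrow> bool" where
  "proper_node (Pt a) = True"
| "proper_node (Br ns) = (2 \<le> length ns \<and> (\<forall>N \<in> set ns. proper_node N))"

fun proper_center :: "'a center \<Rightarrow> bool" where
  "proper_center (AxisBr c ns) = (proper_center c \<and> ns \<noteq> [] \<and> (\<forall>N \<in> set ns. proper_node N))"
| "proper_center _ = True"

fun proper :: "'a diagram \<Rightarrow> bool" where
  "proper (Lin ns) = (\<forall>N \<in> set ns. proper_node N)"
| "proper (Circ ns) = (\<forall>N \<in> set ns. proper_node N)"
| "proper (SymLin c ns) = (proper_center c \<and> (\<forall>N \<in> set ns. proper_node N))"
| "proper (SymCirc c0 ns c1) =
     (proper_center c0 \<and> proper_center c1 \<and> (\<forall>N \<in> set ns. proper_node N))"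

fun diagram_of_type :: "coxeter \<Rightarrow> 'a diagram \<Rightarrow> bool" where
  "diagram_of_type W (Lin ns) = (W = TypeA)"
| "diagram_of_type W (Circ ns) = (W = AffA)"
| "diagram_of_type W (SymLin c ns) = (W \<in> {TypeB, TypeD} \<and> has_fixed c = fixed_at_0 W)"
| "diagram_of_type W (SymCirc c0 ns c1) =
     (W \<in> {AffB, AffC, AffD} \<and> has_fixed c0 = fixed_at_0 W \<and> has_fixed c1 = fixed_at_1 W)"

text \<open>
  The brackets must represent elements of the minimal building set; this excludes, for example,
  the symmetric bracket around two pairs without a fixed particle, and in the spherical types the
  bracket around all particles of the diagram.
\<close>

definition nested_bracketing :: "coxeter \<Rightarrow> 'n::finite diagram \<Rightarrow> bool" where
  "nested_bracketing W G \<longleftrightarrow>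
     diagram_of_type W G \<and>
     distinct (map label (ordering G)) \<and> label ` set (ordering G) = UNIV \<and>
     (W \<in> {TypeA, AffA} \<longrightarrow> set (ordering G) \<subseteq> range Plus) \<and>
     proper G \<and>
     (\<forall>b \<in> brackets G. locus W b \<in> min_building_set W)"


section \<open>The cell represented by a nested bracketing\<close>

text \<open>
  The order conditions at the axis points, on the increasing list \<open>ys\<close> of the positions on the
  half.  Without a fixed particle the two particles of a pair may pass through each other, so that
  only particles of different pairs are compared: \<open>- y\<^sub>j < y\<^sub>k\<close> at \<open>0\<close>, and \<open>y\<^sub>k < 2 - y\<^sub>j\<close> at \<open>1\<close>.
\<close>

definition ordered_at_0 :: "bool \<Rightarrow> real list \<Rightarrow> bool" where
  "ordered_at_0 fixd ys \<longleftrightarrow>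
     (if fixd then \<forall>y \<in> set ys. 0 < y
      else \<forall>j < length ys. \<forall>k < length ys. j \<noteq> k \<longrightarrow> - ys ! j < ys ! k)"

definition ordered_at_1 :: "bool \<Rightarrow> real list \<Rightarrow> bool" where
  "ordered_at_1 fixd ys \<longleftrightarrow>
     (if fixd then \<forall>y \<in> set ys. y < 1
      else \<forall>j < length ys. \<forall>k < length ys. j \<noteq> k \<longrightarrow> ys ! k < 2 - ys ! j)"

fun boundary_order :: "'a diagram \<Rightarrow> real list \<Rightarrow> bool" where
  "boundary_order (Lin ns) ys = True"
| "boundary_order (Circ ns) ys = (\<forall>y \<in> set ys. \<forall>y' \<in> set ys. y' < y + 2)"
| "boundary_order (SymLin c ns) ys = ordered_at_0 (has_fixed c) ys"
| "boundary_order (SymCirc c0 ns c1) ys =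
     (ordered_at_0 (has_fixed c0) ys \<and> ordered_at_1 (has_fixed c1) ys)"

text \<open>The coordinates of the points in the open chamber of the diagram.\<close>

definition in_order :: "'n::finite diagram \<Rightarrow> real^'n \<Rightarrow> bool" where
  "in_order G x \<longleftrightarrow>
     (let ys = map (pos x) (ordering G) in sorted_wrt (<) ys \<and> boundary_order G ys)"

fun tight :: "real \<Rightarrow> real^'n \<Rightarrow> 'n::finite bracket \<Rightarrow> bool" where
  "tight r x (Off S) = (\<forall>a\<in>S. \<forall>b\<in>S. \<bar>pos x a - pos x b\<bar> < r)"
| "tight r x (Axis t S) = (\<forall>a\<in>S. \<bar>pos x a - t\<bar> < r)"

definition chamber_near ::
    "coxeter \<Rightarrow> (complex^'n^'n) set list \<Rightarrow> 'n::finite diagram \<Rightarrow> real \<Rightarrow> (complex^'n^'n) bpoint set" where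
  "chamber_near W \<alpha>s G r =
     {p \<in> moduli_space W \<alpha>s.
        fst p \<in> place W ` {x \<in> coords W. in_order G x \<and> (\<forall>b \<in> brackets G. tight r x b)}}"

text \<open>
  The (closed) face of the closed chamber of \<open>G\<close> that is cut out by the divisors of the brackets of
  \<open>G\<close>.  A toroidal chamber may meet a divisor in several of its faces (the bracket around all the
  particles of a circle can be cut open at any gap), so the face is approached only from
  configurations in which the particles of each bracket are close together in the order in which
  they are listed.  Without brackets this is the closed chamber.
\<close>

definition cell ::
    "coxeter \<Rightarrow> (complex^'n^'n) set list \<Rightarrow> 'n::finite diagram \<Rightarrow> (complex^'n^'n) bpoint set" where
  "cell W \<alpha>s G =
     {p \<in> moduli_space W \<alpha>s.
        (\<forall>r > 0. p \<in> closure (chamber_near W \<alpha>s G r)) \<and>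
        (\<forall>b \<in> brackets G. p \<in> divisor W \<alpha>s (locus W b))}"


section \<open>Composition and the flip action\<close>

text \<open>The particles at which a diagram can be inserted: a pair (or particle) \<open>i\<close>, or a fixed one.\<close>

datatype 'a slot = Movable 'a | FixedAt0 | FixedAt1

fun slots :: "'a diagram \<Rightarrow> 'a slot set" where
  "slots (Lin ns) = Movable ` label ` set (ordering (Lin ns))"
| "slots (Circ ns) = Movable ` label ` set (ordering (Circ ns))"
| "slots (SymLin c ns) =
     Movable ` label ` set (ordering (SymLin c ns)) \<union> (if has_fixed c then {FixedAt0} else {})"
| "slots (SymCirc c0 ns c1) =
     Movable ` label ` set (ordering (SymCirc c0 ns c1)) \<union>
     (if has_fixed c0 then {FixedAt0} else {}) \<union> (if has_fixed c1 then {FixedAt1} else {})"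

fun insertable :: "'a slot \<Rightarrow> 'a diagram \<Rightarrow> bool" where
  "insertable (Movable i) G = (\<exists>ns. G = Lin ns)"
| "insertable _ G = (\<exists>c ns. G = SymLin c ns)"

fun subst_pt :: "('a slot \<Rightarrow> 'a diagram option) \<Rightarrow> 'a particle \<Rightarrow> 'a node" where
  "subst_pt s (Plus i) = (case s (Movable i) of Some (Lin ns) \<Rightarrow> Br ns | _ \<Rightarrow> Pt (Plus i))"
| "subst_pt s (Minus i) = (case s (Movable i) of Some (Lin ns) \<Rightarrow> mirror (Br ns) | _ \<Rightarrow> Pt (Minus i))"

fun subst_node :: "('a slot \<Rightarrow> 'a diagram option) \<Rightarrow> 'a node \<Rightarrow> 'a node" where
  "subst_node s (Pt a) = subst_pt s a"
| "subst_node s (Br ns) = Br (map (subst_node s) ns)"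

fun subst_center ::
    "('a slot \<Rightarrow> 'a diagram option) \<Rightarrow> 'a slot \<Rightarrow> 'a center \<Rightarrow> 'a center" where
  "subst_center s i Fixed = (case s i of Some (SymLin c ns) \<Rightarrow> AxisBr c ns | _ \<Rightarrow> Fixed)"
| "subst_center s i Free = Free"
| "subst_center s i (AxisBr c ns) = AxisBr (subst_center s i c) (map (subst_node s) ns)"

fun subst_diagram :: "('a slot \<Rightarrow> 'a diagram option) \<Rightarrow> 'a diagram \<Rightarrow> 'a diagram" where
  "subst_diagram s (Lin ns) = Lin (map (subst_node s) ns)"
| "subst_diagram s (Circ ns) = Circ (map (subst_node s) ns)"
| "subst_diagram s (SymLin c ns) = SymLin (subst_center s FixedAt0 c) (map (subst_node s) ns)"
| "subst_diagram s (SymCirc c0 ns c1) =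
     SymCirc (subst_center s FixedAt0 c0) (map (subst_node s) ns) (subst_center s FixedAt1 c1)"

text \<open>
  \<open>composition H [(i\<^sub>1, G\<^sub>1), \<dots>, (i\<^sub>k, G\<^sub>k)]\<close> is \<open>H \<circ>\<^sub>i\<^sub>1 G\<^sub>1 \<circ>\<^sub>i\<^sub>2 \<dots> \<circ>\<^sub>i\<^sub>k G\<^sub>k\<close>.  All \<open>i\<^sub>j\<close> are particles of
  \<open>H\<close>, so the insertions are made simultaneously; the name \<open>i\<^sub>j\<close> may therefore reappear as the
  label of a particle inside some \<open>G\<^sub>l\<close>.
\<close>

definition composition :: "'a diagram \<Rightarrow> ('a slot \<times> 'a diagram) list \<Rightarrow> 'a diagram" where
  "composition H iGs = subst_diagram (map_of iGs) H"

text \<open>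
  The images of a bracketing under the flip action.  Each bracketed component, and the outermost
  one, is independently left alone or has the order of its items reversed.  Reversing a symmetric
  component interchanges its two halves, so its right half becomes the list of mirror images.
\<close>

fun node_flips :: "'a node \<Rightarrow> 'a node set" where
  "node_flips (Pt a) = {Pt a}"
| "node_flips (Br ns) = (\<Union>ms \<in> listset (map node_flips ns). {Br ms, Br (rev ms)})"

fun center_flips :: "'a center \<Rightarrow> 'a center set" where
  "center_flips (AxisBr c ns) =
     (\<Union>c' \<in> center_flips c. \<Union>ms \<in> listset (map node_flips ns).
        {AxisBr c' ms, AxisBr c' (map mirror ms)})"
| "center_flips c = {c}"

text \<open>Only \<open>Lin\<close> and \<open>SymLin\<close> diagrams are ever inserted.\<close>

fun flips :: "'a diagram \<Rightarrow> 'a diagram set" where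
  "flips (Lin ns) = (\<Union>ms \<in> listset (map node_flips ns). {Lin ms, Lin (rev ms)})"
| "flips (SymLin c ns) =
     (\<Union>c' \<in> center_flips c. \<Union>ms \<in> listset (map node_flips ns).
        {SymLin c' ms, SymLin c' (map mirror ms)})"
| "flips G = {G}"

end

theory Submission
  imports Defs
begin

text \<open>
A point of a cell is the limit of points of an open chamber.  It consists of the limit \<open>x0\<close> of these
configurations \<open>X m\<close> and of the limiting direction normal to every irreducible flat through \<open>x0\<close>.
Let \<open>\<beta>\<close> be the flat of a bracket.  Flipping the bracket amounts to replacing \<open>X m\<close> by its
reflection \<open>Y m\<close> in \<open>\<beta>\<close>, the orthogonal reflection of the coordinates in the tangent space of \<open>\<beta>\<close>
at \<open>x0\<close>.  So it has to be seen that \<open>X m\<close> and \<open>Y m\<close> have the same limit in the blow-up and that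
\<open>Y m\<close> lies in the chamber of the flipped diagram.

Let \<open>\<alpha>\<close> be an irreducible flat through \<open>x0\<close>.  If \<open>\<beta> \<subseteq> \<alpha>\<close>, then the reflection reverses the
component normal to \<open>\<alpha>\<close>.  It keeps the line spanned by this component, and a blow-up records
only the line.  If \<open>\<not> \<beta> \<subseteq> \<alpha>\<close>, then the displacement \<open>Y m - X m\<close> does not influence the limiting
direction normal to \<open>\<alpha>\<close>, for one of two reasons (\<open>building_set_meet\<close>).  Either all roots of \<open>\<alpha>\<close> are
orthogonal to those of \<open>\<beta>\<close>; then the displacement is tangent to \<open>\<alpha>\<close>.  Or \<open>\<alpha>\<close> and \<open>\<beta>\<close> span an
irreducible flat \<open>\<gamma>\<close>, a component of their intersection that lies strictly inside \<open>\<beta>\<close>.  As the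
point of the cell lies on the divisor of \<open>\<beta>\<close>, its direction normal to \<open>\<gamma>\<close> is tangent to \<open>\<beta>\<close>
(\<open>divisor_tangential\<close>).  Hence the distance of \<open>X m\<close> from \<open>\<beta>\<close>, and with it the displacement, is of
smaller order than the distance from \<open>\<gamma>\<close>.  The latter is bounded by the distances from \<open>\<alpha>\<close> and \<open>\<beta>\<close>
together, hence by a multiple of the distance from \<open>\<alpha>\<close> (\<open>displacement_negligible\<close>).  This gives the
equality of the limits (\<open>reflected_lines\<close>).

A component of a wall is an irreducible flat, so the same estimate shows that the reflection changes
the side only of those walls that contain \<open>\<beta>\<close> (\<open>reflected_side\<close>).  For a bracket off the axis these
are the walls between two of its particles, and the order of its particles is reversed
(\<open>off_flip_subset\<close>).  A bracket on the axis is replaced by its mirror image (\<open>axis_flip_subset\<close>).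

These two moves act on the ordering of the particles and reverse a segment together with everything
inside it.  The flip action reverses only the order of the items of a bracket; it is obtained by
flipping the items back afterwards (\<open>node_flip_moves\<close>, \<open>center_flip_moves\<close>).  None of the moves changes
the sets of labels in the brackets, so all cells are compared for one fixed set of brackets.
\<close>

section \<open>Normal directions and blow-ups\<close>

text \<open>
Relative to any base point of the affine hull, \<open>normal_part\<close> is the orthogonal projection along the
direction space of the hull.  So it is linear up to the choice of the base point, and contracting.
\<close>

lemma normal_part_linear:
  fixes \<alpha> :: "'e::euclidean_space set"
  assumes "\<alpha> \<noteq> {}"
  obtains R where "linear R" "\<And>v. norm (R v) \<le> norm v"
    "\<And>x y. y \<in> affine hull \<alpha> \<Longrightarrow> normal_part \<alpha> x = R (x - y)"
    "\<And>x y. x \<in> affine hull \<alpha> \<Longrightarrow> y \<in> affine hull \<alpha> \<Longrightarrow> R (x - y) = 0"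
    "\<And>x y z. y \<in> affine hull \<alpha> \<Longrightarrow> z \<in> affine hull \<alpha> \<Longrightarrow> R x \<bullet> (y - z) = 0"
    "\<And>x y. y \<in> affine hull \<alpha> \<Longrightarrow> y + (x - R x) \<in> affine hull \<alpha>"
proof -
  let ?A = "affine hull \<alpha>"
  obtain a0 where a0: "a0 \<in> ?A" using assms by (metis affine_hull_eq_empty all_not_in_conv)
  define D where "D = (\<lambda>x. x - a0) ` ?A"
  have D: "subspace D"
    unfolding D_def using affine_diffs_subspace_subtract[OF affine_affine_hull a0] .
  have DA: "x - y \<in> D" if "x \<in> ?A" "y \<in> ?A" for x y
  proof -
    have "(x - a0) - (y - a0) \<in> D" using that unfolding D_def by (intro subspace_diff D[unfolded D_def] imageI)
    then show ?thesis by simp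
  qed
  have AD: "y + d \<in> ?A" if "y \<in> ?A" "d \<in> D" for y d
  proof -
    have "(y - a0) + d \<in> D" using that(1) by (intro subspace_add D that(2)) (auto simp: D_def)
    then obtain z where "z \<in> ?A" "(y - a0) + d = z - a0" unfolding D_def by blast
    then show ?thesis by (simp add: algebra_simps)
  qed
  have ex: "\<exists>r. v - r \<in> D \<and> (\<forall>d\<in>D. r \<bullet> d = 0)" for v
  proof -
    obtain y z where "y \<in> span D" "\<And>w. w \<in> span D \<Longrightarrow> orthogonal z w" "v = y + z"
      using orthogonal_subspace_decomp_exists by blast
    moreover have "span D = D" using D by (simp add: span_eq_iff)
    ultimately show ?thesis by (intro exI[of _ z]) (auto simp: orthogonal_def)
  qed
  have uniq: "r = r'" if "v - r \<in> D" "\<forall>d\<in>D. r \<bullet> d = 0" "v - r' \<in> D" "\<forall>d\<in>D. r' \<bullet> d = 0" for v r r'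
  proof -
    have "r - r' \<in> D" using subspace_diff[OF D that(3,1)] by simp
    then have "(r - r') \<bullet> (r - r') = 0" using that by (simp add: inner_diff_left)
    then show ?thesis by simp
  qed
  define R where "R v = (SOME r. v - r \<in> D \<and> (\<forall>d\<in>D. r \<bullet> d = 0))" for v
  have R: "v - R v \<in> D" "d \<in> D \<Longrightarrow> R v \<bullet> d = 0" for v d
    using someI_ex[OF ex[of v]] unfolding R_def by auto
  have lin: "linear R"
  proof (rule linearI)
    fix u v
    have "u + v - (R u + R v) \<in> D" using subspace_add[OF D R(1) R(1), of u v] by (simp add: algebra_simps)
    then show "R (u + v) = R u + R v" using R by (intro uniq[of "u + v"]) (auto simp: inner_add_left)
  next
    fix c v
    have "c *\<^sub>R v - c *\<^sub>R R v \<in> D" using subspace_scale[OF D R(1), of c v] by (simp add: algebra_simps)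
    then show "R (c *\<^sub>R v) = c *\<^sub>R R v" using R by (intro uniq[of "c *\<^sub>R v"]) auto
  qed
  have nrm: "norm (R v) \<le> norm v" for v
  proof -
    have "v \<bullet> v = R v \<bullet> R v + (v - R v) \<bullet> (v - R v)"
      using R(2)[OF R(1), of v v] by (simp add: inner_diff_left inner_diff_right inner_commute)
    then have "R v \<bullet> R v \<le> v \<bullet> v" by simp
    then show ?thesis by (simp add: norm_le)
  qed
  have np: "normal_part \<alpha> x = R (x - y)" if y: "y \<in> ?A" for x y
  proof -
    let ?c = "closest_point ?A x"
    have cA: "?c \<in> ?A" using y by (intro closest_point_in_set) auto
    have "(x - ?c) \<bullet> d = 0" if "d \<in> D" for d
    proof -
      have 1: "(x - ?c) \<bullet> d' \<le> 0" if "d' \<in> D" for d'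
        using closest_point_dot[of ?A "?c + d'" x] AD[OF cA that] by (simp add: affine_imp_convex)
      show ?thesis using 1[OF that] 1[OF subspace_neg[OF D that]] by simp
    qed
    moreover have "(x - y) - (x - ?c) \<in> D" using DA[OF cA y] by simp
    ultimately show ?thesis unfolding normal_part_def
      using R(1)[of "x - y"] R(2)[of _ "x - y"] by (intro uniq[of "x - y"]) auto
  qed
  have zero: "R d = 0" if "d \<in> D" for d
    using that R subspace_0[OF D] by (intro uniq[of d]) auto
  have "y + (x - R x) \<in> ?A" if "y \<in> ?A" for x y using AD[OF that R(1)] .
  then show ?thesis using that[OF lin nrm np] DA zero R(2) by blast
qed

lemma normal_part_eq_0:
  assumes "normal_part \<alpha> x = 0" "\<alpha> \<noteq> {}"
  shows "x \<in> affine hull \<alpha>"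
  using assms closest_point_in_set[of "affine hull \<alpha>" x]
  by (auto simp: normal_part_def)

lemma continuous_normal_part: "continuous_on S (normal_part \<alpha>)"
proof (cases "\<alpha> = {}")
  case True
  have "normal_part \<alpha> = (\<lambda>x. x - closest_point {} 0)"
    unfolding True normal_part_def closest_point_def by simp
  then show ?thesis by (simp add: continuous_intros)
next
  case False
  then obtain y where y: "y \<in> affine hull \<alpha>" by (metis affine_hull_eq_empty all_not_in_conv)
  obtain R where R: "linear R" "\<And>x y. y \<in> affine hull \<alpha> \<Longrightarrow> normal_part \<alpha> x = R (x - y)"
    using normal_part_linear[OF False] by metis
  have "normal_part \<alpha> = (\<lambda>x. R (x - y))" using R(2)[OF y] by auto
  then show ?thesis
    using linear_continuous_on_compose[OF continuous_on_diff[OF continuous_on_id continuous_on_const] R(1)]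
    by simp
qed

lemma linear_line: "linear (line v)"
  by (auto simp: line_def linear_iff inner_add_left add_divide_distrib scaleR_add_left)

text \<open>
A line does not change with the sign of its spanning vector, and a relative error that tends to \<open>0\<close>
does not change the limit of the lines.
\<close>

lemma line_close_tendsto:
  fixes v w :: "nat \<Rightarrow> 'e::euclidean_space"
  assumes lim: "(\<lambda>m. line (v m) u) \<longlonglongrightarrow> L"
    and nz: "\<And>m. v m \<noteq> 0" and eps: "\<epsilon> \<in> {1, -1::real}"
    and small: "(\<lambda>m. norm (w m - \<epsilon> *\<^sub>R v m) / norm (v m)) \<longlonglongrightarrow> 0"
  shows "(\<lambda>m. line (w m) u) \<longlonglongrightarrow> L"
proof -
  define a where "a m = (\<epsilon> / norm (v m)) *\<^sub>R v m" for m
  define b where "b m = (1 / norm (v m)) *\<^sub>R w m" for m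
  define e where "e m = b m - a m" for m
  have na: "norm (a m) = 1" for m using nz[of m] eps by (auto simp: a_def)
  have la: "line (v m) u = (u \<bullet> a m) *\<^sub>R a m" for m
  proof -
    have "\<epsilon> * \<epsilon> = 1" using eps by auto
    then show ?thesis using nz[of m] by (simp add: a_def line_def dot_square_norm power2_eq_square)
  qed
  \<comment> \<open>Normalizing both vectors by the same factor leaves the lines unchanged; then \<open>a\<close> has norm \<open>1\<close>.\<close>
  have lb: "line (w m) u = inverse (b m \<bullet> b m) *\<^sub>R ((u \<bullet> b m) *\<^sub>R b m)" for m
    using nz[of m] by (simp add: b_def line_def field_simps)
  have "norm (e m) = norm (w m - \<epsilon> *\<^sub>R v m) / norm (v m)" for m
  proof -
    have "e m = (1 / norm (v m)) *\<^sub>R (w m - \<epsilon> *\<^sub>R v m)" by (simp add: e_def a_def b_def algebra_simps)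
    then show ?thesis by simp
  qed
  then have e0: "e \<longlonglongrightarrow> 0" using small by (intro tendsto_norm_zero_cancel[of e]) simp
  have bb: "b m = a m + e m" for m by (simp add: e_def)
  have z1: "(\<lambda>m. a m \<bullet> e m) \<longlonglongrightarrow> 0"
  proof (rule Lim_null_comparison[OF _ tendsto_norm_zero[OF e0]])
    show "\<forall>\<^sub>F m in sequentially. norm (a m \<bullet> e m) \<le> norm (e m)"
      using Cauchy_Schwarz_ineq2[of "a _" "e _"] by (auto simp: na)
  qed
  have "(\<lambda>m. 1 + 2 * (a m \<bullet> e m) + e m \<bullet> e m) \<longlonglongrightarrow> 1 + 2 * 0 + (0::'e) \<bullet> 0"
    by (intro tendsto_add tendsto_inner tendsto_mult tendsto_const z1 e0)
  moreover have "b m \<bullet> b m = 1 + 2 * (a m \<bullet> e m) + e m \<bullet> e m" for m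
    using na[of m] by (simp add: bb inner_add_left inner_add_right inner_commute norm_eq_sqrt_inner)
  ultimately have n1: "(\<lambda>m. b m \<bullet> b m) \<longlonglongrightarrow> 1" by simp
  have z2: "(\<lambda>m. (u \<bullet> e m) *\<^sub>R b m + (u \<bullet> a m) *\<^sub>R e m) \<longlonglongrightarrow> 0"
  proof (rule Lim_null_comparison)
    show "\<forall>\<^sub>F m in sequentially. norm ((u \<bullet> e m) *\<^sub>R b m + (u \<bullet> a m) *\<^sub>R e m)
        \<le> norm u * norm (e m) * (1 + norm (e m)) + norm u * norm (e m)"
    proof (rule always_eventually, rule allI)
      fix m
      have "norm (b m) \<le> 1 + norm (e m)" using norm_triangle_ineq[of "a m" "e m"] by (simp add: bb na)
      moreover have "\<bar>u \<bullet> e m\<bar> \<le> norm u * norm (e m)" by (rule Cauchy_Schwarz_ineq2)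
      ultimately have "\<bar>u \<bullet> e m\<bar> * norm (b m) \<le> norm u * norm (e m) * (1 + norm (e m))"
        by (intro mult_mono) auto
      moreover have "\<bar>u \<bullet> a m\<bar> * norm (e m) \<le> norm u * norm (e m)"
        using Cauchy_Schwarz_ineq2[of u "a m"] by (intro mult_right_mono) (auto simp: na)
      ultimately show "norm ((u \<bullet> e m) *\<^sub>R b m + (u \<bullet> a m) *\<^sub>R e m)
        \<le> norm u * norm (e m) * (1 + norm (e m)) + norm u * norm (e m)"
        using norm_triangle_ineq[of "(u \<bullet> e m) *\<^sub>R b m" "(u \<bullet> a m) *\<^sub>R e m"] by simp
    qed
    have "(\<lambda>m. norm u * norm (e m) * (1 + norm (e m)) + norm u * norm (e m))
        \<longlonglongrightarrow> norm u * norm (0::'e) * (1 + norm (0::'e)) + norm u * norm (0::'e)"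
      by (intro tendsto_intros e0)
    then show "(\<lambda>m. norm u * norm (e m) * (1 + norm (e m)) + norm u * norm (e m)) \<longlonglongrightarrow> 0" by simp
  qed
  have "(\<lambda>m. (u \<bullet> a m) *\<^sub>R a m + ((u \<bullet> e m) *\<^sub>R b m + (u \<bullet> a m) *\<^sub>R e m)) \<longlonglongrightarrow> L + 0"
    using lim z2 by (intro tendsto_add) (auto simp: la)
  moreover have "(u \<bullet> a m) *\<^sub>R a m + ((u \<bullet> e m) *\<^sub>R b m + (u \<bullet> a m) *\<^sub>R e m) = (u \<bullet> b m) *\<^sub>R b m" for m
    by (simp add: bb inner_add_right algebra_simps)
  ultimately have "(\<lambda>m. (u \<bullet> b m) *\<^sub>R b m) \<longlonglongrightarrow> L" by simp
  then have "(\<lambda>m. inverse (b m \<bullet> b m) *\<^sub>R ((u \<bullet> b m) *\<^sub>R b m)) \<longlonglongrightarrow> inverse 1 *\<^sub>R L"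
    by (intro tendsto_intros n1) auto
  then show ?thesis by (simp add: lb)
qed

lemma continuous_line: 
  fixes v :: "nat \<Rightarrow> 'e::euclidean_space"
  assumes "v \<longlonglongrightarrow> v0" "v0 \<noteq> 0"
  shows "(\<lambda>m. line (v m) u) \<longlonglongrightarrow> line v0 u"
  unfolding line_def using assms by (intro tendsto_intros) auto

lemma continuous_entry: "continuous_on UNIV (\<lambda>p::'e::euclidean_space bpoint. snd p \<alpha> u)"
proof -
  have "continuous_on UNIV (\<lambda>p::'e bpoint. snd p)" by (intro continuous_intros)
  from continuous_on_product_then_coordinatewise[OF this]
  have "continuous_on UNIV (\<lambda>p::'e bpoint. snd p \<alpha>)" .
  from continuous_on_product_then_coordinatewise[OF this] show ?thesis .
qed

text \<open>
Blowing up only adds limits, so it preserves every closed condition that holds for the points off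
the centres.
\<close>

lemma fold_blow_up_invariant:
  assumes "closed C" "Y \<subseteq> C"
    and "\<And>\<alpha> x l. \<alpha> \<in> set \<alpha>s \<Longrightarrow> (x, l) \<in> C \<Longrightarrow> x \<notin> \<alpha> \<Longrightarrow> (x, l(\<alpha> := line (normal_part \<alpha> x))) \<in> C"
  shows "fold blow_up \<alpha>s Y \<subseteq> C"
  using assms(2,3)
proof (induction \<alpha>s arbitrary: Y)
  case (Cons \<alpha> \<alpha>s)
  have "blow_up \<alpha> Y \<subseteq> C" unfolding blow_up_def
    using Cons.prems(1) Cons.prems(2)[of \<alpha>] by (intro closure_minimal \<open>closed C\<close>) (auto simp del: fun_upd_apply)
  then show ?case using Cons.IH[of "blow_up \<alpha> Y"] Cons.prems(2) by simp
qed auto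

text \<open>
Where the normal part does not vanish, its line depends continuously on the point, so taking
closures does not create any other direction.
\<close>

lemma iterated_blow_up_direction:
  fixes X :: "'e::euclidean_space set"
  assumes "(y, l) \<in> iterated_blow_up X \<alpha>s" "distinct \<alpha>s" "\<alpha> \<in> set \<alpha>s" "normal_part \<alpha> y \<noteq> 0"
  shows "l \<alpha> = line (normal_part \<alpha> y)"
proof -
  obtain as bs where ab: "\<alpha>s = as @ \<alpha> # bs" using split_list[OF assms(3)] by auto
  define N where "N = (normal_part \<alpha> :: 'e \<Rightarrow> 'e)"
  \<comment> \<open>The defining equation of the line, multiplied by the denominator, is a closed condition.\<close>
  define C where "C = {p::'e bpoint. \<forall>u. (N (fst p) \<bullet> N (fst p)) *\<^sub>R snd p \<alpha> u = (u \<bullet> N (fst p)) *\<^sub>R N (fst p)}"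
  have cN: "continuous_on UNIV (\<lambda>p::'e bpoint. N (fst p))"
    unfolding N_def using continuous_on_compose2[OF continuous_normal_part[of UNIV] continuous_on_fst[OF continuous_on_id]] by auto
  have clC: "closed C"
    unfolding C_def
    by (intro closed_Collect_all closed_Collect_eq continuous_intros cN continuous_entry)
  have lineC: "(x, l(\<alpha> := line (normal_part \<alpha> x))) \<in> C" for x l
    by (cases "N x = 0") (auto simp: C_def line_def N_def)
  have "iterated_blow_up X \<alpha>s \<subseteq> C" unfolding iterated_blow_up_def ab fold_append fold.simps comp_apply
  proof (rule fold_blow_up_invariant[OF clC])
    show "blow_up \<alpha> (fold blow_up as ((\<lambda>x. (x, \<lambda>_ _. 0)) ` X)) \<subseteq> C"
      unfolding blow_up_def using lineC by (intro closure_minimal clC) auto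
    show "(x, l(\<beta> := line (normal_part \<beta> x))) \<in> C" if "\<beta> \<in> set bs" "(x, l) \<in> C" for \<beta> x l
      using that assms(2) unfolding ab by (auto simp: C_def)
  qed
  then have "(y, l) \<in> C" using assms(1) by blast
  then have eq: "(N y \<bullet> N y) *\<^sub>R l \<alpha> u = (u \<bullet> N y) *\<^sub>R N y" for u by (simp add: C_def)
  have nz: "N y \<bullet> N y \<noteq> 0" using assms(4) by (simp add: N_def)
  have "l \<alpha> u = line (N y) u" for u
  proof -
    have "l \<alpha> u = inverse (N y \<bullet> N y) *\<^sub>R ((N y \<bullet> N y) *\<^sub>R l \<alpha> u)" using nz by simp
    also have "\<dots> = line (N y) u" unfolding eq by (simp add: line_def field_simps)
    finally show ?thesis .
  qed
  then show ?thesis unfolding N_def by (rule ext)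
qed

lemma iterated_blow_up_off_centres:
  fixes X :: "'e::euclidean_space set"
  assumes "(y, l) \<in> iterated_blow_up X \<alpha>s" "\<alpha> \<notin> set \<alpha>s"
  shows "l \<alpha> = (\<lambda>_. 0)"
proof -
  let ?C = "{p::'e bpoint. \<forall>u. snd p \<alpha> u = 0}"
  have "iterated_blow_up X \<alpha>s \<subseteq> ?C" unfolding iterated_blow_up_def
  proof (rule fold_blow_up_invariant)
    show "closed ?C"
      by (intro closed_Collect_all closed_Collect_eq continuous_on_const continuous_entry)
    show "(x, l(\<beta> := line (normal_part \<beta> x))) \<in> ?C" if "\<beta> \<in> set \<alpha>s" "(x, l) \<in> ?C" for \<beta> x l
      using that assms(2) by (cases "\<beta> = \<alpha>") simp_all
  qed auto
  then have "(y, l) \<in> ?C" using assms(1) by blast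
  then show ?thesis by (simp add: fun_eq_iff)
qed

lemma iterated_blow_up_linear:
  fixes X :: "'e::euclidean_space set"
  assumes "(y, l) \<in> iterated_blow_up X \<alpha>s"
  shows "linear (l \<alpha>)"
proof -
  let ?C = "{p::'e bpoint. (\<forall>u v. snd p \<alpha> (u + v) = snd p \<alpha> u + snd p \<alpha> v) \<and>
      (\<forall>c u. snd p \<alpha> (c *\<^sub>R u) = c *\<^sub>R snd p \<alpha> u)}"
  have "iterated_blow_up X \<alpha>s \<subseteq> ?C" unfolding iterated_blow_up_def
  proof (rule fold_blow_up_invariant)
    show "closed ?C"
      by (intro closed_Collect_conj closed_Collect_all closed_Collect_eq continuous_on_add
          continuous_on_scaleR continuous_on_const continuous_entry)
    show "(x, l(\<beta> := line (normal_part \<beta> x))) \<in> ?C" if "(x, l) \<in> ?C" for \<beta> x l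
      using that by (cases "\<beta> = \<alpha>") (simp_all add: linear_add[OF linear_line] linear_scale[OF linear_line])
  qed auto
  then have "(y, l) \<in> ?C" using assms by blast
  then show ?thesis by (simp add: linear_iff)
qed

lemma iterated_blow_up_generic:
  assumes "x \<in> X" "\<forall>\<alpha>\<in>set \<alpha>s. x \<notin> \<alpha>"
  shows "(x, \<lambda>\<alpha>. if \<alpha> \<in> set \<alpha>s then line (normal_part \<alpha> x) else (\<lambda>_. 0)) \<in> iterated_blow_up X \<alpha>s"
  using assms(2)
proof (induction \<alpha>s rule: rev_induct)
  case Nil
  then show ?case using assms(1) by (simp add: iterated_blow_up_def)
next
  case (snoc \<beta> \<alpha>s)
  let ?l = "\<lambda>\<alpha>. if \<alpha> \<in> set \<alpha>s then line (normal_part \<alpha> x) else (\<lambda>_. 0)"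
  have "(x, ?l(\<beta> := line (normal_part \<beta> x))) \<in> blow_up \<beta> (iterated_blow_up X \<alpha>s)"
    unfolding blow_up_def using snoc by (intro closure_subset[THEN subsetD] CollectI exI conjI refl) auto
  moreover have "?l(\<beta> := line (normal_part \<beta> x)) =
      (\<lambda>\<alpha>. if \<alpha> \<in> set (\<alpha>s @ [\<beta>]) then line (normal_part \<alpha> x) else (\<lambda>_. 0))"
    by (auto simp: fun_eq_iff)
  ultimately show ?case by (simp add: iterated_blow_up_def)
qed

lemma tendsto_fun:
  fixes f :: "'c \<Rightarrow> 'i \<Rightarrow> 'b::topological_space"
  assumes "\<And>i. ((\<lambda>m. f m i) \<longlongrightarrow> g i) F"
  shows "(f \<longlongrightarrow> g) F"
proof -
  have "limitin (product_topology (\<lambda>i. euclidean) UNIV) f g F"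
    using assms by (subst limitin_componentwise) auto
  then show ?thesis by (simp add: euclidean_product_topology)
qed

lemma closure_bpointI:
  fixes p :: "'e::euclidean_space bpoint"
  assumes "x \<longlonglongrightarrow> fst p" "\<And>\<alpha> u. (\<lambda>m. l m \<alpha> u) \<longlonglongrightarrow> snd p \<alpha> u" "\<forall>\<^sub>F m in sequentially. (x m, l m) \<in> S"
  shows "p \<in> closure S"
proof -
  have "(\<lambda>m. (x m, l m)) \<longlonglongrightarrow> (fst p, snd p)"
    using assms(1,2) by (intro tendsto_Pair tendsto_fun)
  then show ?thesis
    using Lim_in_closed_set[of "closure S" "\<lambda>m. (x m, l m)" sequentially p]
      eventually_mono[OF assms(3), of "\<lambda>m. (x m, l m) \<in> closure S"] closure_subset[of S] by auto
qed

text \<open>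
A basic neighbourhood in the topology of pointwise convergence restricts only finitely many
directions, each at finitely many arguments.
\<close>

lemma closure_bpoint_approx:
  fixes p :: "'e::euclidean_space bpoint"
  assumes "p \<in> closure S" "finite A" "finite B" "0 < e"
  shows "\<exists>x l. (x, l) \<in> S \<and> dist x (fst p) < e \<and> (\<forall>\<alpha>\<in>A. \<forall>u\<in>B. dist (l \<alpha> u) (snd p \<alpha> u) < e)"
proof -
  let ?U = "{q. dist (fst q) (fst p) < e} \<inter> (\<Inter>\<alpha>\<in>A. \<Inter>u\<in>B. {q. dist (snd q \<alpha> u) (snd p \<alpha> u) < e})"
  have "open ?U" using assms(2,3)
    by (intro open_Int open_INT ballI open_Collect_less continuous_on_dist continuous_on_const
        continuous_on_fst continuous_on_id continuous_entry) auto
  moreover have "p \<in> ?U" using assms(4) by simp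
  ultimately have "S \<inter> ?U \<noteq> {}"
    using assms(1)[unfolded closure_iff_nhds_not_empty, THEN spec, THEN spec, of ?U ?U] by simp
  then obtain q where "q \<in> S" "q \<in> ?U" by blast
  then show ?thesis by (intro exI[of _ "fst q"] exI[of _ "snd q"]) simp
qed


section \<open>Roots and walls\<close>

text \<open>
The positions that coincide with \<open>0\<close>.  Equality of positions becomes membership of the difference
in an additive group, which treats the line and the circle alike.
\<close>

definition lattice :: "coxeter \<Rightarrow> real set" where
  "lattice W = {s. same_pos W s 0}"

lemma same_pos_lattice: "same_pos W s t \<longleftrightarrow> s - t \<in> lattice W"
  by (simp add: lattice_def same_pos_def)

lemma lattice_iff: "s \<in> lattice W \<longleftrightarrow> (if toroidal W then \<exists>k::int. s = 2 * of_int k else s = 0)"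
  by (simp add: lattice_def same_pos_def)

lemma lattice_0 [simp]: "0 \<in> lattice W"
  by (auto simp: lattice_iff)

lemma lattice_add: "s \<in> lattice W \<Longrightarrow> t \<in> lattice W \<Longrightarrow> s + t \<in> lattice W"
  by (auto simp: lattice_iff distrib_left[symmetric] of_int_add[symmetric] simp del: of_int_add split: if_splits)

lemma lattice_neg: "s \<in> lattice W \<Longrightarrow> - s \<in> lattice W"
  by (auto simp: lattice_iff split: if_splits intro: exI[of _ "- _"])

lemma lattice_neg_iff [simp]: "- s \<in> lattice W \<longleftrightarrow> s \<in> lattice W"
  using lattice_neg[of s] lattice_neg[of "- s"] by auto

lemma lattice_diff: "s \<in> lattice W \<Longrightarrow> t \<in> lattice W \<Longrightarrow> s - t \<in> lattice W"
  using lattice_add[of s W "- t"] by simp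

lemma lattice_diff_commute: "s - t \<in> lattice W \<longleftrightarrow> t - s \<in> lattice W"
  using lattice_neg_iff[of "s - t" W] by simp

lemma lattice_mult: "c \<in> \<int> \<Longrightarrow> s \<in> lattice W \<Longrightarrow> c * s \<in> lattice W"
proof (cases "toroidal W")
  case True
  assume "c \<in> \<int>" "s \<in> lattice W"
  then obtain k l :: int where "c = of_int l" "s = 2 * of_int k"
    using True by (auto simp: lattice_iff elim: Ints_cases)
  then have "c * s = 2 * of_int (l * k)" by simp
  then show ?thesis using True unfolding lattice_iff by metis
qed (auto simp: lattice_iff)

lemma lattice_sum: "(\<And>i. i \<in> I \<Longrightarrow> f i \<in> lattice W) \<Longrightarrow> (\<Sum>i\<in>I. f i) \<in> lattice W"
  by (induction I rule: infinite_finite_induct) (auto intro: lattice_add)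

lemma lattice_discrete: "s \<in> lattice W \<Longrightarrow> \<bar>s\<bar> < 2 \<Longrightarrow> s = 0"
  by (auto simp: lattice_iff split: if_splits)

lemma lattice_line:
  assumes "\<And>s::real. b + s * d \<in> lattice W"
  shows "d = 0"
proof (rule ccontr)
  assume d: "d \<noteq> 0"
  have "(b + (1 / d) * d) - (b + 0 * d) \<in> lattice W" using assms by (intro lattice_diff)
  then have "1 \<in> lattice W" using d by simp
  from lattice_discrete[OF this] show False by simp
qed

definition place_entry :: "coxeter \<Rightarrow> real \<Rightarrow> complex" where
  "place_entry W s = (if toroidal W then cis (pi * s) else of_real s)"

definition coord_entry :: "coxeter \<Rightarrow> real^'n \<Rightarrow> 'n \<Rightarrow> 'n \<Rightarrow> real" where
  "coord_entry W x i j = x $ i - (if W = AffA then x $ j else 0)"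

lemma place_nth: "place W x $ i $ j = place_entry W (coord_entry W x i j)"
  by (simp add: place_def place_entry_def coord_entry_def toroidal_def)

lemma norm_cis_minus_1: "norm (cis t - 1) = 2 * \<bar>sin (t / 2)\<bar>"
proof -
  have "(norm (cis t - 1))\<^sup>2 = (cos t - 1)\<^sup>2 + (sin t)\<^sup>2" by (simp add: cmod_power2)
  also have "\<dots> = 2 - 2 * cos t" using sin_cos_squared_add[of t] by (simp add: power2_diff)
  also have "\<dots> = (2 * \<bar>sin (t / 2)\<bar>)\<^sup>2"
    using cos_double_sin[of "t / 2"] by (simp add: power_mult_distrib)
  finally show ?thesis by (rule power2_eq_imp_eq) auto
qed

lemma norm_cis_diff: "norm (cis s - cis t) = norm (cis (s - t) - 1)"
proof -
  have "cis s - cis t = cis t * (cis (s - t) - 1)" by (simp add: right_diff_distrib cis_mult)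
  then show ?thesis by (simp only: norm_mult norm_cis mult_1)
qed

lemma cis_pi_eq_1: "cis (pi * s) = 1 \<longleftrightarrow> (\<exists>k::int. s = 2 * of_int k)"
proof -
  have "cis (pi * s) = 1 \<longleftrightarrow> cos (pi * s) = 1"
    using sin_cos_squared_add[of "pi * s"] by (auto simp: complex_eq_iff simp del: sin_cos_squared_add)
  then show ?thesis by (auto simp: cos_one_2pi_int)
qed

text \<open>
How much an equation of positions fails, measured in the ambient space: the distance on the line,
the length of a chord on the circle.
\<close>

definition defect :: "coxeter \<Rightarrow> real \<Rightarrow> real" where
  "defect W s = norm (place_entry W s - place_entry W 0)"

lemma defect_eq_0: "defect W s = 0 \<longleftrightarrow> s \<in> lattice W"
  by (simp add: defect_def place_entry_def lattice_iff cis_pi_eq_1)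

lemma place_entry_lattice: "s - t \<in> lattice W \<Longrightarrow> place_entry W s = place_entry W t"
  using norm_cis_diff[of "pi * s" "pi * t"] cis_pi_eq_1[of "s - t"]
  by (auto simp: place_entry_def lattice_iff right_diff_distrib split: if_splits)

lemma place_entry_eq: "place_entry W s = place_entry W t \<longleftrightarrow> s - t \<in> lattice W"
proof
  assume eq: "place_entry W s = place_entry W t"
  show "s - t \<in> lattice W"
  proof (cases "toroidal W")
    case True
    with eq have "cis (pi * (s - t)) = 1"
      by (simp add: place_entry_def right_diff_distrib cis_divide[symmetric])
    then show ?thesis using True by (simp add: lattice_iff cis_pi_eq_1)
  qed (use eq in \<open>auto simp: place_entry_def lattice_iff\<close>)
qed (rule place_entry_lattice)

lemma defect_ge: 
  assumes "\<bar>s\<bar> \<le> 1 / 2"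
  shows "\<bar>s\<bar> \<le> defect W s"
proof (cases "toroidal W")
  case True
  define x where "x = pi * s / 2"
  have "(\<Sum>m<3. sin_coeff m * x ^ m) = x" by (simp add: sin_coeff_def numeral_3_eq_3)
  then have b: "\<bar>sin x - x\<bar> \<le> \<bar>x\<bar> ^ 3 / 6"
    using Maclaurin_sin_bound[of x 3] by (simp add: fact_numeral)
  have x1: "\<bar>x\<bar> \<le> 1"
  proof -
    have "pi * \<bar>s\<bar> \<le> 4 * (1 / 2)" using pi_less_4 assms by (intro mult_mono) auto
    then show ?thesis by (simp add: x_def abs_mult)
  qed
  have "\<bar>x\<bar> ^ 3 \<le> \<bar>x\<bar> ^ 1" using x1 by (intro power_decreasing) auto
  with b have "\<bar>sin x - x\<bar> \<le> \<bar>x\<bar> / 6" by simp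
  then have "\<bar>x\<bar> / 2 \<le> \<bar>sin x\<bar>" by linarith
  then have "pi / 2 * \<bar>s\<bar> \<le> 2 * \<bar>sin x\<bar>" by (simp add: x_def abs_mult)
  moreover have "1 * \<bar>s\<bar> \<le> pi / 2 * \<bar>s\<bar>" using pi_ge_two by (intro mult_right_mono) auto
  ultimately show ?thesis
    using True by (simp add: defect_def place_entry_def norm_cis_minus_1 x_def)
qed (simp add: defect_def place_entry_def)

lemma defect_lattice: "s - t \<in> lattice W \<Longrightarrow> defect W s = defect W t"
  by (simp add: defect_def place_entry_lattice)

text \<open>
An equation between positions is given by its linear part and by the value that it is to take.
Integrality and balance of the linear part say that the equation makes sense for configurations: it
does not depend on the choice of the coordinates of a point of the complex.
\<close>

definition balanced :: "coxeter \<Rightarrow> real^'n \<Rightarrow> bool" where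
  "balanced W a \<longleftrightarrow> (\<forall>i. a $ i \<in> \<int>) \<and> (W \<in> {TypeA, AffA} \<longrightarrow> (\<Sum>i\<in>UNIV. a $ i) = 0)"

lemma balanced_inner_lattice:
  fixes x y a :: "real^'n"
  assumes eq: "place W x = place W y" and a: "balanced W a"
  shows "a \<bullet> x - a \<bullet> y \<in> lattice W"
proof -
  have e: "coord_entry W x i j - coord_entry W y i j \<in> lattice W" for i j
    using arg_cong[OF eq, of "\<lambda>z. z $ i $ j"] by (simp add: place_nth place_entry_eq)
  obtain k :: 'n where True by blast
  let ?t = "if W = AffA then x $ k - y $ k else 0"
  have l: "x $ i - y $ i - ?t \<in> lattice W" for i
    using e[of i k] by (auto simp: coord_entry_def algebra_simps)
  have "a \<bullet> x - a \<bullet> y = (\<Sum>i\<in>UNIV. a $ i * (x $ i - y $ i - ?t)) + ?t * (\<Sum>i\<in>UNIV. a $ i)"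
    by (simp add: inner_vec_def sum_distrib_left sum.distrib[symmetric] sum_subtractf[symmetric] algebra_simps)
  also have "?t * (\<Sum>i\<in>UNIV. a $ i) = 0" using a by (auto simp: balanced_def)
  also have "(\<Sum>i\<in>UNIV. a $ i * (x $ i - y $ i - ?t)) + 0 \<in> lattice W"
    using a l by (auto simp: balanced_def intro!: lattice_sum lattice_mult)
  finally show ?thesis .
qed

definition solutions :: "coxeter \<Rightarrow> ((real^'n) \<times> real) set \<Rightarrow> (complex^'n^'n) set" where
  "solutions W E = place W ` {x \<in> coords W. \<forall>(a, c)\<in>E. a \<bullet> x - c \<in> lattice W}"

lemma place_in_solutions:
  assumes "x \<in> coords W" "\<And>a c. (a, c) \<in> E \<Longrightarrow> balanced W a"
  shows "place W x \<in> solutions W E \<longleftrightarrow> (\<forall>(a, c)\<in>E. a \<bullet> x - c \<in> lattice W)"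
proof
  assume "place W x \<in> solutions W E"
  then obtain y where y: "place W x = place W y" "\<forall>(a, c)\<in>E. a \<bullet> y - c \<in> lattice W"
    by (auto simp: solutions_def)
  have "a \<bullet> x - c \<in> lattice W" if "(a, c) \<in> E" for a c
  proof -
    have "(a \<bullet> x - a \<bullet> y) + (a \<bullet> y - c) \<in> lattice W"
      using y that assms by (intro lattice_add balanced_inner_lattice) auto
    then show ?thesis by simp
  qed
  then show "\<forall>(a, c)\<in>E. a \<bullet> x - c \<in> lattice W" by blast
qed (use assms in \<open>auto simp: solutions_def\<close>)

definition affine_roots :: "coxeter \<Rightarrow> ((real^'n) \<times> real) set" where
  "affine_roots W =
     {(axis i 1 - axis j 1, 0) | i j. i \<noteq> j}
   \<union> {(axis i 1 + axis j 1, 0) | i j. i \<noteq> j \<and> W \<notin> {TypeA, AffA}}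
   \<union> {(axis i 1, 0) | i. fixed_at_0 W}
   \<union> {(axis i 1, 1) | i. fixed_at_1 W}"

abbreviation wall :: "coxeter \<Rightarrow> (real^'n) \<times> real \<Rightarrow> (complex^'n^'n) set" where
  "wall W r \<equiv> solutions W {r}"

lemma axis_inner: "axis i (1::real) \<bullet> x = x $ i"
  by (simp add: inner_axis')

lemma affine_roots_cases [consumes 1, case_names minus plus zero one]:
  assumes "r \<in> affine_roots W"
  obtains i j where "i \<noteq> j" "r = (axis i 1 - axis j 1, 0)"
  | i j where "i \<noteq> j" "W \<notin> {TypeA, AffA}" "r = (axis i 1 + axis j 1, 0)"
  | i where "fixed_at_0 W" "r = (axis i 1, 0)"
  | i where "fixed_at_1 W" "r = (axis i 1, 1)"
proof -
  have "(\<exists>i j. i \<noteq> j \<and> r = (axis i 1 - axis j 1, 0)) \<or>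
    (\<exists>i j. i \<noteq> j \<and> W \<notin> {TypeA, AffA} \<and> r = (axis i 1 + axis j 1, 0)) \<or>
    (\<exists>i. fixed_at_0 W \<and> r = (axis i 1, 0)) \<or> (\<exists>i. fixed_at_1 W \<and> r = (axis i 1, 1))"
    using assms unfolding affine_roots_def Un_iff mem_Collect_eq by metis
  then show thesis using that by metis
qed

lemma image_setcompr:
  "f ` {g i j | i j. P i j} = {f (g i j) | i j. P i j}" "f ` {h i | i. Q} = {f (h i) | i. Q}"
  by (auto simp: image_def)

lemma hyperplanes_eq: "hyperplanes W = wall W ` (affine_roots W :: ((real^'n::finite) \<times> real) set)"
proof -
  have w: "wall W (axis i 1 - axis j 1, 0) = place W ` {x \<in> coords W. same_pos W (x $ i) (x $ j)}"
    "wall W (axis i 1 + axis j 1, 0) = place W ` {x \<in> coords W. same_pos W (x $ i) (- x $ j)}"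
    "wall W (axis i 1, t) = place W ` {x \<in> coords W. same_pos W (x $ i) t}" for i j :: 'n and t
    by (simp_all add: solutions_def same_pos_lattice inner_diff_left inner_add_left axis_inner)
  show ?thesis
    unfolding hyperplanes_def affine_roots_def image_Un w[symmetric] image_setcompr..
qed

lemma finite_affine_roots: "finite (affine_roots W :: ((real^'n) \<times> real) set)"
proof (rule finite_subset)
  show "affine_roots W \<subseteq> ((\<lambda>(i, j). (axis i 1 - axis j 1, 0)) ` (UNIV :: ('n \<times> 'n) set))
     \<union> ((\<lambda>(i, j). (axis i 1 + axis j 1, 0)) ` (UNIV :: ('n \<times> 'n) set))
     \<union> (\<lambda>i. (axis i 1, 0)) ` UNIV \<union> ((\<lambda>i. (axis i 1, 1)) ` UNIV)"
    by (auto simp: affine_roots_def)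
qed simp

lemma balanced_root: "(a, c) \<in> affine_roots W \<Longrightarrow> balanced W a"
  by (erule affine_roots_cases)
     (auto simp: balanced_def axis_def sum.distrib sum_subtractf fixed_at_0_def fixed_at_1_def)

lemma root_nonzero: "(a, c) \<in> affine_roots W \<Longrightarrow> a \<noteq> 0"
  by (erule affine_roots_cases)
     (auto simp: axis_def vec_eq_iff split: if_splits)

lemma root_nonzero': "r \<in> affine_roots W \<Longrightarrow> fst r \<noteq> 0"
  using root_nonzero[of "fst r" "snd r"] by simp

lemma spherical_root_level: "(a, c) \<in> affine_roots W \<Longrightarrow> \<not> toroidal W \<Longrightarrow> c = 0"
  by (erule affine_roots_cases) (auto simp: fixed_at_1_def toroidal_def)

lemma place_in_wall:
  assumes "x \<in> coords W" "(a, c) \<in> affine_roots W"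
  shows "place W x \<in> wall W (a, c) \<longleftrightarrow> a \<bullet> x - c \<in> lattice W"
  using balanced_root[OF assms(2)] by (subst place_in_solutions[OF assms(1)]) simp_all

text \<open>
The linear parts of all equations between positions, whether or not they belong to a hyperplane of
the type.  A flat may satisfy further equations: \<open>x\<^sub>i = x\<^sub>j\<close> and \<open>x\<^sub>i = - x\<^sub>j\<close> force \<open>2 x\<^sub>i = 0\<close>, so that
\<open>x\<^sub>i\<close> is constant on a component even if no hyperplane \<open>x\<^sub>i = 0\<close> is listed.
\<close>

definition directions :: "coxeter \<Rightarrow> (real^'n) set" where
  "directions W =
     {axis i 1 - axis j 1 | i j. i \<noteq> j}
   \<union> {axis i 1 + axis j 1 | i j. i \<noteq> j \<and> W \<notin> {TypeA, AffA}}
   \<union> {axis i 1 | i. W \<notin> {TypeA, AffA}}"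

lemma directionsI:
  "i \<noteq> j \<Longrightarrow> axis i 1 - axis j 1 \<in> directions W"
  "i \<noteq> j \<Longrightarrow> W \<notin> {TypeA, AffA} \<Longrightarrow> axis i 1 + axis j 1 \<in> directions W"
  "W \<notin> {TypeA, AffA} \<Longrightarrow> axis i 1 \<in> directions W"
  by (auto simp: directions_def)

lemma root_direction: "(a, c) \<in> affine_roots W \<Longrightarrow> a \<in> directions W"
  by (erule affine_roots_cases) (auto simp: directions_def fixed_at_0_def fixed_at_1_def)

text \<open>
Although positions are points of a circle, an equation between two of them is, up to a shift, the
restriction to the complex of a real affine equation of the ambient space: \<open>z\<^sub>i = e^(\<i> \<pi> c) z\<^sub>j\<close> is
linear, and \<open>- x\<^sub>j\<close> is obtained by complex conjugation.
\<close>

lemma direction_equation: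
  fixes a :: "real^'n"
  assumes "a \<in> directions W"
  obtains f :: "complex^'n^'n \<Rightarrow> complex" and k
  where "linear f" "\<And>x. norm (f (place W x) - k) = defect W (a \<bullet> x - c)"
proof -
  define P where "P = place_entry W"
  have e: "norm (P s - P t) = defect W (s - t)" for s t
    using norm_cis_diff[of "pi * s" "pi * t"]
    by (auto simp: P_def place_entry_def defect_def right_diff_distrib of_real_diff[symmetric] simp del: of_real_diff)
  have lin: "linear (\<lambda>z::complex^'n^'n. z $ i $ j)" for i j by (simp add: linear_iff)
  define m where "m = (\<lambda>z. if toroidal W then P c * z else z)"
  define k where "k = (if toroidal W then 0 else complex_of_real c)"
  have m: "linear m" "m (P t) + k = P (t + c)" for t
    by (auto simp: m_def k_def P_def place_entry_def linear_iff distrib_left cis_mult add.commute)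
  define g where "g = (if toroidal W then cnj else uminus)"
  have g: "linear g" "g (P s) = P (- s)" for s
    by (auto simp: g_def P_def place_entry_def cis_cnj linear_iff)
  have lm: "linear (\<lambda>z::complex^'n^'n. m (z $ i $ j))" for i j
    using linear_compose[OF lin m(1)] by (simp add: comp_def)
  have lg: "linear (\<lambda>z::complex^'n^'n. m (g (z $ i $ j)))" for i j
    using linear_compose[OF linear_compose[OF lin g(1)] m(1)] by (simp add: comp_def)
  have pl: "place W x $ i $ j = P (coord_entry W x i j)" for x :: "real^'n" and i j
    by (simp add: P_def place_nth)
  from assms consider i j where "i \<noteq> j" "a = axis i 1 - axis j 1" "W \<noteq> AffA"
    | i j where "i \<noteq> j" "a = axis i 1 - axis j 1" "W = AffA"
    | i j where "W \<noteq> AffA" "a = axis i 1 + axis j 1" | i where "W \<noteq> AffA" "a = axis i 1"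
    unfolding directions_def by auto
  then show ?thesis
  proof cases
    case (1 i j)
    have "norm (place W x $ i $ i - m (place W x $ j $ j) - k) = defect W (a \<bullet> x - c)" for x
      using 1 e[of "x $ i" "x $ j + c"] m(2)[of "x $ j"]
      by (simp add: pl coord_entry_def inner_diff_left axis_inner diff_diff_eq)
    then show ?thesis using linear_compose_sub[OF lin lm] by (rule that[rotated])
  next
    case (2 i j)
    have "norm (place W x $ i $ j - P c) = defect W (a \<bullet> x - c)" for x
      using e[of "x $ i - x $ j" c] unfolding pl 2(2) coord_entry_def
      by (simp add: inner_diff_left axis_inner 2(3))
    then show ?thesis using lin by (rule that[rotated])
  next
    case (3 i j)
    have "norm (place W x $ i $ i - m (g (place W x $ j $ j)) - k) = defect W (a \<bullet> x - c)" for x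
      using 3 e[of "x $ i" "- x $ j + c"] m(2)[of "- x $ j"]
      by (simp add: pl g coord_entry_def inner_add_left axis_inner diff_diff_eq diff_diff_eq2)
    then show ?thesis using linear_compose_sub[OF lin lg] by (rule that[rotated])
  next
    case (4 i)
    have "norm (place W x $ i $ i - P c) = defect W (a \<bullet> x - c)" for x
      using 4 e[of "x $ i" c] by (simp add: pl coord_entry_def axis_inner)
    then show ?thesis using lin by (rule that[rotated])
  qed
qed

text \<open>
Two oblique roots that are not parallel span a root system of type \<open>A\<^sub>2\<close> or \<open>B\<^sub>2\<close>, and the third root is the
reflection of the shorter one in the longer one.  Its level must fit, too: with an axis root
\<open>x\<^sub>i = c\<close> all axis roots \<open>x\<^sub>j = c\<close> are present, and \<open>2 c\<close> lies in the lattice.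
\<close>

lemma oblique_roots_third_root:
  fixes a1 a2 :: "real^'n"
  assumes r1: "(a1, c1) \<in> affine_roots W" and r2: "(a2, c2) \<in> affine_roots W"
    and oblique: "a1 \<bullet> a2 \<noteq> 0"
  shows "(\<exists>s\<in>{1, -1}. a2 = s *\<^sub>R a1) \<or>
    (\<exists>a3 c3 s1 s2. (a3, c3) \<in> affine_roots W \<and> s1 \<in> {1, -1} \<and> s2 \<in> {1, -1} \<and>
      a3 = s1 *\<^sub>R a1 + s2 *\<^sub>R a2 \<and> c3 - (s1 * c1 + s2 * c2) \<in> lattice W)"
proof -
  define P where "P i s = s *\<^sub>R (axis i (1::real) :: real^'n)" for i s
  define third where "third a1 c1 a2 c2 \<longleftrightarrow> (\<exists>a3 c3 s1 s2. (a3, c3) \<in> affine_roots W \<and>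
      s1 \<in> {1, -1} \<and> s2 \<in> {1, -1} \<and>
      a3 = s1 *\<^sub>R a1 + s2 *\<^sub>R a2 \<and> c3 - (s1 * c1 + s2 * c2) \<in> lattice W)"
    for a1 a2 :: "real^'n" and c1 c2 :: real
  have thirdI: "third a1 c1 a2 c2" if "(a3, c3) \<in> affine_roots W" "s1 \<in> {1, -1}" "s2 \<in> {1, -1}"
      "a3 = s1 *\<^sub>R a1 + s2 *\<^sub>R a2" "c3 - (s1 * c1 + s2 * c2) \<in> lattice W" for a1 a2 a3 c1 c2 c3 s1 s2
    using that unfolding third_def by (intro exI conjI)
  have sym: "third a2 c2 a1 c1" if th: "third a1 c1 a2 c2" for a1 c1 a2 c2
  proof -
    obtain a3 c3 s1 s2 where "(a3, c3) \<in> affine_roots W" "s1 \<in> {1, -1}" "s2 \<in> {1, -1}"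
      "a3 = s1 *\<^sub>R a1 + s2 *\<^sub>R a2" "c3 - (s1 * c1 + s2 * c2) \<in> lattice W"
      using th unfolding third_def by blast
    then show ?thesis unfolding third_def
      by (intro exI[of _ a3] exI[of _ c3] exI[of _ s2] exI[of _ s1]) (simp add: add.commute)
  qed
  have PP: "P i s \<bullet> P j t = (if i = j then s * t else 0)" for i j s t
    by (simp add: P_def inner_axis_axis)
  \<comment> \<open>The roots with two nonzero coordinates are long, the axis roots are short.\<close>
  define long where "long a c \<longleftrightarrow> c = (0::real) \<and> (\<exists>i j s t. i \<noteq> j \<and> s \<in> {1, -1} \<and> t \<in> {1, -1} \<and>
      (s = t \<longrightarrow> W \<notin> {TypeA, AffA}) \<and> a = P i s + P j t)" for a c
  define short where "short a c \<longleftrightarrow> (\<exists>i. a = P i 1) \<and> (\<forall>j. (P j 1, c) \<in> affine_roots W) \<and> 2 * c \<in> lattice W" for a c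
  have kinds: "long a c \<or> short a c" if "(a, c) \<in> affine_roots W" for a c
    using that
  proof (cases rule: affine_roots_cases)
    case (minus i j)
    then have "long a c" unfolding long_def
      by (intro conjI exI[of _ i] exI[of _ j] exI[of _ 1] exI[of _ "-1"]) (auto simp: P_def)
    then show ?thesis ..
  next
    case (plus i j)
    then have "long a c" unfolding long_def
      by (intro conjI exI[of _ i] exI[of _ j] exI[of _ 1] exI[of _ 1]) (auto simp: P_def)
    then show ?thesis ..
  next
    case (zero i)
    then have "short a c" unfolding short_def by (auto simp: P_def affine_roots_def)
    then show ?thesis ..
  next
    case (one i)
    then have "toroidal W" by (auto simp: fixed_at_1_def toroidal_def)
    with one have "short a c" unfolding short_def
      by (auto simp: P_def affine_roots_def lattice_iff intro: exI[of _ 1])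
    then show ?thesis ..
  qed
  have long_root: "\<exists>u\<in>{1, -1}. (u *\<^sub>R a, 0) \<in> affine_roots W" if l: "long a c" for a c
  proof -
    obtain i j s t where ij: "i \<noteq> j" "s \<in> {1, -1}" "t \<in> {1, -1}" "s = t \<longrightarrow> W \<notin> {TypeA, AffA}" "a = P i s + P j t"
      using l unfolding long_def by blast
    then consider "s = 1" "t = -1" | "s = -1" "t = 1" | "s = 1" "t = 1" | "s = -1" "t = -1" by auto
    then show ?thesis
    proof cases
      case 1
      have "(axis i 1 - axis j 1, 0) \<in> affine_roots W" using ij(1) by (auto simp: affine_roots_def)
      then show ?thesis using 1 ij by (intro bexI[of _ 1]) (auto simp: P_def)
    next
      case 2
      have "(axis j 1 - axis i 1, 0) \<in> affine_roots W" using ij(1) by (auto simp: affine_roots_def)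
      then show ?thesis using 2 ij by (intro bexI[of _ 1]) (auto simp: P_def)
    next
      case 3
      have "(axis i 1 + axis j 1, 0) \<in> affine_roots W" using ij 3 by (auto simp: affine_roots_def)
      then show ?thesis using 3 ij by (intro bexI[of _ 1]) (auto simp: P_def)
    next
      case 4
      have "(axis i 1 + axis j 1, 0) \<in> affine_roots W" using ij 4 by (auto simp: affine_roots_def)
      then show ?thesis using 4 ij by (intro bexI[of _ "-1"]) (auto simp: P_def add.commute)
    qed
  qed
  \<comment> \<open>Two long roots that share the coordinate \<open>p\<close>: eliminate it.\<close>
  have LL: "third (P p s + P j t) 0 (P p s' + P l t') 0"
    if "p \<noteq> j" "p \<noteq> l" "j \<noteq> l" "{s, s', t, t'} \<subseteq> {1, -1}"
      "s = t \<longrightarrow> W \<notin> {TypeA, AffA}" "s' = t' \<longrightarrow> W \<notin> {TypeA, AffA}" for p j l s t s' t'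
  proof -
    have h: "s = 1 \<or> s = -1" "s' = 1 \<or> s' = -1" "t = 1 \<or> t = -1" "t' = 1 \<or> t' = -1" using that by simp_all
    have sg: "- (s * s' * t') \<in> {1, -1}" using h by (elim disjE) simp_all
    have "t = - (s * s' * t') \<Longrightarrow> s = t \<or> s' = t'" using h by (elim disjE) simp_all
    then have "t = - (s * s' * t') \<longrightarrow> W \<notin> {TypeA, AffA}" using that(5,6) by metis
    then have "long (P j t + P l (- (s * s' * t'))) 0"
      unfolding long_def using that(3) h(3) sg
      by (intro conjI refl exI[of _ j] exI[of _ l] exI[of _ t] exI[of _ "- (s * s' * t')"]) simp_all
    then obtain u where u: "u \<in> {1, -1}" "(u *\<^sub>R (P j t + P l (- (s * s' * t'))), 0) \<in> affine_roots W"
      using long_root by metis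
    have ss: "s * s = 1" "s' * s' = 1" using h by auto
    then have "P j t + P l (- (s * s' * t')) = P p s + P j t - (s * s') *\<^sub>R (P p s' + P l t')"
      by (simp add: P_def scaleR_add_right mult.assoc)
    then have "u *\<^sub>R (P j t + P l (- (s * s' * t'))) = u *\<^sub>R (P p s + P j t - (s * s') *\<^sub>R (P p s' + P l t'))"
      by simp
    also have "\<dots> = u *\<^sub>R (P p s + P j t) + (- u * s * s') *\<^sub>R (P p s' + P l t')"
      using scaleR_diff_right[of u "P p s + P j t" "(s * s') *\<^sub>R (P p s' + P l t')"]
      by (simp only: scaleR_scaleR mult.assoc minus_mult_left[symmetric] scaleR_minus_left diff_conv_add_uminus)
    finally have "u *\<^sub>R (P j t + P l (- (s * s' * t'))) = u *\<^sub>R (P p s + P j t) + (- u * s * s') *\<^sub>R (P p s' + P l t')" .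
    moreover have "- u * s * s' \<in> {1, -1}" using h(1,2) u(1) by (elim disjE insertE) simp_all
    ultimately have e: "u *\<^sub>R (P j t + P l (- (s * s' * t'))) = u *\<^sub>R (P p s + P j t) + (- u * s * s') *\<^sub>R (P p s' + P l t')"
      and m: "- u * s * s' \<in> {1, -1}" by blast+
    show ?thesis by (rule thirdI[OF u(2) u(1) m e]) simp
  qed
  \<comment> \<open>A long root and a short one along its coordinate \<open>p\<close>: what is left is short.\<close>
  have LS: "third (P p s + P j t) 0 (P p 1) c" if "short (P p 1) c" "{s, t} \<subseteq> {1, -1}" for p j s t c
  proof -
    have h: "s = 1 \<or> s = -1" "t = 1 \<or> t = -1" using that by simp_all
    have "(P j 1, c) \<in> affine_roots W" and c: "2 * c \<in> lattice W" using that(1) unfolding short_def by blast+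
    moreover have "P j 1 = t *\<^sub>R (P p s + P j t) + (- s * t) *\<^sub>R P p 1"
      using h by (elim disjE) (simp_all add: P_def)
    moreover have "c - (t * 0 + - s * t * c) \<in> lattice W" using h c by (elim disjE) simp_all
    moreover have "t \<in> {1, -1}" using h(2) by simp
    moreover have "- s * t \<in> {1, -1}" using h by (elim disjE) simp_all
    ultimately show ?thesis by (intro thirdI)
  qed
  have LS': "third a c a' c'" if long: "long a c" and short: "short a' c'" and "a \<bullet> a' \<noteq> 0" for a c a' c'
  proof -
    obtain i j s t where ij: "s \<in> {1, -1}" "t \<in> {1, -1}" "a = P i s + P j t" "c = 0"
      using long unfolding long_def by blast
    obtain k where k: "a' = P k 1" using short unfolding short_def by blast
    have "k = i \<or> k = j" using that(3) ij k by (auto simp: inner_add_left PP split: if_splits)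
    then show ?thesis
    proof
      assume "k = i"
      then show ?thesis using LS[of i c' s t j] ij k short by simp
    next
      assume "k = j"
      then show ?thesis using LS[of j c' t s i] ij k short by (simp add: add.commute)
    qed
  qed
  have "(\<exists>s\<in>{1, -1}. a2 = s *\<^sub>R a1) \<or> third a1 c1 a2 c2"
    using kinds[OF r1] kinds[OF r2]
  proof (elim disjE)
    assume "long a1 c1" "short a2 c2"
    then show ?thesis using LS' oblique by metis
  next
    assume "short a1 c1" "long a2 c2"
    then show ?thesis using LS'[of a2 c2 a1 c1] sym oblique by (simp add: inner_commute)
  next
    assume "short a1 c1" "short a2 c2"
    then show ?thesis using oblique by (auto simp: short_def PP split: if_splits)
  next
    assume "long a1 c1" "long a2 c2"
    from \<open>long a1 c1\<close> obtain i j s t where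
      1: "i \<noteq> j" "{s, t} \<subseteq> {1, -1}" "s = t \<longrightarrow> W \<notin> {TypeA, AffA}" "a1 = P i s + P j t" "c1 = 0"
      unfolding long_def by auto
    from \<open>long a2 c2\<close> obtain k l s' t' where
      2: "k \<noteq> l" "{s', t'} \<subseteq> {1, -1}" "s' = t' \<longrightarrow> W \<notin> {TypeA, AffA}" "a2 = P k s' + P l t'" "c2 = 0"
      unfolding long_def by auto
    have signs: "s = 1 \<or> s = -1" "t = 1 \<or> t = -1" "s' = 1 \<or> s' = -1" "t' = 1 \<or> t' = -1"
      using 1(2) 2(2) by simp_all
    have ip: "(if i = k then s * s' else 0) + (if i = l then s * t' else 0)
        + (if j = k then t * s' else 0) + (if j = l then t * t' else 0) \<noteq> 0"
      using oblique unfolding 1 2 by (simp add: inner_add_left inner_add_right PP algebra_simps split del: if_split)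
    consider "i = k" "j = l" | "i = l" "j = k" | "i = k" "j \<noteq> l" | "i = l" "j \<noteq> k" | "j = k" "i \<noteq> l" | "j = l" "i \<noteq> k"
      using ip by (auto split: if_splits)
    then show ?thesis
    proof cases
      case 1
      have "s' = s \<and> t' = t \<or> s' = - s \<and> t' = - t"
        using ip 1 \<open>i \<noteq> j\<close> signs by (elim disjE) simp_all
      then have "a2 = a1 \<or> a2 = - a1" using 1 \<open>a1 = _\<close> \<open>a2 = _\<close> by (auto simp: P_def)
      then show ?thesis by auto
    next
      case 2
      have "s' = t \<and> t' = s \<or> s' = - t \<and> t' = - s"
        using ip 2 \<open>i \<noteq> j\<close> signs by (elim disjE) simp_all
      then have "a2 = a1 \<or> a2 = - a1" using 2 \<open>a1 = _\<close> \<open>a2 = _\<close> by (auto simp: P_def)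
      then show ?thesis by auto
    next
      case 3
      then show ?thesis using LL[of i j l s s' t t'] 1 2 by auto
    next
      case 4
      then show ?thesis using LL[of i j k s t' t s'] 1 2 by (auto simp: add.commute)
    next
      case 5
      then show ?thesis using LL[of j i l t s' s t'] 1 2 by (auto simp: add.commute)
    next
      case 6
      then show ?thesis using LL[of j i k t t' s s'] 1 2 by (auto simp: add.commute)
    qed
  qed
  then show ?thesis unfolding third_def by simp
qed


section \<open>Flats\<close>

definition kernel :: "((real^'n) \<times> real) set \<Rightarrow> (real^'n) set" where
  "kernel R = {v. \<forall>r\<in>R. fst r \<bullet> v = 0}"

definition roots_through :: "coxeter \<Rightarrow> (complex^'n^'n) set \<Rightarrow> ((real^'n) \<times> real) set" where
  "roots_through W \<alpha> = {r \<in> affine_roots W. \<alpha> \<subseteq> wall W r}"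

definition tangent :: "coxeter \<Rightarrow> (complex^'n^'n) set \<Rightarrow> (real^'n) set" where
  "tangent W \<alpha> = kernel (roots_through W \<alpha>)"

lemma subspace_kernel: "subspace (kernel R)"
  by (auto simp: kernel_def subspace_def inner_add_right)

lemma kernelD: "v \<in> kernel R \<Longrightarrow> (a, c) \<in> R \<Longrightarrow> a \<bullet> v = 0"
  by (force simp: kernel_def)

lemma Hs_eq: "Hs W \<alpha> = wall W ` roots_through W \<alpha>"
  by (auto simp: Hs_def hyperplanes_eq roots_through_def)

lemma inner_ones: "a \<bullet> (\<chi> i. 1) = (\<Sum>i\<in>UNIV. a $ i)" for a :: "real^'n"
  by (simp add: inner_vec_def)

lemma ones_in_kernel: "W \<in> {TypeA, AffA} \<Longrightarrow> R \<subseteq> affine_roots W \<Longrightarrow> (\<chi> i. 1) \<in> kernel R"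
proof -
  assume W: "W \<in> {TypeA, AffA}" and R: "R \<subseteq> affine_roots W"
  have "a \<bullet> (\<chi> i. 1) = 0" if "(a, c) \<in> R" for a c
    using balanced_root[OF subsetD[OF R that]] W by (auto simp: balanced_def inner_ones)
  then show ?thesis by (force simp: kernel_def)
qed

lemma coords_spherical: "\<not> toroidal W \<Longrightarrow> x \<in> coords W \<longleftrightarrow> norm x = 1 \<and> (W = TypeA \<longrightarrow> x \<bullet> (\<chi> i. 1) = 0)"
  by (auto simp: coords_def inner_ones)

lemma coords_toroidal: "toroidal W \<Longrightarrow> x \<in> coords W"
  by (simp add: coords_def)

text \<open>
On the circle a functional whose values stay in a coset of the discrete lattice along a line is
constant on it; on the sphere the values at antipodal points must agree.
\<close>

lemma functional_vanishes:
  fixes a :: "real^'n"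
  assumes U: "subspace U" and x0: "x0 \<in> coords W" "\<not> toroidal W \<Longrightarrow> x0 \<in> U"
    and ones: "W = TypeA \<Longrightarrow> (\<chi> i. 1) \<in> U" and a: "balanced W a"
    and eq: "\<And>x. x \<in> coords W \<Longrightarrow> x - x0 \<in> U \<Longrightarrow> a \<bullet> x - c \<in> lattice W"
    and v: "v \<in> U"
  shows "a \<bullet> v = 0"
proof (cases "toroidal W")
  case True
  have "(a \<bullet> x0 - c) + s * (a \<bullet> v) \<in> lattice W" for s
    using eq[of "x0 + s *\<^sub>R v"] subspace_scale[OF U v] True
    by (simp add: coords_toroidal inner_add_right algebra_simps)
  then show ?thesis by (rule lattice_line)
next
  case False
  define t where "t = (if W = TypeA then (v \<bullet> (\<chi> i. 1)) / CARD('n) else 0)"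
  define w where "w = v - t *\<^sub>R (\<chi> i. 1)"
  have wU: "w \<in> U"
    unfolding w_def t_def using ones v U by (auto intro!: subspace_diff subspace_scale)
  have "(\<chi> i. 1) \<bullet> (\<chi> i. 1 :: real^'n) = real CARD('n)" by (simp add: inner_vec_def)
  then have w1: "W = TypeA \<longrightarrow> w \<bullet> (\<chi> i. 1) = 0"
    by (simp add: w_def t_def inner_diff_left)
  have "W = TypeA \<Longrightarrow> a \<bullet> (\<chi> i. 1) = 0" using a by (simp add: balanced_def inner_ones)
  then have av: "a \<bullet> v = a \<bullet> w" by (auto simp: w_def t_def inner_diff_right)
  show ?thesis
  proof (cases "w = 0")
    case False
    have "a \<bullet> (s *\<^sub>R w) - c = 0" if "\<bar>s\<bar> * norm w = 1" for s
    proof -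
      have "s *\<^sub>R w \<in> coords W" using that w1 \<open>\<not> toroidal W\<close> by (simp add: coords_spherical)
      moreover have "s *\<^sub>R w - x0 \<in> U" using wU x0(2) \<open>\<not> toroidal W\<close> by (intro subspace_diff[OF U] subspace_scale[OF U]) auto
      ultimately show ?thesis using eq \<open>\<not> toroidal W\<close> by (force simp: lattice_iff)
    qed
    from this[of "1 / norm w"] this[of "- 1 / norm w"] show ?thesis using False av by simp
  qed (use av in simp)
qed

lemma continuous_place: "continuous_on S (place W)"
  unfolding place_def
  by (cases "W = AffA"; cases "toroidal W"; simp; intro continuous_on_vec_lambda continuous_intros)

lemma place_eqI: 
  assumes "\<And>i. x $ i - y $ i \<in> lattice W"
  shows "place W x = place W y"
proof -
  have "coord_entry W x i j - coord_entry W y i j \<in> lattice W" for i j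
  proof (cases "W = AffA")
    case True
    then show ?thesis using lattice_diff[OF assms[of i] assms[of j]] by (simp add: coord_entry_def algebra_simps)
  qed (use assms[of i] in \<open>simp add: coord_entry_def\<close>)
  then show ?thesis by (simp add: vec_eq_iff place_nth place_entry_lattice)
qed

lemma pieces_subset: "\<alpha> \<in> pieces W S \<Longrightarrow> \<alpha> \<subseteq> S"
  by (auto simp: pieces_def split: if_splits dest: in_components_subset)

lemma pieces_maximal: "\<alpha> \<in> pieces W S \<Longrightarrow> toroidal W \<Longrightarrow> connected T \<Longrightarrow> T \<subseteq> S \<Longrightarrow> q \<in> T \<Longrightarrow> q \<in> \<alpha> \<Longrightarrow> T \<subseteq> \<alpha>"
  using components_maximal[of \<alpha> S T] by (auto simp: pieces_def)

lemma pieces_connected: "\<alpha> \<in> pieces W S \<Longrightarrow> toroidal W \<Longrightarrow> connected \<alpha>"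
  by (auto simp: pieces_def dest: in_components_connected)

lemma pieces_spherical: "\<not> toroidal W \<Longrightarrow> \<alpha> \<in> pieces W S \<longleftrightarrow> \<alpha> = S"
  by (simp add: pieces_def)

lemma piece_exists:
  assumes "q \<in> S"
  obtains \<alpha> where "\<alpha> \<in> pieces W S" "q \<in> \<alpha>"
proof (cases "toroidal W")
  case True
  then show ?thesis using that[of "connected_component_set S q"] assms
    by (simp add: pieces_def componentsI connected_component_refl)
qed (use that[of S] assms in \<open>simp add: pieces_def\<close>)

lemma pieces_shrink:
  assumes \<alpha>: "\<alpha> \<in> pieces W S" and "\<alpha> \<noteq> {}" "\<alpha> \<subseteq> T" "T \<subseteq> S"
  shows "\<alpha> \<in> pieces W T"
proof (cases "toroidal W")
  case True
  obtain q where q: "q \<in> \<alpha>" using assms(2) by blast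
  obtain \<beta> where \<beta>: "\<beta> \<in> pieces W T" "q \<in> \<beta>" using q assms(3) piece_exists[of q T W] by blast
  have "\<alpha> \<subseteq> \<beta>" using pieces_maximal[OF \<beta>(1) True pieces_connected[OF \<alpha> True] assms(3) q \<beta>(2)] .
  moreover have "\<beta> \<subseteq> \<alpha>"
    using pieces_maximal[OF \<alpha> True pieces_connected[OF \<beta>(1) True] _ \<beta>(2) q] pieces_subset[OF \<beta>(1)] assms(4) by blast
  ultimately show ?thesis using \<beta>(1) by simp
qed (use assms in \<open>auto simp: pieces_def\<close>)

lemma pieces_mem:
  fixes x0 x :: "real^'n"
  assumes \<alpha>: "\<alpha> \<in> pieces W S" and U: "subspace U" and x0: "place W x0 \<in> \<alpha>"
    and S: "\<And>y. y \<in> coords W \<Longrightarrow> y - x0 \<in> U \<Longrightarrow> place W y \<in> S"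
    and x: "x \<in> coords W" "x - x0 \<in> U"
  shows "place W x \<in> \<alpha>"
proof (cases "toroidal W")
  case True
  let ?T = "place W ` closed_segment x0 x"
  have "connected ?T" by (rule connected_continuous_image[OF continuous_place connected_segment(1)])
  moreover have "?T \<subseteq> S"
  proof clarify
    fix y assume "y \<in> closed_segment x0 x"
    then obtain u where "y = (1 - u) *\<^sub>R x0 + u *\<^sub>R x" by (auto simp: closed_segment_def)
    then have "y - x0 = u *\<^sub>R (x - x0)" by (simp add: algebra_simps)
    then show "place W y \<in> S" using S[of y] x(2) U True by (simp add: subspace_scale coords_toroidal)
  qed
  ultimately have "?T \<subseteq> \<alpha>" using x0 by (intro pieces_maximal[OF \<alpha> True, where q="place W x0"]) auto
  then show ?thesis by auto
qed (use assms in \<open>simp add: pieces_def\<close>)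

lemma intersectionsE:
  assumes "\<alpha> \<in> intersections W"
  obtains R where "R \<subseteq> affine_roots W" "R \<noteq> {}" "\<alpha> \<in> pieces W (\<Inter>(wall W ` R))" "\<alpha> \<noteq> {}"
proof -
  obtain F where F: "F \<subseteq> wall W ` affine_roots W" "F \<noteq> {}" "\<alpha> \<in> pieces W (\<Inter>F)" "\<alpha> \<noteq> {}"
    using assms unfolding intersections_def hyperplanes_eq by blast
  then obtain R where "R \<subseteq> affine_roots W" "F = wall W ` R" by (auto simp: subset_image_iff)
  then show ?thesis using F that by blast
qed

lemma intersectionsI:
  assumes "R \<subseteq> affine_roots W" "R \<noteq> {}" "\<alpha> \<in> pieces W (\<Inter>(wall W ` R))" "q \<in> \<alpha>"
  shows "\<alpha> \<in> intersections W"
proof -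
  have "wall W ` R \<subseteq> hyperplanes W" "wall W ` R \<noteq> {}" using assms by (auto simp: hyperplanes_eq)
  then show ?thesis using assms unfolding intersections_def by blast
qed

lemma kernel_in_cut:
  assumes R: "R \<subseteq> affine_roots W" and x: "x0 \<in> coords W" "x \<in> coords W"
    and q: "place W x0 \<in> \<Inter>(wall W ` R)" and k: "x - x0 \<in> kernel R"
  shows "place W x \<in> \<Inter>(wall W ` R)"
proof (rule InterI)
  fix h assume "h \<in> wall W ` R"
  then obtain a c where ac: "(a, c) \<in> R" "h = wall W (a, c)" by auto
  then have "(a, c) \<in> affine_roots W" using R by auto
  then show "place W x \<in> h" using ac q kernelD[OF k ac(1)] x
    by (auto simp: place_in_wall inner_diff_right)
qed

lemma spherical_in_kernel:
  assumes "R \<subseteq> affine_roots W" "x0 \<in> coords W" "place W x0 \<in> \<Inter>(wall W ` R)" "\<not> toroidal W"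
  shows "x0 \<in> kernel R"
proof -
  have "a \<bullet> x0 = 0" if ac: "(a, c) \<in> R" for a c
  proof -
  have "(a, c) \<in> R" by (rule ac)
  then have r: "(a, c) \<in> affine_roots W" using assms(1) by auto
  have "place W x0 \<in> wall W (a, c)" using assms(3) ac by auto
  then show "a \<bullet> x0 = 0"
    using place_in_wall[OF assms(2) r] spherical_root_level[OF r assms(4)] assms(4) by (simp add: lattice_iff)
  qed
  then show ?thesis by (auto simp: kernel_def)
qed

text \<open>
Some roots that cut out a flat suffice to determine its tangent space: every other root through the
flat is constant on the flat, hence vanishes on their common kernel.
\<close>

lemma tangent_eq_kernel:
  assumes R: "R \<subseteq> affine_roots W" and \<alpha>: "\<alpha> \<in> pieces W (\<Inter>(wall W ` R))"
    and x0: "x0 \<in> coords W" "place W x0 \<in> \<alpha>"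
  shows "tangent W \<alpha> = kernel R"
proof
  have "R \<subseteq> roots_through W \<alpha>" using R pieces_subset[OF \<alpha>] by (auto simp: roots_through_def)
  then show "tangent W \<alpha> \<subseteq> kernel R" by (auto simp: tangent_def kernel_def)
  have q: "place W x0 \<in> \<Inter>(wall W ` R)" using pieces_subset[OF \<alpha>] x0(2) by (rule subsetD)
  show "kernel R \<subseteq> tangent W \<alpha>"
  proof
    fix v assume v: "v \<in> kernel R"
    have "a \<bullet> v = 0" if ac: "(a, c) \<in> roots_through W \<alpha>" for a c
    proof -
      have r: "(a, c) \<in> affine_roots W" "\<alpha> \<subseteq> wall W (a, c)" using ac by (auto simp: roots_through_def)
      have eq: "a \<bullet> x - c \<in> lattice W" if x: "x \<in> coords W" "x - x0 \<in> kernel R" for x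
      proof -
        have "place W x \<in> \<alpha>"
          by (rule pieces_mem[OF \<alpha> subspace_kernel x0(2) kernel_in_cut[OF R x0(1) _ q] x])
        then show ?thesis using r(2) place_in_wall[OF x(1) r(1)] by blast
      qed
      have "W = TypeA \<Longrightarrow> (\<chi> i. 1) \<in> kernel R" using ones_in_kernel[OF _ R] by simp
      from functional_vanishes[OF subspace_kernel x0(1) spherical_in_kernel[OF R x0(1) q] this
          balanced_root[OF r(1)] eq v] show ?thesis .
    qed
    then show "v \<in> tangent W \<alpha>" by (force simp: tangent_def kernel_def)
  qed
qed

lemma subspace_tangent: "subspace (tangent W \<alpha>)"
  by (simp add: tangent_def subspace_kernel)

lemma flat_mem:
  assumes \<alpha>: "\<alpha> \<in> intersections W" and x: "x0 \<in> coords W" "place W x0 \<in> \<alpha>" "x \<in> coords W" "x - x0 \<in> tangent W \<alpha>"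
  shows "place W x \<in> \<alpha>"
proof -
  obtain R where R: "R \<subseteq> affine_roots W" "R \<noteq> {}" "\<alpha> \<in> pieces W (\<Inter>(wall W ` R))"
    using intersectionsE[OF \<alpha>] by metis
  have q: "place W x0 \<in> \<Inter>(wall W ` R)" using pieces_subset[OF R(3)] x(2) by (rule subsetD)
  show ?thesis
    using pieces_mem[OF R(3) subspace_kernel x(2) kernel_in_cut[OF R(1) x(1) _ q] x(3)]
      tangent_eq_kernel[OF R(1,3) x(1,2)] x(4) by simp
qed

lemma spherical_in_tangent:
  assumes "x0 \<in> coords W" "place W x0 \<in> \<alpha>" "\<not> toroidal W"
  shows "x0 \<in> tangent W \<alpha>"
  unfolding tangent_def
  by (rule spherical_in_kernel[OF _ assms(1) _ assms(3)]) (use assms(2) in \<open>auto simp: roots_through_def\<close>)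

lemma ones_in_tangent: "W \<in> {TypeA, AffA} \<Longrightarrow> (\<chi> i. 1) \<in> tangent W \<alpha>"
  unfolding tangent_def by (rule ones_in_kernel) (auto simp: roots_through_def)

lemma flat_points: "\<alpha> \<in> intersections W \<Longrightarrow> z \<in> \<alpha> \<Longrightarrow> \<exists>x\<in>coords W. z = place W x"
proof -
  assume \<alpha>: "\<alpha> \<in> intersections W" and z: "z \<in> \<alpha>"
  obtain R where "R \<noteq> {}" "\<alpha> \<in> pieces W (\<Inter>(wall W ` R))" using intersectionsE[OF \<alpha>] by metis
  then obtain r where "z \<in> wall W r" using pieces_subset z by blast
  then show ?thesis by (auto simp: solutions_def)
qed

lemma linear_eq_on_affine_hull:
  fixes f :: "'e::real_vector \<Rightarrow> 'f::real_vector"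
  assumes "linear f" "\<And>z. z \<in> S \<Longrightarrow> f z = k" "y \<in> affine hull S"
  shows "f y = k"
proof -
  have "affine {z. f z = k}"
    unfolding affine_def using assms(1) by (auto simp: linear_add linear_scale scaleR_add_left[symmetric])
  then have "affine hull S \<subseteq> {z. f z = k}" using assms(2) by (intro hull_minimal) auto
  then show ?thesis using assms(3) by auto
qed

text \<open>
A wall is cut out of the complex by an affine equation of the ambient space, which persists on
affine hulls.
\<close>

lemma affine_hull_in_wall:
  fixes \<alpha> :: "(complex^'n^'n) set"
  assumes r: "(a, c) \<in> affine_roots W" and "\<alpha> \<subseteq> wall W (a, c)" and y: "y \<in> coords W" "place W y \<in> affine hull \<alpha>"
  shows "place W y \<in> wall W (a, c)"
proof -
  obtain f :: "complex^'n^'n \<Rightarrow> complex" and k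
    where f: "linear f" "\<And>x. norm (f (place W x) - k) = defect W (a \<bullet> x - c)"
    by (rule direction_equation[OF root_direction[OF r], where c=c]) (rule that)
  have "f z = k" if "z \<in> \<alpha>" for z
  proof -
    have "z \<in> wall W (a, c)" using assms(2) that by auto
    then obtain x where "x \<in> coords W" "z = place W x" "a \<bullet> x - c \<in> lattice W" by (auto simp: solutions_def)
    then show ?thesis using f(2)[of x] by (simp add: defect_eq_0[THEN iffD2])
  qed
  from linear_eq_on_affine_hull[OF f(1) this y(2)] have "defect W (a \<bullet> y - c) = 0" using f(2)[of y] by simp
  then show ?thesis using place_in_wall[OF y(1) r] by (simp add: defect_eq_0)
qed

text \<open>
On a torus the point even lies on the flat.  On the sphere the affine hull of a flat is linear, as
the flat contains with a point also its antipode.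
\<close>

lemma place_tangent_affine_hull:
  fixes x0 :: "real^'n"
  assumes \<alpha>: "\<alpha> \<in> intersections W" and x0: "x0 \<in> coords W" "place W x0 \<in> \<alpha>"
    and v: "v \<in> tangent W \<alpha>" "W = TypeA \<Longrightarrow> v \<bullet> (\<chi> i. 1) = 0"
  shows "place W (x0 + v) \<in> affine hull \<alpha>"
proof (cases "toroidal W")
  case True
  then show ?thesis using flat_mem[OF \<alpha> x0, of "x0 + v"] v(1) by (simp add: coords_toroidal hull_inc)
next
  case False
  let ?V = "tangent W \<alpha>"
  have x0V: "x0 \<in> ?V" using spherical_in_tangent[OF x0 False] .
  define y where "y = x0 + v"
  define u where "u = (if y = 0 then x0 else y /\<^sub>R norm y)"
  have yV: "y \<in> ?V" unfolding y_def using x0V v(1) subspace_tangent by (intro subspace_add) auto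
  have uV: "u \<in> ?V" unfolding u_def using x0V yV subspace_tangent by (auto intro: subspace_scale)
  have y1: "W = TypeA \<longrightarrow> y \<bullet> (\<chi> i. 1) = 0" using v(2) x0(1) False by (auto simp: y_def inner_add_left coords_spherical)
  have uc: "u \<in> coords W" "- u \<in> coords W"
    using y1 x0(1) False by (auto simp: u_def coords_spherical)
  have yu: "y = norm y *\<^sub>R u" by (simp add: u_def)
  have "u - x0 \<in> ?V" "- u - x0 \<in> ?V" using uV x0V subspace_tangent by (auto intro!: subspace_diff subspace_neg)
  then have m: "place W u \<in> \<alpha>" "place W (- u) \<in> \<alpha>" using flat_mem[OF \<alpha> x0] uc by auto
  have pl: "place W x $ i $ j = complex_of_real (x $ i)" for x :: "real^'n" and i j
    using False by (simp add: place_def toroidal_def)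
  have "place W y = ((1 + norm y) / 2) *\<^sub>R place W u + ((1 - norm y) / 2) *\<^sub>R place W (- u)"
  proof (subst vec_eq_iff, intro allI, subst vec_eq_iff, intro allI)
    fix i j
    have "((1 + norm y) / 2) *\<^sub>R complex_of_real (u $ i) + ((1 - norm y) / 2) *\<^sub>R complex_of_real (- u $ i)
      = complex_of_real (((1 + norm y) / 2) * u $ i + ((1 - norm y) / 2) * - u $ i)"
      by (simp only: scaleR_conv_of_real of_real_add of_real_mult)
    also have "((1 + norm y) / 2) * u $ i + ((1 - norm y) / 2) * - u $ i = norm y * u $ i" by (simp add: field_simps)
    also have "\<dots> = y $ i" using arg_cong[OF yu, of "\<lambda>x. x $ i"] by simp
    finally show "place W y $ i $ j = (((1 + norm y) / 2) *\<^sub>R place W u + ((1 - norm y) / 2) *\<^sub>R place W (- u)) $ i $ j"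
      by (simp add: pl)
  qed
  moreover have "((1 + norm y) / 2) *\<^sub>R place W u + ((1 - norm y) / 2) *\<^sub>R place W (- u) \<in> affine hull \<alpha>"
    using m by (intro mem_affine[OF affine_affine_hull]) (auto simp: hull_inc field_simps)
  ultimately show ?thesis by (simp add: y_def)
qed


lemma box_representative:
  fixes x :: "real^'n"
  assumes "toroidal W"
  obtains y where "place W y = place W x" "norm y \<le> CARD('n)" 
proof -
  define y where "y = (\<chi> i. x $ i - 2 * real_of_int \<lfloor>(x $ i + 1) / 2\<rfloor>)"
  have "y $ i - x $ i \<in> lattice W" for i
    using assms by (auto simp: y_def lattice_iff intro!: exI[of _ "- \<lfloor>(x $ i + 1) / 2\<rfloor>"])
  then have "place W y = place W x" by (rule place_eqI)
  moreover have "\<bar>y $ i\<bar> \<le> 1" for i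
  proof -
    have "real_of_int \<lfloor>(x $ i + 1) / 2\<rfloor> \<le> (x $ i + 1) / 2" "(x $ i + 1) / 2 < real_of_int \<lfloor>(x $ i + 1) / 2\<rfloor> + 1"
      by linarith+
    then show ?thesis by (auto simp: y_def abs_le_iff field_simps)
  qed
  then have "norm y \<le> CARD('n)"
    using norm_le_l1_cart[of y] sum_mono[of UNIV "\<lambda>i. \<bar>y $ i\<bar>" "\<lambda>_. 1"] by simp
  ultimately show ?thesis by (rule that)
qed

lemma finite_image_factor:
  assumes "finite (T ` Q)" "\<And>x y. x \<in> Q \<Longrightarrow> y \<in> Q \<Longrightarrow> T x = T y \<Longrightarrow> F x = F y"
  shows "finite (F ` Q)"
proof -
  have "F ` Q \<subseteq> (\<lambda>t. F (SOME x. x \<in> Q \<and> T x = t)) ` (T ` Q)"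
  proof
    fix z assume "z \<in> F ` Q"
    then obtain x where x: "x \<in> Q" "z = F x" by blast
    then have "\<exists>y. y \<in> Q \<and> T y = T x" by blast
    from someI_ex[OF this]
    have "(SOME y. y \<in> Q \<and> T y = T x) \<in> Q" "T (SOME y. y \<in> Q \<and> T y = T x) = T x" by auto
    then have "F (SOME y. y \<in> Q \<and> T y = T x) = z" using assms(2) x by blast
    then show "z \<in> (\<lambda>t. F (SOME x. x \<in> Q \<and> T x = t)) ` (T ` Q)" using x by blast
  qed
  then show ?thesis using assms(1) by (meson finite_imageI finite_subset)
qed

lemma finite_bounded_lattice: "finite {s::real. s - c \<in> lattice W \<and> \<bar>s\<bar> \<le> B}"
proof -
  have "{s. s - c \<in> lattice W \<and> \<bar>s\<bar> \<le> B} \<subseteq> (\<lambda>k::int. c + 2 * of_int k) ` {- \<lceil>B + \<bar>c\<bar>\<rceil>..\<lceil>B + \<bar>c\<bar>\<rceil>}"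
  proof
    fix s assume "s \<in> {s. s - c \<in> lattice W \<and> \<bar>s\<bar> \<le> B}"
    then have s: "s - c \<in> lattice W" "\<bar>s\<bar> \<le> B" by auto
    then obtain k :: int where k: "s - c = 2 * of_int k" by (auto simp: lattice_iff split: if_splits)
    then have "\<bar>real_of_int k\<bar> \<le> B + \<bar>c\<bar>" using s(2) by linarith
    then have "k \<in> {- \<lceil>B + \<bar>c\<bar>\<rceil>..\<lceil>B + \<bar>c\<bar>\<rceil>}" by (auto simp: abs_le_iff) linarith+
    moreover have "s = c + 2 * of_int k" using k by simp
    ultimately show "s \<in> (\<lambda>k::int. c + 2 * of_int k) ` {- \<lceil>B + \<bar>c\<bar>\<rceil>..\<lceil>B + \<bar>c\<bar>\<rceil>}" by blast
  qed
  then show ?thesis by (rule finite_subset) simp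
qed

text \<open>
  On a toroidal flat the value of a functional that vanishes on the tangent space can, modulo the
  lattice, only take finitely many values; as the flat is connected, it takes only one.
\<close>

lemma direction_constant:
  fixes a x0 y :: "real^'n"
  assumes t: "toroidal W" and R: "R \<subseteq> affine_roots W" and \<alpha>: "\<alpha> \<in> pieces W (\<Inter>(wall W ` R))" "R \<noteq> {}"
    and x0: "place W x0 \<in> \<alpha>" and a: "a \<in> directions W" "\<And>v. v \<in> kernel R \<Longrightarrow> a \<bullet> v = 0"
    and y: "place W y \<in> affine hull \<alpha>"
  shows "a \<bullet> y - a \<bullet> x0 \<in> lattice W"
proof -
  obtain f :: "complex^'n^'n \<Rightarrow> complex" and k
    where f: "linear f" "\<And>x. norm (f (place W x) - k) = defect W (a \<bullet> x - a \<bullet> x0)"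
    by (rule direction_equation[OF a(1), where c="a \<bullet> x0"]) (rule that)
  define Q where "Q = {x :: real^'n. norm x \<le> CARD('n) \<and> place W x \<in> \<alpha>}"
  define T where "T x = (\<lambda>r\<in>R. fst r \<bullet> x)" for x
  have finR: "finite R" using R finite_affine_roots finite_subset by blast
  have "T ` Q \<subseteq> Pi\<^sub>E R (\<lambda>r. {s. s - snd r \<in> lattice W \<and> \<bar>s\<bar> \<le> norm (fst r) * CARD('n)})"
  proof (intro image_subsetI PiE_I)
    fix x r assume x: "x \<in> Q" and r: "r \<in> R"
    have "place W x \<in> wall W r" using x r pieces_subset[OF \<alpha>(1)] by (auto simp: Q_def)
    then have "fst r \<bullet> x - snd r \<in> lattice W"
      using place_in_wall[of x W "fst r" "snd r"] r R t by (auto simp: coords_toroidal)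
    moreover have "\<bar>fst r \<bullet> x\<bar> \<le> norm (fst r) * CARD('n)"
      using Cauchy_Schwarz_ineq2[of "fst r" x] x mult_left_mono[of "norm x" "CARD('n)" "norm (fst r)"]
      by (auto simp: Q_def)
    ultimately show "T x r \<in> {s. s - snd r \<in> lattice W \<and> \<bar>s\<bar> \<le> norm (fst r) * CARD('n)}"
      using r by (simp add: T_def)
  qed (simp add: T_def)
  then have finT: "finite (T ` Q)"
    by (rule finite_subset) (intro finite_PiE finR finite_bounded_lattice)
  have same: "norm (f (place W x) - k) = norm (f (place W x') - k)" if "T x = T x'" for x x'
  proof -
    have "fst r \<bullet> (x - x') = 0" if "r \<in> R" for r
      using fun_cong[OF \<open>T x = T x'\<close>, of r] that by (simp add: T_def inner_diff_right)
    then have "x - x' \<in> kernel R" by (simp add: kernel_def)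
    from a(2)[OF this] show ?thesis by (simp add: f(2) inner_diff_right)
  qed
  have "finite ((\<lambda>x. norm (f (place W x) - k)) ` Q)" by (rule finite_image_factor[OF finT same])
  moreover have "(\<lambda>z. norm (f z - k)) ` \<alpha> \<subseteq> (\<lambda>x. norm (f (place W x) - k)) ` Q"
  proof
    fix s assume "s \<in> (\<lambda>z. norm (f z - k)) ` \<alpha>"
    then obtain z where z: "z \<in> \<alpha>" "s = norm (f z - k)" by blast
    obtain r where "r \<in> R" using \<alpha>(2) by blast
    then have "z \<in> wall W r" using z(1) pieces_subset[OF \<alpha>(1)] by blast
    then obtain x where x: "z = place W x" by (auto simp: solutions_def)
    obtain x' :: "real^'n" where "place W x' = place W x" "norm x' \<le> CARD('n)" by (rule box_representative[OF t]) (rule that)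
    then have "x' \<in> Q" "s = norm (f (place W x') - k)" using z x by (auto simp: Q_def)
    then show "s \<in> (\<lambda>x. norm (f (place W x) - k)) ` Q" by blast
  qed
  ultimately have "finite ((\<lambda>z. norm (f z - k)) ` \<alpha>)" by (rule finite_subset[rotated])
  moreover have "continuous_on \<alpha> (\<lambda>z. norm (f z - k))"
    by (intro continuous_on_norm continuous_on_diff continuous_on_const linear_continuous_on
        linear_conv_bounded_linear[THEN iffD1] f(1))
  ultimately have "(\<lambda>z. norm (f z - k)) constant_on \<alpha>"
    using pieces_connected[OF \<alpha>(1) t] by (intro continuous_finite_range_constant)
  then have "norm (f z - k) = norm (f (place W x0) - k)" if "z \<in> \<alpha>" for z
    using that x0 unfolding constant_on_def by metis
  moreover have "norm (f (place W x0) - k) = 0" by (simp add: f(2) defect_eq_0)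
  ultimately have "f z = k" if "z \<in> \<alpha>" for z using that by simp
  from linear_eq_on_affine_hull[OF f(1) this y] have "defect W (a \<bullet> y - a \<bullet> x0) = 0"
    using f(2)[of y] by simp
  then show ?thesis by (simp add: defect_eq_0)
qed

text \<open>
  A vector that satisfies modulo the lattice all relations between coordinates that hold on the
  common kernel of some roots is congruent to a vector of the kernel: choose one coordinate in
  every class of related coordinates and define the others by the relations.
\<close>

lemma lift_to_kernel:
  fixes w :: "real^'n"
  assumes R: "R \<subseteq> affine_roots W"
    and rel: "\<And>a. a \<in> directions W \<Longrightarrow> (\<And>v. v \<in> kernel R \<Longrightarrow> a \<bullet> v = 0) \<Longrightarrow> a \<bullet> w \<in> lattice W"
  shows "\<exists>u\<in>kernel R. \<forall>i. u $ i - w $ i \<in> lattice W"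
proof -
  define van where "van a \<longleftrightarrow> (\<forall>v\<in>kernel R. a \<bullet> v = 0)" for a :: "real^'n"
  have van_add: "van (a + b)" if "van a" "van b" for a b using that by (simp add: van_def inner_add_left)
  have van_diff: "van (a - b)" if "van a" "van b" for a b using that by (simp add: van_def inner_diff_left)
  have van_scale: "van (s *\<^sub>R a)" if "van a" for a s using that by (simp add: van_def)
  define E where "E i = (axis i 1 :: real^'n)" for i
  define zero where "zero i \<longleftrightarrow> W \<notin> {TypeA, AffA} \<and> van (E i)" for i
  define sgns where "sgns = (if W \<in> {TypeA, AffA} then {1} else {1, -1::real})"
  \<comment> \<open>On the kernel the coordinates \<open>i\<close> and \<open>j\<close> agree up to the sign \<open>s\<close>, and those with \<open>zero i\<close> vanish.\<close>
  define R2 where "R2 i j s \<longleftrightarrow> s \<in> sgns \<and> van (E i - s *\<^sub>R E j)" for i j s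
  have sg: "s * s = 1" "s \<noteq> 0" if "s \<in> sgns" for s using that by (auto simp: sgns_def split: if_splits)
  have refl: "R2 i i 1" for i by (auto simp: R2_def sgns_def van_def)
  have symm: "R2 j i s" if h: "R2 i j s" for i j s
  proof -
    have "van ((- s) *\<^sub>R (E i - s *\<^sub>R E j))" using h by (intro van_scale) (simp add: R2_def)
    moreover have "(- s) *\<^sub>R (E i - s *\<^sub>R E j) = E j - s *\<^sub>R E i"
      using h sg(1)[of s] by (simp add: R2_def scaleR_diff_right)
    ultimately show ?thesis using h by (simp add: R2_def)
  qed
  have trans: "R2 i k (s * t)" if h: "R2 i j s" "R2 j k t" for i j k s t
  proof -
    have "van ((E i - s *\<^sub>R E j) + s *\<^sub>R (E j - t *\<^sub>R E k))" using h by (intro van_add[OF _ van_scale]) (auto simp: R2_def)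
    moreover have "s * t \<in> sgns" using h by (auto simp: R2_def sgns_def split: if_splits)
    ultimately show ?thesis by (simp add: R2_def scaleR_diff_right)
  qed
  define rel2 where "rel2 i j \<longleftrightarrow> (\<exists>s. R2 i j s)" for i j
  have rel2_eq: "rel2 i = rel2 j" if "rel2 i j" for i j
    using that symm trans unfolding rel2_def by (intro ext iffI) meson+
  define rep where "rep i = (SOME j. rel2 i j)" for i
  have rep: "rel2 i (rep i)" for i
    unfolding rep_def using refl by (intro someI[of "rel2 i" i]) (auto simp: rel2_def)
  define sg2 where "sg2 i = (SOME s. R2 i (rep i) s)" for i
  have sg2: "R2 i (rep i) (sg2 i)" for i
    using someI_ex[OF rep[of i, unfolded rel2_def]] unfolding sg2_def .
  \<comment> \<open>The sign \<open>sg2 i\<close> is unique unless \<open>zero i\<close>, as two signs would force the coordinate to vanish.\<close>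
  define u where "u = (\<chi> i. if zero i then 0 else sg2 i * w $ rep i)"
  have uz: "zero i \<Longrightarrow> u $ i = 0" for i by (simp add: u_def)
  have compare: "zero i \<and> zero j \<or> \<not> zero i \<and> \<not> zero j \<and> u $ i = s * u $ j" if h: "R2 i j s" for i j s
  proof -
    have s: "s \<in> sgns" using h by (simp add: R2_def)
    have vij: "van (E i - s *\<^sub>R E j)" using h by (simp add: R2_def)
    have "van (E i) \<longleftrightarrow> van (E j)"
    proof
      assume "van (E i)"
      then have "van (s *\<^sub>R (E i - (E i - s *\<^sub>R E j)))" by (rule van_scale[OF van_diff[OF _ vij]])
      then show "van (E j)" using sg(1)[OF s] by simp
    next
      assume "van (E j)"
      then have "van ((E i - s *\<^sub>R E j) + s *\<^sub>R E j)" by (rule van_add[OF vij van_scale])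
      then show "van (E i)" by simp
    qed
    then have z: "zero i \<longleftrightarrow> zero j" by (simp add: zero_def)
    show ?thesis
    proof (cases "zero i")
      case False
      have "rel2 i j" using h by (auto simp: rel2_def)
      then have r: "rep i = rep j" using rel2_eq by (simp add: rep_def)
      have si: "sg2 i \<in> sgns" "sg2 j \<in> sgns" using sg2 by (auto simp: R2_def)
      have "sg2 i = s * sg2 j"
      proof (rule ccontr)
        assume ne: "sg2 i \<noteq> s * sg2 j"
        let ?r = "rep i"
        have t: "R2 i ?r (s * sg2 j)" using trans[OF h sg2[of j]] r by simp
        have "van ((E i - (s * sg2 j) *\<^sub>R E ?r) - (E i - sg2 i *\<^sub>R E ?r))"
          by (rule van_diff) (use t sg2[of i] in \<open>simp_all add: R2_def\<close>)
        then have "van ((sg2 i - s * sg2 j) *\<^sub>R E ?r)" by (simp add: algebra_simps)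
        then have "van ((1 / (sg2 i - s * sg2 j)) *\<^sub>R ((sg2 i - s * sg2 j) *\<^sub>R E ?r))" by (rule van_scale)
        then have vr: "van (E ?r)" using ne by simp
        have "van ((E i - sg2 i *\<^sub>R E ?r) + sg2 i *\<^sub>R E ?r)"
          using sg2[of i] by (intro van_add[OF _ van_scale[OF vr]]) (simp add: R2_def)
        then have "van (E i)" by simp
        moreover have "W \<notin> {TypeA, AffA}"
        proof
          assume "W \<in> {TypeA, AffA}"
          then have "sgns = {1}" by (simp add: sgns_def)
          then show False using ne s si by simp
        qed
        ultimately show False using False by (simp add: zero_def)
      qed
      then show ?thesis using False z r by (simp add: u_def)
    qed (use z in simp)
  qed
  have "u \<in> kernel R"
  proof -
    have "a \<bullet> u = 0" if ac: "(a, c) \<in> R" for a c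
    proof -
      have va: "van a" using ac kernelD by (auto simp: van_def)
      have "(a, c) \<in> affine_roots W" using R ac by auto
      then show ?thesis
      proof (cases rule: affine_roots_cases)
        case (minus i j)
        then have "R2 i j 1" using va by (auto simp: R2_def sgns_def E_def)
        from compare[OF this] show ?thesis using minus uz[of i] uz[of j] by (auto simp: inner_diff_left axis_inner)
      next
        case (plus i j)
        then have "R2 i j (- 1)" using va by (auto simp: R2_def sgns_def E_def)
        from compare[OF this] show ?thesis using plus uz[of i] uz[of j] by (auto simp: inner_add_left axis_inner)
      next
        case (zero i)
        then have "zero i" using va by (auto simp: zero_def E_def fixed_at_0_def)
        then show ?thesis using zero by (simp add: axis_inner u_def)
      next
        case (one i)
        then have "zero i" using va by (auto simp: zero_def E_def fixed_at_1_def)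
        then show ?thesis using one by (simp add: axis_inner u_def)
      qed
    qed
    then show ?thesis by (force simp: kernel_def)
  qed
  moreover have "u $ i - w $ i \<in> lattice W" for i
  proof (cases "zero i")
    case True
    then have "E i \<in> directions W" "\<And>v. v \<in> kernel R \<Longrightarrow> E i \<bullet> v = 0"
      by (auto simp: zero_def directions_def E_def van_def)
    from rel[OF this] show ?thesis using True by (simp add: u_def E_def axis_inner)
  next
    case False
    have "sg2 i * w $ rep i - w $ i \<in> lattice W"
    proof (cases "rep i = i")
      case True
      have "sg2 i = 1"
      proof (rule ccontr)
        assume "sg2 i \<noteq> 1"
        then have m: "sg2 i = - 1" "W \<notin> {TypeA, AffA}" using sg2[of i] by (auto simp: R2_def sgns_def split: if_splits)
        have "van ((1 / 2) *\<^sub>R (E i - sg2 i *\<^sub>R E i))" using sg2[of i] True by (intro van_scale) (simp add: R2_def)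
        moreover have "(1 / 2) *\<^sub>R (E i - sg2 i *\<^sub>R E i) = E i" using m by (simp add: scaleR_2[symmetric])
        ultimately show False using False m by (simp add: zero_def)
      qed
      then show ?thesis using True by simp
    next
      case ne: False
      have s: "sg2 i \<in> sgns" using sg2[of i] by (simp add: R2_def)
      have "E i - sg2 i *\<^sub>R E (rep i) \<in> directions W"
      proof (cases "sg2 i = 1")
        case True
        then show ?thesis using directionsI(1)[of i "rep i"] ne by (simp add: E_def)
      next
        case False
        then have "sg2 i = -1" "W \<notin> {TypeA, AffA}" using s by (auto simp: sgns_def split: if_splits)
        then show ?thesis using directionsI(2)[of i "rep i" W] ne by (simp add: E_def)
      qed
      moreover have "\<And>v. v \<in> kernel R \<Longrightarrow> (E i - sg2 i *\<^sub>R E (rep i)) \<bullet> v = 0"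
        using sg2[of i] by (simp add: R2_def van_def)
      ultimately have "(E i - sg2 i *\<^sub>R E (rep i)) \<bullet> w \<in> lattice W" by (rule rel)
      then show ?thesis using lattice_diff_commute by (simp add: E_def inner_diff_left axis_inner)
    qed
    then show ?thesis using False by (simp add: u_def)
  qed
  ultimately show ?thesis by blast
qed

text \<open>
Flats are clean.  On the sphere the equations of the flat persist on its hull.  On the torus, the
equations between positions that hold along the flat hold, up to the lattice, at every point of the
complex in its hull; so such a point has coordinates that satisfy them exactly.
\<close>

lemma flat_section:
  fixes \<alpha> :: "(complex^'n^'n) set"
  assumes \<alpha>: "\<alpha> \<in> intersections W" and y: "y \<in> coords W" "place W y \<in> affine hull \<alpha>"
  shows "place W y \<in> \<alpha>"
proof -
  obtain R where R: "R \<subseteq> affine_roots W" "R \<noteq> {}" "\<alpha> \<in> pieces W (\<Inter>(wall W ` R))" "\<alpha> \<noteq> {}"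
    by (rule intersectionsE[OF \<alpha>]) (rule that)
  show ?thesis
  proof (cases "toroidal W")
    case False
    have "place W y \<in> wall W r" if "r \<in> R" for r
      using affine_hull_in_wall[of "fst r" "snd r" W \<alpha> y] that R(1) pieces_subset[OF R(3)] y by auto
    then show ?thesis using R(3) False by (simp add: pieces_spherical)
  next
    case True
    obtain x0 where x0: "x0 \<in> coords W" "place W x0 \<in> \<alpha>" using R(4) flat_points[OF \<alpha>] by blast
    have rel: "a \<bullet> (y - x0) \<in> lattice W" if "a \<in> directions W" "\<And>v. v \<in> kernel R \<Longrightarrow> a \<bullet> v = 0" for a
      using direction_constant[OF True R(1,3,2) x0(2) that y(2)] by (simp add: inner_diff_right)
    have "\<exists>u\<in>kernel R. \<forall>i. u $ i - (y - x0) $ i \<in> lattice W"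
      by (rule lift_to_kernel[OF R(1)]) (rule rel)
    then obtain u where u: "u \<in> kernel R" "\<And>i. u $ i - (y - x0) $ i \<in> lattice W" by blast
    have "place W (x0 + u) = place W y" using u(2) by (intro place_eqI) (simp add: algebra_simps)
    moreover have "place W (x0 + u) \<in> \<alpha>"
      using flat_mem[OF \<alpha> x0] tangent_eq_kernel[OF R(1,3) x0] u(1) True by (simp add: coords_toroidal)
    ultimately show ?thesis by simp
  qed
qed


section \<open>Irreducible flats\<close>

lemma root_value:
  assumes "\<alpha> \<subseteq> wall W (a, c)" "(a, c) \<in> affine_roots W" "x \<in> coords W" "place W x \<in> \<alpha>"
  shows "a \<bullet> x - c \<in> lattice W"
  using assms place_in_wall by blast

lemma wallI:
  assumes \<alpha>: "\<alpha> \<in> intersections W" and r: "(a, c) \<in> affine_roots W"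
    and "\<And>x. x \<in> coords W \<Longrightarrow> place W x \<in> \<alpha> \<Longrightarrow> a \<bullet> x - c \<in> lattice W"
  shows "\<alpha> \<subseteq> wall W (a, c)"
proof
  fix z assume "z \<in> \<alpha>"
  then obtain x where "x \<in> coords W" "z = place W x" using flat_points[OF \<alpha>] by blast
  then show "z \<in> wall W (a, c)" using assms(3) place_in_wall[OF _ r] \<open>z \<in> \<alpha>\<close> by blast
qed

lemma intersections_nonempty: "\<alpha> \<in> intersections W \<Longrightarrow> \<alpha> \<noteq> {}"
  by (simp add: intersections_def)

lemma roots_through_nonempty: 
  assumes "\<alpha> \<in> intersections W"
  shows "\<exists>a c. (a, c) \<in> affine_roots W \<and> \<alpha> \<subseteq> wall W (a, c)"
proof -
  obtain R where R: "R \<subseteq> affine_roots W" "R \<noteq> {}" "\<alpha> \<in> pieces W (\<Inter>(wall W ` R))" "\<alpha> \<noteq> {}"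
    by (rule intersectionsE[OF assms]) (rule that)
  obtain a c where "(a, c) \<in> R" using R(2) by auto
  then show ?thesis using R(1) pieces_subset[OF R(3)] by blast
qed

text \<open>
  If the walls through a flat split into the walls through two flats, then the roots of the two
  parts are orthogonal: the third root of a pencil through two oblique ones would have to
  belong to one of the parts, which then contains the whole pencil.
\<close>

lemma reducible_orthogonal:
  fixes a1 a2 :: "real^'n"
  assumes \<gamma>: "\<gamma> \<in> intersections W" and \<beta>: "\<beta> \<in> intersections W" and \<delta>: "\<delta> \<in> intersections W"
    and un: "Hs W \<gamma> = Hs W \<beta> \<union> Hs W \<delta>" and dj: "Hs W \<beta> \<inter> Hs W \<delta> = {}"
    and r1: "(a1, c1) \<in> affine_roots W" "\<beta> \<subseteq> wall W (a1, c1)"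
    and r2: "(a2, c2) \<in> affine_roots W" "\<delta> \<subseteq> wall W (a2, c2)"
  shows "a1 \<bullet> a2 = 0"
proof (rule ccontr)
  assume ob: "a1 \<bullet> a2 \<noteq> 0"
  have h: "wall W r \<in> Hs W \<epsilon> \<longleftrightarrow> \<epsilon> \<subseteq> wall W r" if "r \<in> affine_roots W" for r and \<epsilon> :: "(complex^'n^'n) set"
    using that by (auto simp: Hs_def hyperplanes_eq)
  have g: "\<gamma> \<subseteq> wall W (a1, c1)" "\<gamma> \<subseteq> wall W (a2, c2)" using un r1 r2 h by blast+
  have nd: "\<not> \<delta> \<subseteq> wall W (a1, c1)" "\<not> \<beta> \<subseteq> wall W (a2, c2)" using dj r1 r2 h by blast+
  have neg: "s * t \<in> lattice W" if "s \<in> {1, -1}" "t \<in> lattice W" for s t using that by auto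
  have neg': "t \<in> lattice W" if "s \<in> {1, -1}" "s * t \<in> lattice W" for s t using that by auto
  from oblique_roots_third_root[OF r1(1) r2(1) ob] show False
  proof (elim disjE exE conjE bexE)
    fix s :: real assume s: "s \<in> {1, -1}" "a2 = s *\<^sub>R a1"
    obtain z where z: "z \<in> \<gamma>" using intersections_nonempty[OF \<gamma>] by blast
    then obtain x where x: "x \<in> coords W" "z = place W x" using flat_points[OF \<gamma>] by blast
    have v: "a1 \<bullet> x - c1 \<in> lattice W" "a2 \<bullet> x - c2 \<in> lattice W"
      using root_value[OF g(1) r1(1) x(1)] root_value[OF g(2) r2(1) x(1)] z x(2) by simp_all
    have "(a2 \<bullet> x - c2) - s * (a1 \<bullet> x - c1) \<in> lattice W" by (rule lattice_diff[OF v(2) neg[OF s(1) v(1)]])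
    then have cc: "s * c1 - c2 \<in> lattice W" using s(2) by (simp add: algebra_simps)
    have "\<beta> \<subseteq> wall W (a2, c2)"
    proof (rule wallI[OF \<beta> r2(1)])
      fix x assume x: "x \<in> coords W" "place W x \<in> \<beta>"
      have "s * (a1 \<bullet> x - c1) + (s * c1 - c2) \<in> lattice W"
        by (rule lattice_add[OF neg[OF s(1) root_value[OF r1(2,1) x]] cc])
      then show "a2 \<bullet> x - c2 \<in> lattice W" using s(2) by (simp add: algebra_simps)
    qed
    then show False using nd by simp
  next
    fix a3 c3 s1 s2
    assume r3: "(a3, c3) \<in> affine_roots W" and s: "s1 \<in> {1, -1}" "s2 \<in> {1, - 1}"
      and a3: "a3 = s1 *\<^sub>R a1 + s2 *\<^sub>R a2" and c3': "c3 - (s1 * c1 + s2 * c2) \<in> lattice W"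
    have c3: "(s1 * c1 + s2 * c2) - c3 \<in> lattice W" using c3' lattice_diff_commute by blast
    have id: "a3 \<bullet> x - c3 = s1 * (a1 \<bullet> x - c1) + s2 * (a2 \<bullet> x - c2) + ((s1 * c1 + s2 * c2) - c3)" for x
      by (simp add: a3 inner_add_left algebra_simps)
    have "\<gamma> \<subseteq> wall W (a3, c3)"
    proof (rule wallI[OF \<gamma> r3])
      fix x assume x: "x \<in> coords W" "place W x \<in> \<gamma>"
      show "a3 \<bullet> x - c3 \<in> lattice W" unfolding id
        by (rule lattice_add[OF lattice_add[OF neg[OF s(1) root_value[OF g(1) r1(1) x]]
                neg[OF s(2) root_value[OF g(2) r2(1) x]]] c3])
    qed
    then have "\<beta> \<subseteq> wall W (a3, c3) \<or> \<delta> \<subseteq> wall W (a3, c3)" using un h[OF r3] by blast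
    then show False
    proof
      assume b3: "\<beta> \<subseteq> wall W (a3, c3)"
      have "\<beta> \<subseteq> wall W (a2, c2)"
      proof (rule wallI[OF \<beta> r2(1)])
        fix x assume x: "x \<in> coords W" "place W x \<in> \<beta>"
        have "s2 * (a2 \<bullet> x - c2) = (a3 \<bullet> x - c3) - s1 * (a1 \<bullet> x - c1) - ((s1 * c1 + s2 * c2) - c3)" by (simp add: id)
        also have "\<dots> \<in> lattice W"
          by (rule lattice_diff[OF lattice_diff[OF root_value[OF b3 r3 x] neg[OF s(1) root_value[OF r1(2,1) x]]] c3])
        finally show "a2 \<bullet> x - c2 \<in> lattice W" by (rule neg'[OF s(2)])
      qed
      then show False using nd by simp
    next
      assume d3: "\<delta> \<subseteq> wall W (a3, c3)"
      have "\<delta> \<subseteq> wall W (a1, c1)"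
      proof (rule wallI[OF \<delta> r1(1)])
        fix x assume x: "x \<in> coords W" "place W x \<in> \<delta>"
        have "s1 * (a1 \<bullet> x - c1) = (a3 \<bullet> x - c3) - s2 * (a2 \<bullet> x - c2) - ((s1 * c1 + s2 * c2) - c3)" by (simp add: id)
        also have "\<dots> \<in> lattice W"
          by (rule lattice_diff[OF lattice_diff[OF root_value[OF d3 r3 x] neg[OF s(2) root_value[OF r2(2,1) x]]] c3])
        finally show "a1 \<bullet> x - c1 \<in> lattice W" by (rule neg'[OF s(1)])
      qed
      then show False using nd by simp
    qed
  qed
qed

text \<open>
Each of two orthogonal sets of roots that together make up the roots through \<open>\<alpha>\<close> is the set of all roots
through some larger flat: a root of the other set that vanished on the tangent space of this flat
would be orthogonal to itself.
\<close>

lemma irreducible_no_orthogonal_split: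
  assumes \<alpha>: "\<alpha> \<in> min_building_set W" and split: "roots_through W \<alpha> = R1 \<union> R2"
    and orth: "\<forall>r1\<in>R1. \<forall>r2\<in>R2. fst r1 \<bullet> fst r2 = 0"
  shows "R1 = {} \<or> R2 = {}"
proof (rule ccontr)
  assume "\<not> ?thesis"
  then have ne: "R1 \<noteq> {}" "R2 \<noteq> {}" by auto
  have \<alpha>i: "\<alpha> \<in> intersections W" and irr: "\<not> reducible W \<alpha>" using \<alpha> by (auto simp: min_building_set_def)
  have R12: "R1 \<subseteq> affine_roots W" "R2 \<subseteq> affine_roots W" using split by (auto simp: roots_through_def)
  have sub: "\<alpha> \<subseteq> \<Inter>(wall W ` R1)" "\<alpha> \<subseteq> \<Inter>(wall W ` R2)" using split by (auto simp: roots_through_def)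
  obtain R where R: "R \<subseteq> affine_roots W" "R \<noteq> {}" "\<alpha> \<in> pieces W (\<Inter>(wall W ` R))" "\<alpha> \<noteq> {}"
    by (rule intersectionsE[OF \<alpha>i]) (rule that)
  obtain q where q: "q \<in> \<alpha>" using R(4) by blast
  obtain x0 where x0: "x0 \<in> coords W" "q = place W x0" using flat_points[OF \<alpha>i q] by blast
  have part: "\<exists>\<beta>. \<beta> \<in> intersections W \<and> \<alpha> \<subseteq> \<beta> \<and> \<beta> \<subseteq> \<Inter>(wall W ` P) \<and> roots_through W \<beta> = P"
    if P: "P \<subseteq> affine_roots W" "P \<noteq> {}" "\<alpha> \<subseteq> \<Inter>(wall W ` P)" "roots_through W \<alpha> = P \<union> P'"
      and o: "\<forall>r1\<in>P. \<forall>r2\<in>P'. fst r1 \<bullet> fst r2 = 0" for P P'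
  proof -
    have qP: "q \<in> \<Inter>(wall W ` P)" using P(3) q by blast
    obtain \<beta> where \<beta>: "\<beta> \<in> pieces W (\<Inter>(wall W ` P))" "q \<in> \<beta>" by (rule piece_exists[OF qP]) (rule that)
    have \<beta>i: "\<beta> \<in> intersections W" by (rule intersectionsI[OF P(1,2) \<beta>])
    have ab: "\<alpha> \<subseteq> \<beta>"
    proof (cases "toroidal W")
      case True
      then show ?thesis using pieces_maximal[OF \<beta>(1) True pieces_connected[OF R(3) True] P(3) q \<beta>(2)] by simp
    qed (use \<beta>(1) P(3) in \<open>simp add: pieces_spherical\<close>)
    have "P \<subseteq> roots_through W \<beta>" using P(1) pieces_subset[OF \<beta>(1)] by (auto simp: roots_through_def)
    moreover have "roots_through W \<beta> \<subseteq> P"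
    proof clarify
      fix a c assume ac: "(a, c) \<in> roots_through W \<beta>"
      then have "(a, c) \<in> roots_through W \<alpha>" using ab by (auto simp: roots_through_def)
      moreover have "(a, c) \<notin> P'"
      proof
        assume "(a, c) \<in> P'"
        then have "fst r \<bullet> a = 0" if "r \<in> P" for r using o that by (metis fst_conv)
        then have "a \<in> kernel P" by (simp add: kernel_def)
        then have "a \<in> tangent W \<beta>" using tangent_eq_kernel[OF P(1) \<beta>(1) x0(1)] \<beta>(2) x0(2) by simp
        then have "a \<bullet> a = 0" using ac unfolding tangent_def by (rule kernelD)
        then show False using root_nonzero ac by (auto simp: roots_through_def)
      qed
      ultimately show "(a, c) \<in> P" using P(4) by auto
    qed
    ultimately show ?thesis using \<beta>i ab pieces_subset[OF \<beta>(1)] by blast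
  qed
  obtain \<beta>1 where b1: "\<beta>1 \<in> intersections W" "\<alpha> \<subseteq> \<beta>1" "\<beta>1 \<subseteq> \<Inter>(wall W ` R1)" "roots_through W \<beta>1 = R1"
    using part[OF R12(1) ne(1) sub(1) split orth] by metis
  have "roots_through W \<alpha> = R2 \<union> R1" using split by blast
  moreover have "\<forall>r1\<in>R2. \<forall>r2\<in>R1. fst r1 \<bullet> fst r2 = 0"
    using orth by (metis inner_commute)
  ultimately obtain \<beta>2 where b2: "\<beta>2 \<in> intersections W" "\<alpha> \<subseteq> \<beta>2" "\<beta>2 \<subseteq> \<Inter>(wall W ` R2)" "roots_through W \<beta>2 = R2"
    using part[OF R12(2) ne(2) sub(2)] by metis
  have "Hs W \<beta>1 \<inter> Hs W \<beta>2 = {}"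
  proof (rule ccontr)
    assume "Hs W \<beta>1 \<inter> Hs W \<beta>2 \<noteq> {}"
    then obtain r1 r2 where r: "r1 \<in> R1" "r2 \<in> R2" "wall W r1 = wall W r2" unfolding Hs_eq b1 b2 by auto
    have "r2 \<in> roots_through W \<beta>1" using r R12 b1(3) unfolding roots_through_def by blast
    then have "r2 \<in> R1" by (simp add: b1(4))
    then have "fst r2 \<bullet> fst r2 = 0" using orth r(2) by blast
    then show False using root_nonzero'[of r2 W] r(2) R12(2) by auto
  qed
  moreover have "Hs W \<alpha> = Hs W \<beta>1 \<union> Hs W \<beta>2" by (simp add: Hs_eq split b1 b2 image_Un)
  moreover have "\<alpha> \<in> pieces W (\<beta>1 \<inter> \<beta>2)"
  proof (rule pieces_shrink[OF R(3,4)])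
    have "R \<subseteq> R1 \<union> R2" using R(1) pieces_subset[OF R(3)] by (auto simp: split[symmetric] roots_through_def)
    then show "\<beta>1 \<inter> \<beta>2 \<subseteq> \<Inter>(wall W ` R)" using b1(3) b2(3) by blast
  qed (use b1(2) b2(2) in blast)
  ultimately show False using irr b1(1) b2(1) unfolding reducible_def by blast
qed

text \<open>
Let \<open>\<gamma>\<close> be the component through \<open>q\<close> of the intersection.  If \<open>\<gamma>\<close> is reducible, then the roots
through it fall into two orthogonal parts.  By irreducibility the roots of \<open>\<alpha>\<close> lie in one part and
those of \<open>\<beta>\<close> in one part.  The parts are different: the roots of \<open>\<alpha>\<close> and \<open>\<beta>\<close> together determine
the tangent space of \<open>\<gamma>\<close>, so a root orthogonal to all of them would be tangent to \<open>\<gamma>\<close>, on which it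
vanishes.
\<close>

lemma building_set_meet:
  assumes \<alpha>: "\<alpha> \<in> min_building_set W" and \<beta>: "\<beta> \<in> min_building_set W"
    and q: "q \<in> \<alpha>" "q \<in> \<beta>"
  obtains (irreducible) \<gamma> where "\<gamma> \<in> min_building_set W" "q \<in> \<gamma>" "\<gamma> \<subseteq> \<alpha>" "\<gamma> \<subseteq> \<beta>"
      "tangent W \<gamma> = tangent W \<alpha> \<inter> tangent W \<beta>"
  | (orthogonal) "\<forall>r1\<in>roots_through W \<alpha>. \<forall>r2\<in>roots_through W \<beta>. fst r1 \<bullet> fst r2 = 0"
proof -
  have i: "\<alpha> \<in> intersections W" "\<beta> \<in> intersections W" using \<alpha> \<beta> by (auto simp: min_building_set_def)
  obtain x0 where x0: "x0 \<in> coords W" "q = place W x0" using flat_points[OF i(1) q(1)] by blast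
  let ?R = "roots_through W \<alpha> \<union> roots_through W \<beta>"
  have R: "?R \<subseteq> affine_roots W" "?R \<noteq> {}" "q \<in> \<Inter>(wall W ` ?R)"
    using roots_through_nonempty[OF i(1)] q by (auto simp: roots_through_def)
  obtain \<gamma> where \<gamma>: "\<gamma> \<in> pieces W (\<Inter>(wall W ` ?R))" "q \<in> \<gamma>" by (rule piece_exists[OF R(3)]) (rule that)
  have \<gamma>i: "\<gamma> \<in> intersections W" by (rule intersectionsI[OF R(1,2) \<gamma>])
  have tan: "tangent W \<gamma> = tangent W \<alpha> \<inter> tangent W \<beta>"
    using tangent_eq_kernel[OF R(1) \<gamma>(1) x0(1)] \<gamma>(2) x0(2) by (auto simp: tangent_def kernel_def)
  have sub: "\<gamma> \<subseteq> \<epsilon>" if e: "\<epsilon> \<in> intersections W" "q \<in> \<epsilon>" "roots_through W \<epsilon> \<subseteq> ?R" for \<epsilon>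
  proof -
    obtain S where S: "S \<subseteq> affine_roots W" "S \<noteq> {}" "\<epsilon> \<in> pieces W (\<Inter>(wall W ` S))" "\<epsilon> \<noteq> {}"
      by (rule intersectionsE[OF e(1)]) (rule that)
    have "S \<subseteq> roots_through W \<epsilon>" using S(1) pieces_subset[OF S(3)] by (auto simp: roots_through_def)
    then have g: "\<gamma> \<subseteq> \<Inter>(wall W ` S)" using pieces_subset[OF \<gamma>(1)] e(3) by blast
    show ?thesis
    proof (cases "toroidal W")
      case True
      then show ?thesis using pieces_maximal[OF S(3) True pieces_connected[OF \<gamma>(1) True] g \<gamma>(2) e(2)] by simp
    qed (use S(3) g in \<open>simp add: pieces_spherical\<close>)
  qed
  have \<gamma>\<alpha>: "\<gamma> \<subseteq> \<alpha>" "\<gamma> \<subseteq> \<beta>" using sub[OF i(1) q(1)] sub[OF i(2) q(2)] by auto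
  show ?thesis
  proof (cases "\<gamma> \<in> min_building_set W")
    case True
    then show ?thesis using irreducible[OF True \<gamma>(2) \<gamma>\<alpha> tan] by simp
  next
    case False
    then have "reducible W \<gamma>" using \<gamma>i by (simp add: min_building_set_def)
    then obtain \<beta>' \<delta> where bd: "\<beta>' \<in> intersections W" "\<delta> \<in> intersections W"
      "Hs W \<gamma> = Hs W \<beta>' \<union> Hs W \<delta>" "Hs W \<beta>' \<inter> Hs W \<delta> = {}" unfolding reducible_def by blast
    let ?B = "roots_through W \<beta>'" and ?D = "roots_through W \<delta>"
    have ortho: "\<forall>r1\<in>?B. \<forall>r2\<in>?D. fst r1 \<bullet> fst r2 = 0"
    proof (intro ballI)
      fix r1 r2 assume "r1 \<in> ?B" "r2 \<in> ?D"
      then show "fst r1 \<bullet> fst r2 = 0"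
        using reducible_orthogonal[OF \<gamma>i bd, of "fst r1" "snd r1" "fst r2" "snd r2"] by (simp add: roots_through_def)
    qed
    have through: "roots_through W \<gamma> = ?B \<union> ?D"
    proof -
      have "wall W r \<in> Hs W \<epsilon> \<longleftrightarrow> \<epsilon> \<subseteq> wall W r" if "r \<in> affine_roots W" for r and \<epsilon> :: "(complex^'n^'n) set"
        using that by (auto simp: Hs_def hyperplanes_eq)
      then show ?thesis using bd(3) unfolding roots_through_def by blast
    qed
    have side: "roots_through W \<epsilon> \<subseteq> ?B \<or> roots_through W \<epsilon> \<subseteq> ?D"
      if e: "\<epsilon> \<in> min_building_set W" "\<gamma> \<subseteq> \<epsilon>" for \<epsilon>
    proof -
      have "roots_through W \<epsilon> \<subseteq> ?B \<union> ?D" using e(2) through[symmetric] by (auto simp: roots_through_def)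
      then have "roots_through W \<epsilon> = (roots_through W \<epsilon> \<inter> ?B) \<union> (roots_through W \<epsilon> \<inter> ?D)" by blast
      moreover have "\<forall>r1\<in>roots_through W \<epsilon> \<inter> ?B. \<forall>r2\<in>roots_through W \<epsilon> \<inter> ?D. fst r1 \<bullet> fst r2 = 0"
        using ortho by blast
      ultimately have "roots_through W \<epsilon> \<inter> ?B = {} \<or> roots_through W \<epsilon> \<inter> ?D = {}"
        by (rule irreducible_no_orthogonal_split[OF e(1)])
      then show ?thesis using \<open>roots_through W \<epsilon> \<subseteq> ?B \<union> ?D\<close> by blast
    qed
    \<comment> \<open>A root in \<open>P'\<close> would be orthogonal to all of \<open>?R\<close>, hence tangent to \<open>\<gamma>\<close>.\<close>
    have not_all: "\<not> ?R \<subseteq> P" if P: "?B \<union> ?D = P \<union> P'" "\<epsilon> \<in> intersections W" "P' = roots_through W \<epsilon>"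
      and o: "\<forall>r1\<in>P. \<forall>r2\<in>P'. fst r1 \<bullet> fst r2 = 0" for P P' \<epsilon>
    proof
      assume all: "?R \<subseteq> P"
      obtain a c where ac: "(a, c) \<in> P'" using roots_through_nonempty[OF P(2)] P(3) by (auto simp: roots_through_def)
      have g: "(a, c) \<in> roots_through W \<gamma>" using ac P(1) through by blast
      have "a \<bullet> fst r = 0" if "r \<in> ?R" for r
        using o[THEN bspec, OF subsetD[OF all that], THEN bspec, OF ac] by (simp add: inner_commute)
      then have "fst r \<bullet> a = 0" if "r \<in> ?R" for r using that by (metis inner_commute)
      then have "a \<in> tangent W \<alpha> \<inter> tangent W \<beta>" by (simp add: tangent_def kernel_def)
      then have "a \<in> tangent W \<gamma>" by (simp only: tan)
      then have "a \<bullet> a = 0" using g unfolding tangent_def by (rule kernelD)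
      then show False using root_nonzero g by (auto simp: roots_through_def)
    qed
    have ortho': "\<forall>r1\<in>?D. \<forall>r2\<in>?B. fst r1 \<bullet> fst r2 = 0" using ortho by (metis inner_commute)
    have nB: "\<not> ?R \<subseteq> ?B" by (rule not_all[OF refl bd(2) refl ortho])
    have nD: "\<not> ?R \<subseteq> ?D" by (rule not_all[OF Un_commute bd(1) refl ortho'])
    have s: "roots_through W \<alpha> \<subseteq> ?B \<and> roots_through W \<beta> \<subseteq> ?D \<or> roots_through W \<alpha> \<subseteq> ?D \<and> roots_through W \<beta> \<subseteq> ?B"
      using side[OF \<alpha> \<gamma>\<alpha>(1)] side[OF \<beta> \<gamma>\<alpha>(2)] nB nD by (metis Un_least)
    show ?thesis
    proof (rule orthogonal)
      show "\<forall>r1\<in>roots_through W \<alpha>. \<forall>r2\<in>roots_through W \<beta>. fst r1 \<bullet> fst r2 = 0"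
        using s ortho ortho' by (meson subsetD)
    qed
  qed
qed

text \<open>
All roots through a component of a wall are parallel, so there is no orthogonal splitting.
\<close>

lemma wall_piece_irreducible:
  assumes r: "(a, c) \<in> affine_roots W" and \<alpha>: "\<alpha> \<in> pieces W (wall W (a, c))" and q: "place W x0 \<in> \<alpha>" "x0 \<in> coords W"
  shows "\<alpha> \<in> min_building_set W" "tangent W \<alpha> = {v. a \<bullet> v = 0}"
proof -
  have R: "{(a, c)} \<subseteq> affine_roots W" "{(a, c)} \<noteq> {}" "\<alpha> \<in> pieces W (\<Inter>(wall W ` {(a, c)}))" using r \<alpha> by auto
  have \<alpha>i: "\<alpha> \<in> intersections W" by (rule intersectionsI[OF R q(1)])
  show tan: "tangent W \<alpha> = {v. a \<bullet> v = 0}"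
    using tangent_eq_kernel[OF R(1,3) q(2,1)] by (simp add: kernel_def)
  have "\<not> reducible W \<alpha>"
  proof
    assume "reducible W \<alpha>"
    then obtain \<beta> \<delta> where bd: "\<beta> \<in> intersections W" "\<delta> \<in> intersections W"
      "Hs W \<alpha> = Hs W \<beta> \<union> Hs W \<delta>" "Hs W \<beta> \<inter> Hs W \<delta> = {}" unfolding reducible_def by blast
    have par: "a' \<in> span {a}" "a' \<noteq> 0" if "(a', c') \<in> affine_roots W" "wall W (a', c') \<in> Hs W \<alpha>" for a' c'
    proof -
      have "(a', c') \<in> roots_through W \<alpha>" using that by (auto simp: Hs_def roots_through_def)
      moreover have "v \<in> kernel (roots_through W \<alpha>)" if "a \<bullet> v = 0" for v
        using tan that by (simp add: tangent_def)
      ultimately have z: "a' \<bullet> v = 0" if "a \<bullet> v = 0" for v using that kernelD by metis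
      define t where "t = (a \<bullet> a') / (a \<bullet> a)"
      have "a \<bullet> (a' - t *\<^sub>R a) = 0" using root_nonzero[OF r] by (simp add: t_def inner_diff_right)
      from z[OF this] this have "(a' - t *\<^sub>R a) \<bullet> (a' - t *\<^sub>R a) = 0"
        by (simp add: inner_diff_left inner_commute)
      then have "a' = t *\<^sub>R a" by simp
      then show "a' \<in> span {a}" by (simp add: span_base span_scale)
      show "a' \<noteq> 0" using root_nonzero that(1) by blast
    qed
    obtain a1 c1 where 1: "(a1, c1) \<in> affine_roots W" "\<beta> \<subseteq> wall W (a1, c1)" using roots_through_nonempty[OF bd(1)] by blast
    obtain a2 c2 where 2: "(a2, c2) \<in> affine_roots W" "\<delta> \<subseteq> wall W (a2, c2)" using roots_through_nonempty[OF bd(2)] by blast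
    have "wall W (a1, c1) \<in> Hs W \<alpha>" "wall W (a2, c2) \<in> Hs W \<alpha>"
      using 1 2 bd(3) by (auto simp: Hs_def hyperplanes_eq)
    then have p: "a1 \<in> span {a}" "a2 \<in> span {a}" "a1 \<noteq> 0" "a2 \<noteq> 0" using par 1(1) 2(1) by blast+
    then obtain s t where "a1 = s *\<^sub>R a" "a2 = t *\<^sub>R a" by (auto simp: span_singleton)
    then have "a1 \<bullet> a2 \<noteq> 0" using p by simp
    then show False using reducible_orthogonal[OF \<alpha>i bd 1 2] by simp
  qed
  then show "\<alpha> \<in> min_building_set W" using \<alpha>i by (simp add: min_building_set_def)
qed


section \<open>Size of normal parts\<close>

lemma normal_part_subspace:
  fixes V :: "'e::euclidean_space set"
  assumes V: "subspace V"
  shows "linear (normal_part V)" "norm (normal_part V x) \<le> norm x" "x - normal_part V x \<in> V"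
    "v \<in> V \<Longrightarrow> normal_part V v = 0" "v \<in> V \<Longrightarrow> normal_part V x \<bullet> v = 0"
proof -
  have ne: "V \<noteq> {}" and 0: "0 \<in> V" using subspace_0[OF V] by auto
  have hull: "affine hull V = V" using V by (simp add: subspace_imp_affine affine_hull_eq)
  obtain R where R: "linear R" "\<And>v. norm (R v) \<le> norm v"
    "\<And>x y. y \<in> affine hull V \<Longrightarrow> normal_part V x = R (x - y)"
    "\<And>x y. x \<in> affine hull V \<Longrightarrow> y \<in> affine hull V \<Longrightarrow> R (x - y) = 0"
    "\<And>x y z. y \<in> affine hull V \<Longrightarrow> z \<in> affine hull V \<Longrightarrow> R x \<bullet> (y - z) = 0"
    "\<And>x y. y \<in> affine hull V \<Longrightarrow> y + (x - R x) \<in> affine hull V"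
    by (rule normal_part_linear[OF ne]) (rule that)
  have NR: "normal_part V = R" using R(3)[of 0] 0 hull by auto
  show "linear (normal_part V)" "norm (normal_part V x) \<le> norm x" using R(1,2) NR by auto
  show "x - normal_part V x \<in> V" using R(6)[of 0 x] 0 hull NR by simp
  show "v \<in> V \<Longrightarrow> normal_part V v = 0" using R(4)[of v 0] 0 hull NR by simp
  show "v \<in> V \<Longrightarrow> normal_part V x \<bullet> v = 0" using R(5)[of v 0 x] 0 hull NR by simp
qed

text \<open>
On the orthogonal complement of the kernel the values of the roots determine the point, so the norm
of a point is bounded in terms of them.
\<close>

lemma kernel_distance:
  fixes R :: "((real^'n) \<times> real) set"
  assumes "finite R"
  obtains C where "C > 0" "\<And>x. norm (normal_part (kernel R) x) \<le> C * (\<Sum>r\<in>R. \<bar>fst r \<bullet> x\<bar>)"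
proof -
  let ?V = "kernel R"
  note V = normal_part_subspace[OF subspace_kernel[of R]]
  define S where "S = {x :: real^'n. \<forall>v\<in>?V. v \<bullet> x = 0}"
  define f where "f x = (\<Sum>r\<in>R. (fst r \<bullet> x) *\<^sub>R fst r)" for x :: "real^'n"
  have S: "subspace S" by (auto simp: S_def subspace_def inner_add_right)
  have f: "linear f"
    by (rule linearI) (simp_all add: f_def inner_add_right scaleR_add_left sum.distrib scaleR_sum_right)
  have inj: "x = 0" if "x \<in> S" "f x = 0" for x
  proof -
    have "0 = x \<bullet> f x" using that by simp
    also have "\<dots> = (\<Sum>r\<in>R. (fst r \<bullet> x)\<^sup>2)" by (simp add: f_def inner_sum_right power2_eq_square inner_commute)
    finally have "\<forall>r\<in>R. (fst r \<bullet> x)\<^sup>2 = 0" using assms by (simp add: sum_nonneg_eq_0_iff)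
    then have "x \<in> ?V" by (simp add: kernel_def)
    then have "x \<bullet> x = 0" using that(1) by (simp add: S_def)
    then show ?thesis by simp
  qed
  obtain e where e: "e > 0" "\<forall>x\<in>S. e * norm x \<le> norm (f x)"
    using injective_imp_isometric[OF closed_subspace[OF S] S, of f] inj f linear_conv_bounded_linear by blast
  define M where "M = 1 + (\<Sum>r\<in>R. norm (fst r))"
  have M: "M \<ge> 1" by (simp add: M_def sum_nonneg)
  have "norm (normal_part ?V x) \<le> M / e * (\<Sum>r\<in>R. \<bar>fst r \<bullet> x\<bar>)" for x
  proof -
    have "normal_part ?V x \<in> S" using V(5) by (simp add: S_def inner_commute)
    moreover have "f (normal_part ?V x) = f x"
    proof -
      have "fst r \<bullet> (x - normal_part ?V x) = 0" if "r \<in> R" for r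
        using V(3)[of x] that by (simp add: kernel_def)
      then have "fst r \<bullet> normal_part ?V x = fst r \<bullet> x" if "r \<in> R" for r using that by (simp add: inner_diff_right)
      then show ?thesis by (simp add: f_def)
    qed
    ultimately have "e * norm (normal_part ?V x) \<le> norm (f x)" using e(2) by metis
    also have "\<dots> \<le> (\<Sum>r\<in>R. \<bar>fst r \<bullet> x\<bar> * norm (fst r))"
      unfolding f_def by (rule order_trans[OF norm_sum]) simp
    also have "\<dots> \<le> (\<Sum>r\<in>R. \<bar>fst r \<bullet> x\<bar> * M)"
    proof (intro sum_mono mult_left_mono)
      fix r assume "r \<in> R"
      then have "norm (fst r) \<le> (\<Sum>r\<in>R. norm (fst r))" using assms by (intro member_le_sum) auto
      then show "norm (fst r) \<le> M" by (simp add: M_def)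
    qed simp
    also have "\<dots> = M * (\<Sum>r\<in>R. \<bar>fst r \<bullet> x\<bar>)" by (simp add: sum_distrib_left mult.commute)
    finally show ?thesis using e(1) by (simp add: field_simps)
  qed
  moreover have "M / e > 0" using M e(1) by simp
  ultimately show ?thesis by (intro that)
qed

lemma place_entry_lipschitz: "norm (place_entry W s - place_entry W t) \<le> 4 * \<bar>s - t\<bar>"
proof (cases "toroidal W")
  case True
  have "norm (place_entry W s - place_entry W t) = 2 * \<bar>sin (pi * (s - t) / 2)\<bar>"
    using True norm_cis_diff[of "pi * s" "pi * t"]
    by (simp add: place_entry_def right_diff_distrib[symmetric] norm_cis_minus_1)
  also have "\<dots> \<le> 2 * \<bar>pi * (s - t) / 2\<bar>" by (rule mult_left_mono[OF abs_sin_x_le_abs_x]) simp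
  also have "\<dots> = pi * \<bar>s - t\<bar>" by (simp add: abs_mult)
  also have "\<dots> \<le> 4 * \<bar>s - t\<bar>" using pi_less_4 by (intro mult_right_mono) auto
  finally show ?thesis .
next
  case False
  then have "norm (place_entry W s - place_entry W t) = \<bar>s - t\<bar>"
    by (simp add: place_entry_def of_real_diff[symmetric] del: of_real_diff)
  then show ?thesis by simp
qed

text \<open>
The second difference of a function with bounded second derivative, here for two increments that
agree, up to the sign \<open>\<epsilon>\<close> and a small error, at two base points.
\<close>

lemma place_entry_second_difference:
  assumes eps: "\<epsilon> \<in> {1, -1::real}"
  shows "norm ((place_entry W (s' + t') - place_entry W s') - \<epsilon> *\<^sub>R (place_entry W (s + t) - place_entry W s))
    \<le> 4 * \<bar>t' - \<epsilon> * t\<bar> + 16 * \<bar>t\<bar>\<^sup>2 + 16 * (\<bar>s' - s\<bar> * \<bar>t\<bar>)"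
proof (cases "toroidal W")
  case True
  define e where "e = place_entry W"
  have em: "e (a + b) = e a * e b" for a b using True by (simp add: e_def place_entry_def distrib_left cis_mult)
  have e0: "e 0 = 1" using True by (simp add: e_def place_entry_def)
  have en: "norm (e a) = 1" for a using True by (simp add: e_def place_entry_def)
  have lip: "norm (e a - e b) \<le> 4 * \<bar>a - b\<bar>" for a b unfolding e_def by (rule place_entry_lipschitz)
  have l1: "norm (e t - 1) \<le> 4 * \<bar>t\<bar>" using lip[of t 0] e0 by simp
  define A where "A = (e (\<epsilon> * t) - 1) - \<epsilon> *\<^sub>R (e t - 1)"
  have A: "norm A \<le> 16 * \<bar>t\<bar>\<^sup>2"
  proof (cases "\<epsilon> = 1")
    case True
    then show ?thesis by (simp add: A_def)
  next
    case False
    then have "\<epsilon> = -1" using eps by simp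
    moreover have "e (- t) * e t = 1" using em[of "- t" t] e0 by simp
    then have "(e (- t) - 1) + (e t - 1) = e (- t) * ((e t - 1) * (e t - 1))" by (simp add: algebra_simps)
    ultimately have "norm A = norm (e t - 1) * norm (e t - 1)" by (simp add: A_def norm_mult en)
    also have "\<dots> \<le> (4 * \<bar>t\<bar>) * (4 * \<bar>t\<bar>)" using l1 by (intro mult_mono) auto
    finally show ?thesis by (simp add: power2_eq_square)
  qed
  have "(e (s' + t') - e s') - \<epsilon> *\<^sub>R (e (s + t) - e s) =
      (e (s' + t') - e (s' + \<epsilon> * t)) + (e s' * A + \<epsilon> *\<^sub>R ((e s' - e s) * (e t - 1)))"
    by (simp add: em A_def algebra_simps)
  also have "norm \<dots> \<le> norm (e (s' + t') - e (s' + \<epsilon> * t)) + (norm (e s' * A) + norm (\<epsilon> *\<^sub>R ((e s' - e s) * (e t - 1))))"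
    by (intro order_trans[OF norm_triangle_ineq] add_left_mono norm_triangle_ineq)
  also have "\<dots> \<le> 4 * \<bar>t' - \<epsilon> * t\<bar> + (16 * \<bar>t\<bar>\<^sup>2 + (4 * \<bar>s' - s\<bar>) * (4 * \<bar>t\<bar>))"
  proof (intro add_mono)
    show "norm (e (s' + t') - e (s' + \<epsilon> * t)) \<le> 4 * \<bar>t' - \<epsilon> * t\<bar>" using lip[of "s' + t'" "s' + \<epsilon> * t"] by simp
    show "norm (e s' * A) \<le> 16 * \<bar>t\<bar>\<^sup>2" using A by (simp add: norm_mult en)
    have "norm (\<epsilon> *\<^sub>R ((e s' - e s) * (e t - 1))) = norm (e s' - e s) * norm (e t - 1)" using eps by (auto simp: norm_mult norm_minus_commute)
    also have "\<dots> \<le> (4 * \<bar>s' - s\<bar>) * (4 * \<bar>t\<bar>)" using lip l1 by (intro mult_mono) auto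
    finally show "norm (\<epsilon> *\<^sub>R ((e s' - e s) * (e t - 1))) \<le> (4 * \<bar>s' - s\<bar>) * (4 * \<bar>t\<bar>)" .
  qed
  finally show ?thesis by (simp add: e_def)
next
  case False
  have "(place_entry W (s' + t') - place_entry W s') - \<epsilon> *\<^sub>R (place_entry W (s + t) - place_entry W s) = complex_of_real (t' - \<epsilon> * t)"
    using False by (simp add: place_entry_def scaleR_conv_of_real)
  then have "norm ((place_entry W (s' + t') - place_entry W s') - \<epsilon> *\<^sub>R (place_entry W (s + t) - place_entry W s)) = \<bar>t' - \<epsilon> * t\<bar>"
    by (simp only: norm_of_real)
  then show ?thesis by simp
qed

lemma norm_matrix_le: "norm (z :: complex^'n^'n) \<le> (\<Sum>i\<in>UNIV. \<Sum>j\<in>UNIV. norm (z $ i $ j))"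
  unfolding norm_vec_def
  by (rule order_trans[OF L2_set_le_sum]) (auto intro!: sum_mono L2_set_le_sum L2_set_nonneg)

lemma coord_entry_linear:
  "coord_entry W (x + y) i j = coord_entry W x i j + coord_entry W y i j"
  "coord_entry W (x - y) i j = coord_entry W x i j - coord_entry W y i j"
  "coord_entry W (c *\<^sub>R x) i j = c * coord_entry W x i j"
  by (simp_all add: coord_entry_def algebra_simps)

lemma coord_entry_le: "\<bar>coord_entry W x i j\<bar> \<le> 2 * norm x"
  using component_le_norm_cart[of x i] component_le_norm_cart[of x j] by (auto simp: coord_entry_def)

text \<open>
Up to terms of second order the displacement in the ambient space is linear in the displacement of
the coordinates, uniformly in the base point.  For \<open>\<epsilon> = -1\<close> this compares a displacement with its
reflection.
\<close>

lemma place_second_difference: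
  obtains C where "C > 0"
    "\<And>(y::real^'n) y' n n' \<epsilon>. \<epsilon> \<in> {1, -1} \<Longrightarrow>
       norm ((place W (y' + n') - place W y') - \<epsilon> *\<^sub>R (place W (y + n) - place W y))
       \<le> C * (norm (n' - \<epsilon> *\<^sub>R n) + (norm n)\<^sup>2 + norm (y' - y) * norm n)"
proof -
  let ?N = "real CARD('n)"
  have "norm ((place W (y' + n') - place W y') - \<epsilon> *\<^sub>R (place W (y + n) - place W y))
       \<le> (?N * ?N * 64) * (norm (n' - \<epsilon> *\<^sub>R n) + (norm n)\<^sup>2 + norm (y' - y) * norm n)"
    if eps: "\<epsilon> \<in> {1, -1}" for y y' n n' :: "real^'n" and \<epsilon>
  proof -
    let ?z = "(place W (y' + n') - place W y') - \<epsilon> *\<^sub>R (place W (y + n) - place W y)"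
    let ?B = "64 * (norm (n' - \<epsilon> *\<^sub>R n) + (norm n)\<^sup>2 + norm (y' - y) * norm n)"
    have "norm (?z $ i $ j) \<le> ?B" for i j
    proof -
      let ?c = "\<lambda>x. coord_entry W x i j"
      have "norm (?z $ i $ j) = norm ((place_entry W (?c y' + ?c n') - place_entry W (?c y')) - \<epsilon> *\<^sub>R (place_entry W (?c y + ?c n) - place_entry W (?c y)))"
        by (simp add: place_nth coord_entry_linear)
      also have "\<dots> \<le> 4 * \<bar>?c n' - \<epsilon> * ?c n\<bar> + 16 * \<bar>?c n\<bar>\<^sup>2 + 16 * (\<bar>?c y' - ?c y\<bar> * \<bar>?c n\<bar>)"
        by (rule place_entry_second_difference[OF eps])
      also have "\<dots> \<le> 4 * (2 * norm (n' - \<epsilon> *\<^sub>R n)) + 16 * (2 * norm n)\<^sup>2 + 16 * ((2 * norm (y' - y)) * (2 * norm n))"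
      proof (intro add_mono mult_left_mono mult_mono power_mono)
        show "\<bar>?c n' - \<epsilon> * ?c n\<bar> \<le> 2 * norm (n' - \<epsilon> *\<^sub>R n)"
          using coord_entry_le[of W "n' - \<epsilon> *\<^sub>R n" i j] by (simp add: coord_entry_linear)
        show "\<bar>?c y' - ?c y\<bar> \<le> 2 * norm (y' - y)"
          using coord_entry_le[of W "y' - y" i j] by (simp add: coord_entry_linear)
      qed (use coord_entry_le[of W n i j] in auto)
      also have "\<dots> \<le> ?B" by (simp add: power2_eq_square algebra_simps)
      finally show ?thesis .
    qed
    then have "(\<Sum>i\<in>UNIV. \<Sum>j\<in>UNIV. norm (?z $ i $ j)) \<le> (\<Sum>i\<in>(UNIV::'n set). \<Sum>j\<in>(UNIV::'n set). ?B)"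
      by (intro sum_mono)
    with norm_matrix_le[of ?z] have "norm ?z \<le> ?N * (?N * ?B)" by simp
    then show ?thesis by (simp add: mult.assoc)
  qed
  moreover have "?N * ?N * 64 > 0" by simp
  ultimately show ?thesis by (intro that) 
qed

lemma place_lipschitz:
  obtains C where "C > 0" "\<And>(y::real^'n) n. norm (place W (y + n) - place W y) \<le> C * norm n"
proof -
  obtain C where C: "C > 0" "\<And>(y::real^'n) y' n n' \<epsilon>. \<epsilon> \<in> {1, -1} \<Longrightarrow>
       norm ((place W (y' + n') - place W y') - \<epsilon> *\<^sub>R (place W (y + n) - place W y))
       \<le> C * (norm (n' - \<epsilon> *\<^sub>R n) + (norm n)\<^sup>2 + norm (y' - y) * norm n)"
    by (rule place_second_difference[of W]) (rule that)
  have "norm (place W (y + n) - place W y) \<le> C * norm n" for y n :: "real^'n"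
    using C(2)[of 1 y n y 0] by simp
  with C(1) show ?thesis by (rule that)
qed

context
  fixes W :: coxeter and \<alpha> :: "(complex^'n^'n) set" and x0 :: "real^'n"
  assumes \<alpha>: "\<alpha> \<in> intersections W" and x0: "x0 \<in> coords W" "place W x0 \<in> \<alpha>"
begin

abbreviation (input) "nu \<equiv> normal_part (tangent W \<alpha>)"

lemmas nu = normal_part_subspace[OF subspace_tangent[of W \<alpha>]]

text \<open>
Removing the component normal to the tangent space leaves a translate of the base point by a tangent
vector.
\<close>

lemma place_foot: 
  assumes x: "x \<in> coords W"
  shows "place W (x - nu (x - x0)) \<in> affine hull \<alpha>"
proof -
  have "place W (x0 + ((x - x0) - nu (x - x0))) \<in> affine hull \<alpha>"
  proof (rule place_tangent_affine_hull[OF \<alpha> x0 nu(3)])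
    assume W: "W = TypeA"
    then have t: "\<not> toroidal W" by (simp add: toroidal_def)
    have "nu (x - x0) \<bullet> (\<chi> i. 1) = 0" using ones_in_tangent[of W \<alpha>] W nu(5) by simp
    moreover have "y \<bullet> (\<chi> i. 1) = 0" if "y \<in> coords W" for y :: "real^'n"
      using that coords_spherical[OF t, of y] W by simp
    ultimately show "(x - x0 - nu (x - x0)) \<bullet> (\<chi> i. 1) = 0"
      using x x0(1) by (simp add: inner_diff_left)
  qed
  then show ?thesis by simp
qed

lemma normal_part_place_upper:
  obtains C where "C > 0" "\<And>x. x \<in> coords W \<Longrightarrow> norm (normal_part \<alpha> (place W x)) \<le> C * norm (nu (x - x0))"
proof -
  have ne: "\<alpha> \<noteq> {}" using x0(2) by auto
  obtain R where R: "\<And>v. norm (R v) \<le> norm v"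
    "\<And>x y. y \<in> affine hull \<alpha> \<Longrightarrow> normal_part \<alpha> x = R (x - y)"
    using normal_part_linear[OF ne] by metis
  obtain C where C: "C > 0" "\<And>(y::real^'n) n. norm (place W (y + n) - place W y) \<le> C * norm n"
    by (rule place_lipschitz[of W]) (rule that)
  have "norm (normal_part \<alpha> (place W x)) \<le> C * norm (nu (x - x0))" if "x \<in> coords W" for x
  proof -
    have "norm (normal_part \<alpha> (place W x)) \<le> norm (place W x - place W (x - nu (x - x0)))"
      using R(2)[OF place_foot[OF that]] R(1) by simp
    also have "\<dots> \<le> C * norm (nu (x - x0))" using C(2)[of "x - nu (x - x0)" "nu (x - x0)"] by simp
    finally show ?thesis .
  qed
  with C(1) show ?thesis by (rule that)
qed

text \<open>
An affine equation of a wall through \<open>\<alpha>\<close> only sees the component normal to \<open>\<alpha>\<close>.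
\<close>

lemma wall_function_normal_part:
  assumes ac: "(a, c) \<in> affine_roots W" "\<alpha> \<subseteq> wall W (a, c)"
    and f: "linear f" "\<And>x. norm (f (place W x) - k) = defect W (a \<bullet> x - c)"
  shows "f (normal_part \<alpha> z) = f z - (k::complex)" "z \<in> affine hull \<alpha> \<Longrightarrow> f z = k"
proof -
  have k: "f w = k" if "w \<in> \<alpha>" for w
  proof -
    have "w \<in> wall W (a, c)" using ac(2) that by auto
    then obtain x where "w = place W x" "a \<bullet> x - c \<in> lattice W" by (auto simp: solutions_def)
    then show ?thesis using f(2)[of x] by (simp add: defect_eq_0[THEN iffD2])
  qed
  show hull: "f z = k" if "z \<in> affine hull \<alpha>" for z
    by (rule linear_eq_on_affine_hull[OF f(1) k that])
  have "closest_point (affine hull \<alpha>) z \<in> affine hull \<alpha>"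
    using x0(2) by (intro closest_point_in_set) auto
  from hull[OF this] show "f (normal_part \<alpha> z) = f z - k"
    unfolding normal_part_def by (simp add: linear_diff[OF f(1)])
qed

text \<open>
With the upper bound above, this is a quantitative form of cleanness: near the flat the normal part
in the ambient space is comparable to the normal part of the coordinates, because the ambient
equations of the walls through \<open>\<alpha>\<close> control both.
\<close>

lemma normal_part_place_lower:
  obtains K where "K > 0" "\<And>x. x \<in> coords W \<Longrightarrow> (\<forall>r\<in>affine_roots W. \<bar>fst r \<bullet> (x - x0)\<bar> \<le> 1 / 2) \<Longrightarrow>
    norm (nu (x - x0)) \<le> K * norm (normal_part \<alpha> (place W x))"
proof -
  let ?R = "roots_through W \<alpha>"
  have fin: "finite ?R" unfolding roots_through_def by (rule finite_subset[OF _ finite_affine_roots]) auto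
  have one: "\<exists>K>0. \<forall>x. \<bar>fst r \<bullet> (x - x0)\<bar> \<le> 1 / 2 \<longrightarrow> \<bar>fst r \<bullet> (x - x0)\<bar> \<le> K * norm (normal_part \<alpha> (place W x))"
    if r: "r \<in> ?R" for r
  proof -
    obtain a c where ac: "r = (a, c)" by (cases r)
    have rt: "(a, c) \<in> affine_roots W" "\<alpha> \<subseteq> wall W (a, c)" using r ac by (auto simp: roots_through_def)
    obtain f :: "complex^'n^'n \<Rightarrow> complex" and k
      where f: "linear f" "\<And>x. norm (f (place W x) - k) = defect W (a \<bullet> x - c)"
      by (rule direction_equation[OF root_direction[OF rt(1)], where c=c]) (rule that)
    obtain K where K: "K > 0" "\<And>z. norm (f z) \<le> K * norm z"
      by (rule linear_bounded_pos[OF f(1)]) (rule that)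
    have "\<bar>a \<bullet> (x - x0)\<bar> \<le> K * norm (normal_part \<alpha> (place W x))" if "\<bar>a \<bullet> (x - x0)\<bar> \<le> 1 / 2" for x
    proof -
      have "(a \<bullet> x - c) - a \<bullet> (x - x0) \<in> lattice W"
        using root_value[OF rt(2,1) x0] by (simp add: inner_diff_right)
      then have "defect W (a \<bullet> x - c) = defect W (a \<bullet> (x - x0))" by (rule defect_lattice)
      then have "\<bar>a \<bullet> (x - x0)\<bar> \<le> norm (f (place W x) - k)" using defect_ge[OF that, of W] f(2)[of x] by simp
      also have "\<dots> = norm (f (normal_part \<alpha> (place W x)))" using wall_function_normal_part(1)[OF rt f] by simp
      also have "\<dots> \<le> K * norm (normal_part \<alpha> (place W x))" by (rule K(2))
      finally show ?thesis .
    qed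
    then show ?thesis using K(1) ac by auto
  qed
  then obtain K where K: "\<And>r. r \<in> ?R \<Longrightarrow> K r > 0" "\<And>r x. r \<in> ?R \<Longrightarrow> \<bar>fst r \<bullet> (x - x0)\<bar> \<le> 1 / 2 \<Longrightarrow>
      \<bar>fst r \<bullet> (x - x0)\<bar> \<le> K r * norm (normal_part \<alpha> (place W x))"
    by metis
  obtain C where C: "C > 0" "\<And>x. norm (normal_part (kernel ?R) x) \<le> C * (\<Sum>r\<in>?R. \<bar>fst r \<bullet> x\<bar>)"
    by (rule kernel_distance[OF fin]) (rule that)
  define M where "M = C * (\<Sum>r\<in>?R. K r) + 1"
  have M: "M > 0" unfolding M_def using K(1) C(1) by (intro add_nonneg_pos mult_nonneg_nonneg sum_nonneg) (auto intro: less_imp_le)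
  have "norm (nu (x - x0)) \<le> M * norm (normal_part \<alpha> (place W x))"
    if "x \<in> coords W" "\<forall>r\<in>affine_roots W. \<bar>fst r \<bullet> (x - x0)\<bar> \<le> 1 / 2" for x
  proof -
    have "norm (nu (x - x0)) \<le> C * (\<Sum>r\<in>?R. \<bar>fst r \<bullet> (x - x0)\<bar>)" unfolding tangent_def by (rule C(2))
    also have "\<dots> \<le> C * (\<Sum>r\<in>?R. K r * norm (normal_part \<alpha> (place W x)))"
      using C(1) that(2) by (intro mult_left_mono sum_mono K(2)) (auto simp: roots_through_def)
    also have "\<dots> = (C * (\<Sum>r\<in>?R. K r)) * norm (normal_part \<alpha> (place W x))" by (simp add: sum_distrib_right mult.assoc)
    also have "\<dots> \<le> M * norm (normal_part \<alpha> (place W x))" by (intro mult_right_mono) (auto simp: M_def)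
    finally show ?thesis .
  qed
  with M show ?thesis by (rule that)
qed

lemma normal_part_place_difference:
  obtains C where "C > 0" "\<And>x x' \<epsilon>. x \<in> coords W \<Longrightarrow> x' \<in> coords W \<Longrightarrow> \<epsilon> \<in> {1, -1} \<Longrightarrow>
    norm (normal_part \<alpha> (place W x') - \<epsilon> *\<^sub>R normal_part \<alpha> (place W x))
    \<le> C * (norm (nu (x' - x0) - \<epsilon> *\<^sub>R nu (x - x0)) + (norm (nu (x - x0)))\<^sup>2
        + 2 * (norm (x' - x0) + norm (x - x0)) * norm (nu (x - x0)))"
proof -
  have ne: "\<alpha> \<noteq> {}" using x0(2) by auto
  obtain R where R: "linear R" "\<And>v. norm (R v) \<le> norm v"
    "\<And>x y. y \<in> affine hull \<alpha> \<Longrightarrow> normal_part \<alpha> x = R (x - y)"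
    using normal_part_linear[OF ne] by metis
  obtain C where C: "C > 0" "\<And>(y::real^'n) y' n n' \<epsilon>. \<epsilon> \<in> {1, -1} \<Longrightarrow>
       norm ((place W (y' + n') - place W y') - \<epsilon> *\<^sub>R (place W (y + n) - place W y))
       \<le> C * (norm (n' - \<epsilon> *\<^sub>R n) + (norm n)\<^sup>2 + norm (y' - y) * norm n)"
    by (rule place_second_difference[of W]) (rule that)
  have "norm (normal_part \<alpha> (place W x') - \<epsilon> *\<^sub>R normal_part \<alpha> (place W x))
    \<le> C * (norm (nu (x' - x0) - \<epsilon> *\<^sub>R nu (x - x0)) + (norm (nu (x - x0)))\<^sup>2
        + 2 * (norm (x' - x0) + norm (x - x0)) * norm (nu (x - x0)))"
    if x: "x \<in> coords W" "x' \<in> coords W" and eps: "\<epsilon> \<in> {1, -1}" for x x' \<epsilon>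
  proof -
    let ?n = "nu (x - x0)" and ?n' = "nu (x' - x0)"
    let ?y = "x - ?n" and ?y' = "x' - ?n'"
    have "normal_part \<alpha> (place W x') - \<epsilon> *\<^sub>R normal_part \<alpha> (place W x)
      = R ((place W (?y' + ?n') - place W ?y') - \<epsilon> *\<^sub>R (place W (?y + ?n) - place W ?y))"
      using R(3)[OF place_foot[OF x(1)], of "place W x"] R(3)[OF place_foot[OF x(2)], of "place W x'"]
      by (simp add: linear_diff[OF R(1)] linear_scale[OF R(1)])
    then have "norm (normal_part \<alpha> (place W x') - \<epsilon> *\<^sub>R normal_part \<alpha> (place W x))
      \<le> norm ((place W (?y' + ?n') - place W ?y') - \<epsilon> *\<^sub>R (place W (?y + ?n) - place W ?y))"
      using R(2) by simp
    also have "\<dots> \<le> C * (norm (?n' - \<epsilon> *\<^sub>R ?n) + (norm ?n)\<^sup>2 + norm (?y' - ?y) * norm ?n)" by (rule C(2)[OF eps])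
    also have "\<dots> \<le> C * (norm (?n' - \<epsilon> *\<^sub>R ?n) + (norm ?n)\<^sup>2 + (2 * (norm (x' - x0) + norm (x - x0))) * norm ?n)"
    proof (intro mult_left_mono add_left_mono mult_right_mono)
      have "?y' - ?y = ((x' - x0) - ?n') - ((x - x0) - ?n)" by simp
      then have "norm (?y' - ?y) \<le> norm ((x' - x0) - ?n') + norm ((x - x0) - ?n)"
        by (simp only: norm_triangle_ineq4)
      then have "norm (?y' - ?y) \<le> (norm (x' - x0) + norm ?n') + (norm (x - x0) + norm ?n)"
        using norm_triangle_ineq4[of "x' - x0" ?n'] norm_triangle_ineq4[of "x - x0" ?n] by linarith
      then show "norm (?y' - ?y) \<le> 2 * (norm (x' - x0) + norm (x - x0))"
        using nu(2)[of "x - x0"] nu(2)[of "x' - x0"] by simp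
    qed (use C(1) in auto)
    finally show ?thesis .
  qed
  with C(1) show ?thesis by (rule that)
qed

end


section \<open>Reflected degenerations\<close>

lemma null_ratioI:
  fixes f g h :: "nat \<Rightarrow> real"
  assumes "(\<lambda>m. h m / g m) \<longlonglongrightarrow> 0" "\<forall>\<^sub>F m in sequentially. 0 \<le> f m \<and> f m \<le> C * h m" "\<And>m. 0 < g m"
  shows "(\<lambda>m. f m / g m) \<longlonglongrightarrow> 0"
proof (rule Lim_null_comparison)
  show "(\<lambda>m. C * (h m / g m)) \<longlonglongrightarrow> 0" using tendsto_mult_right_zero[OF assms(1)] .
  show "\<forall>\<^sub>F m in sequentially. norm (f m / g m) \<le> C * (h m / g m)"
    using assms(2)
  proof eventually_elim
    case (elim m)
    then have "f m / g m \<le> (C * h m) / g m" using assms(3)[of m] by (intro divide_right_mono) auto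
    then show ?case using elim assms(3)[of m] by simp
  qed
qed

lemma null_ratio_eventually:
  fixes f g :: "nat \<Rightarrow> real"
  assumes "(\<lambda>m. f m / g m) \<longlonglongrightarrow> 0" "\<And>m. 0 < g m" "0 < e"
  shows "\<forall>\<^sub>F m in sequentially. f m \<le> e * g m"
proof -
  have "\<forall>\<^sub>F m in sequentially. f m / g m < e" by (rule order_tendstoD(2)[OF assms(1,3)])
  then show ?thesis
  proof eventually_elim
    case (elim m)
    then show ?case using assms(2)[of m] by (simp add: divide_less_eq less_imp_le)
  qed
qed

text \<open>
A functional that vanishes on the limit of the lines is small compared with the vectors spanning
them, as such a vector is recovered from the values of its line on a basis.
\<close>

lemma line_limit_functional:
  fixes v :: "nat \<Rightarrow> 'e::euclidean_space" and f :: "'e \<Rightarrow> 'f::real_normed_vector"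
  assumes f: "linear f" "continuous_on UNIV f" and nz: "\<And>m. v m \<noteq> 0"
    and lim: "\<And>u. (\<lambda>m. line (v m) u) \<longlonglongrightarrow> L u" and z: "\<And>u. f (L u) = 0"
  shows "(\<lambda>m. norm (f (v m)) / norm (v m)) \<longlonglongrightarrow> 0"
proof (rule Lim_null_comparison)
  show "\<forall>\<^sub>F m in sequentially. norm (norm (f (v m)) / norm (v m)) \<le> (\<Sum>u\<in>Basis. norm (f (line (v m) u)))"
  proof (rule always_eventually, rule allI)
    fix m
    let ?w = "v m /\<^sub>R norm (v m)"
    have "v m = (\<Sum>u\<in>Basis. (v m \<bullet> u) *\<^sub>R u)" by (simp add: euclidean_representation)
    have "line (v m) (v m) = v m" using nz by (simp add: line_def)
    then have "f (v m) = f (line (v m) (\<Sum>u\<in>Basis. (v m \<bullet> u) *\<^sub>R u))" by (simp add: euclidean_representation)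
    also have "\<dots> = (\<Sum>u\<in>Basis. (v m \<bullet> u) *\<^sub>R f (line (v m) u))"
      by (simp add: linear_sum[OF linear_line] linear_scale[OF linear_line] linear_sum[OF f(1)] linear_scale[OF f(1)])
    also have "norm \<dots> \<le> (\<Sum>u\<in>Basis. \<bar>v m \<bullet> u\<bar> * norm (f (line (v m) u)))"
      by (rule order_trans[OF norm_sum]) simp
    also have "\<dots> \<le> (\<Sum>u\<in>Basis. norm (v m) * norm (f (line (v m) u)))"
      using Basis_le_norm by (intro sum_mono mult_right_mono) auto
    finally have "norm (f (v m)) \<le> norm (v m) * (\<Sum>u\<in>Basis. norm (f (line (v m) u)))" by (simp add: sum_distrib_left)
    then show "norm (norm (f (v m)) / norm (v m)) \<le> (\<Sum>u\<in>Basis. norm (f (line (v m) u)))"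
      using nz[of m] by (simp add: divide_le_eq mult.commute)
  qed
  have "(\<lambda>m. f (line (v m) u)) \<longlonglongrightarrow> f (L u)" for u
    by (rule continuous_on_tendsto_compose[OF f(2) lim]) auto
  then have "(\<lambda>m. \<Sum>u\<in>Basis. norm (f (line (v m) u))) \<longlonglongrightarrow> (\<Sum>u\<in>Basis. norm (f (L u)))"
    by (intro tendsto_sum tendsto_norm)
  then show "(\<lambda>m. \<Sum>u\<in>Basis. norm (f (line (v m) u))) \<longlonglongrightarrow> 0" by (simp add: z)
qed

text \<open>
Generic configurations \<open>X m\<close> that converge to \<open>x0\<close>, with limiting normal directions \<open>l\<close>, and their reflections
\<open>Y m\<close> in the flat \<open>\<beta>\<close>.  The assumption \<open>tangential\<close> is what is known about a limit that lies on the
divisor of \<open>\<beta>\<close>: its directions normal to the irreducible flats \<open>\<gamma>\<close> strictly inside \<open>\<beta>\<close> satisfy the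
linear parts of the ambient equations of \<open>\<beta>\<close>.
\<close>

locale degeneration =
  fixes W :: coxeter and \<beta> :: "(complex^'n^'n) set" and x0 :: "real^'n" and X Y :: "nat \<Rightarrow> real^'n"
    and l :: "(complex^'n^'n) set \<Rightarrow> complex^'n^'n \<Rightarrow> complex^'n^'n"
  assumes \<beta>: "\<beta> \<in> min_building_set W" and x0: "x0 \<in> coords W" "place W x0 \<in> \<beta>"
    and XY: "\<And>m. X m \<in> coords W" "\<And>m. Y m \<in> coords W"
    and X_lim: "X \<longlonglongrightarrow> x0"
    and generic: "\<And>\<alpha> m. \<alpha> \<in> min_building_set W \<Longrightarrow> normal_part \<alpha> (place W (X m)) \<noteq> 0"
    and lines: "\<And>\<alpha> u. \<alpha> \<in> min_building_set W \<Longrightarrow>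
        (\<lambda>m. line (normal_part \<alpha> (place W (X m))) u) \<longlonglongrightarrow> l \<alpha> u"
    and tangential: "\<And>\<gamma> a c f k u. \<gamma> \<in> min_building_set W \<Longrightarrow> \<gamma> \<subseteq> \<beta> \<Longrightarrow> \<not> \<beta> \<subseteq> \<gamma> \<Longrightarrow> place W x0 \<in> \<gamma> \<Longrightarrow>
        (a, c) \<in> roots_through W \<beta> \<Longrightarrow> linear f \<Longrightarrow>
        (\<And>x::real^'n. norm (f (place W x) - (k::complex)) = defect W (a \<bullet> x - c)) \<Longrightarrow> f (l \<gamma> u) = 0"
    and mid: "\<And>m. (1 / 2) *\<^sub>R (X m + Y m) - x0 \<in> tangent W \<beta>"
    and orth: "\<And>m v. v \<in> tangent W \<beta> \<Longrightarrow> v \<bullet> (Y m - X m) = 0"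
begin

lemma \<beta>i: "\<beta> \<in> intersections W" using \<beta> by (simp add: min_building_set_def)

text \<open>
A measure of the distance from \<open>\<beta>\<close>: for a bracket off the axis, of how far its particles are apart.
\<close>

abbreviation "spread m \<equiv> (\<Sum>r\<in>roots_through W \<beta>. \<bar>fst r \<bullet> (X m - x0)\<bar>)"

lemma finite_roots_through: "finite (roots_through W (\<alpha> :: (complex^'n^'n) set))"
  unfolding roots_through_def by (rule finite_subset[OF _ finite_affine_roots]) auto

lemma displacement_bound: obtains C where "C > 0" "\<And>m. norm (Y m - X m) \<le> C * spread m"
proof -
  note nu = normal_part_subspace[OF subspace_tangent[of W \<beta>]]
  obtain C where C: "C > 0" "\<And>x. norm (normal_part (kernel (roots_through W \<beta>)) x) \<le> C * (\<Sum>r\<in>roots_through W \<beta>. \<bar>fst r \<bullet> x\<bar>)"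
    by (rule kernel_distance[OF finite_roots_through]) (rule that)
  have "norm (Y m - X m) \<le> (2 * C) * spread m" for m
  proof -
    let ?d = "Y m - X m"
    let ?w = "?d - normal_part (tangent W \<beta>) ?d"
    have "?w \<bullet> ?d = 0" "normal_part (tangent W \<beta>) ?d \<bullet> ?w = 0" using orth nu(3,5) by auto
    then have "?w \<bullet> ?w = 0" by (simp add: inner_diff_right inner_commute)
    then have "norm ?d = norm (normal_part (kernel (roots_through W \<beta>)) ?d)" by (simp add: tangent_def)
    also have "\<dots> \<le> C * (\<Sum>r\<in>roots_through W \<beta>. \<bar>fst r \<bullet> ?d\<bar>)" by (rule C(2))
    also have "(\<Sum>r\<in>roots_through W \<beta>. \<bar>fst r \<bullet> ?d\<bar>) = (\<Sum>r\<in>roots_through W \<beta>. 2 * \<bar>fst r \<bullet> (X m - x0)\<bar>)"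
    proof (intro sum.cong refl)
      fix r assume r: "r \<in> roots_through W \<beta>"
      have "fst r \<bullet> ((1 / 2) *\<^sub>R (X m + Y m) - x0) = 0" using mid[of m] r by (simp add: tangent_def kernel_def)
      then have "fst r \<bullet> ?d = - 2 * (fst r \<bullet> (X m - x0))" by (simp add: inner_diff_right inner_add_right)
      then show "\<bar>fst r \<bullet> ?d\<bar> = 2 * \<bar>fst r \<bullet> (X m - x0)\<bar>" by (simp add: abs_mult)
    qed
    also have "C * \<dots> = (2 * C) * spread m" by (simp add: sum_distrib_left mult.assoc mult.left_commute)
    finally show ?thesis .
  qed
  moreover have "2 * C > 0" using C(1) by simp
  ultimately show ?thesis by (intro that)
qed

lemma spread_lim: "spread \<longlonglongrightarrow> 0"
proof -
  have "(\<lambda>m. X m - x0) \<longlonglongrightarrow> 0" using X_lim by (simp add: LIM_zero)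
  then have "spread \<longlonglongrightarrow> (\<Sum>r\<in>roots_through W \<beta>. \<bar>fst r \<bullet> 0\<bar>)"
    by (intro tendsto_sum tendsto_rabs tendsto_inner tendsto_const)
  then show ?thesis by simp
qed

lemma displacement_lim: "(\<lambda>m. Y m - X m) \<longlonglongrightarrow> 0"
proof -
  obtain C where C: "C > 0" "\<And>m. norm (Y m - X m) \<le> C * spread m" by (rule displacement_bound) (rule that)
  show ?thesis
    by (rule Lim_null_comparison[OF always_eventually tendsto_mult_right_zero[OF spread_lim]]) (use C(2) in blast)
qed

lemma Y_lim: "Y \<longlonglongrightarrow> x0"
  using tendsto_add[OF displacement_lim X_lim] by simp

lemma near: "\<forall>\<^sub>F m in sequentially. \<forall>r\<in>affine_roots W. \<bar>fst r \<bullet> (X m - x0)\<bar> \<le> 1 / 2"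
proof (rule eventually_ball_finite[OF finite_affine_roots], rule ballI)
  fix r :: "(real^'n) \<times> real"
  have "(\<lambda>m. X m - x0) \<longlonglongrightarrow> 0" using X_lim by (simp add: LIM_zero)
  then have "(\<lambda>m. \<bar>fst r \<bullet> (X m - x0)\<bar>) \<longlonglongrightarrow> \<bar>fst r \<bullet> 0\<bar>"
    by (intro tendsto_rabs tendsto_inner tendsto_const)
  then have "\<forall>\<^sub>F m in sequentially. \<bar>fst r \<bullet> (X m - x0)\<bar> < 1 / 2" by (rule order_tendstoD(2)) simp
  then show "\<forall>\<^sub>F m in sequentially. \<bar>fst r \<bullet> (X m - x0)\<bar> \<le> 1 / 2" by (rule eventually_mono) simp
qed

text \<open>
The distance from \<open>\<beta>\<close> is of smaller order than the distance from an irreducible flat strictly inside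
\<open>\<beta>\<close>, since the limiting direction normal to this flat is tangential to \<open>\<beta>\<close>.
\<close>

lemma spread_negligible:
  assumes \<gamma>: "\<gamma> \<in> min_building_set W" "\<gamma> \<subseteq> \<beta>" "\<not> \<beta> \<subseteq> \<gamma>" "place W x0 \<in> \<gamma>"
  shows "(\<lambda>m. spread m / norm (normal_part \<gamma> (place W (X m)))) \<longlonglongrightarrow> 0"
proof -
  let ?N = "\<lambda>m. normal_part \<gamma> (place W (X m))"
  have \<gamma>i: "\<gamma> \<in> intersections W" using \<gamma> by (simp add: min_building_set_def)
  have "(\<lambda>m. \<bar>fst r \<bullet> (X m - x0)\<bar> / norm (?N m)) \<longlonglongrightarrow> 0" if r: "r \<in> roots_through W \<beta>" for r
  proof -
    obtain a c where ac: "r = (a, c)" by (cases r)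
    have rt: "(a, c) \<in> affine_roots W" "\<beta> \<subseteq> wall W (a, c)" using r ac by (auto simp: roots_through_def)
    have rg: "\<gamma> \<subseteq> wall W (a, c)" using rt(2) \<gamma>(2) by blast
    obtain f :: "complex^'n^'n \<Rightarrow> complex" and k
      where f: "linear f" "\<And>x. norm (f (place W x) - k) = defect W (a \<bullet> x - c)"
      by (rule direction_equation[OF root_direction[OF rt(1)], where c=c]) (rule that)
    have cf: "continuous_on UNIV f" using f(1) by (simp add: linear_continuous_on linear_conv_bounded_linear)
    have lim: "(\<lambda>m. norm (f (?N m)) / norm (?N m)) \<longlonglongrightarrow> 0"
    proof (rule line_limit_functional[OF f(1) cf generic[OF \<gamma>(1)] lines[OF \<gamma>(1)]])
      show "f (l \<gamma> u) = 0" for u using tangential[OF \<gamma> r[unfolded ac] f] .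
    qed
    have le: "\<bar>a \<bullet> (X m - x0)\<bar> \<le> norm (f (?N m))" if "\<bar>a \<bullet> (X m - x0)\<bar> \<le> 1 / 2" for m
    proof -
      have "(a \<bullet> X m - c) - a \<bullet> (X m - x0) \<in> lattice W"
        using root_value[OF rt(2,1) x0] by (simp add: inner_diff_right)
      then have "defect W (a \<bullet> X m - c) = defect W (a \<bullet> (X m - x0))" by (rule defect_lattice)
      then show ?thesis
        using defect_ge[OF that, of W] f(2)[of "X m"] wall_function_normal_part(1)[OF \<gamma>i x0(1) \<gamma>(4) rt(1) rg f] by simp
    qed
    have "\<forall>\<^sub>F m in sequentially. 0 \<le> \<bar>fst r \<bullet> (X m - x0)\<bar> \<and> \<bar>fst r \<bullet> (X m - x0)\<bar> \<le> 1 * norm (f (?N m))"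
      using near
    proof eventually_elim
      case (elim m)
      then have "\<bar>a \<bullet> (X m - x0)\<bar> \<le> 1 / 2" using rt(1) by force
      then show ?case using le[of m] ac by simp
    qed
    then show ?thesis by (rule null_ratioI[OF lim]) (use generic[OF \<gamma>(1)] in simp)
  qed
  then have "(\<lambda>m. \<Sum>r\<in>roots_through W \<beta>. \<bar>fst r \<bullet> (X m - x0)\<bar> / norm (?N m)) \<longlonglongrightarrow> 0"
    by (intro tendsto_null_sum)
  then show ?thesis by (simp add: sum_divide_distrib)
qed

abbreviation nu :: "(complex^'n^'n) set \<Rightarrow> real^'n \<Rightarrow> real^'n" where
  "nu \<alpha> \<equiv> normal_part (tangent W \<alpha>)"

lemma nu_nonzero:
  assumes \<alpha>: "\<alpha> \<in> min_building_set W" "place W x0 \<in> \<alpha>"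
  shows "nu \<alpha> (X m - x0) \<noteq> 0"
proof
  assume z: "nu \<alpha> (X m - x0) = 0"
  have \<alpha>i: "\<alpha> \<in> intersections W" using \<alpha> by (simp add: min_building_set_def)
  obtain C where "C > 0" "\<And>x. x \<in> coords W \<Longrightarrow> norm (normal_part \<alpha> (place W x)) \<le> C * norm (nu \<alpha> (x - x0))"
    by (rule normal_part_place_upper[OF \<alpha>i x0(1) \<alpha>(2)]) (rule that)
  from this(2)[OF XY(1)[of m]] generic[OF \<alpha>(1), of m] z show False by simp
qed

text \<open>
Compared with the distance from \<open>\<alpha>\<close>, the displacement normal to \<open>\<alpha>\<close> tends to \<open>0\<close>.  It vanishes if the
roots of \<open>\<alpha>\<close> and \<open>\<beta>\<close> are orthogonal.  Otherwise \<open>\<alpha>\<close> and \<open>\<beta>\<close> span an irreducible \<open>\<gamma>\<close>, whose distance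
is bounded by the distances from \<open>\<alpha>\<close> and \<open>\<beta>\<close>; the latter is negligible, so that from \<open>\<alpha>\<close> dominates.
\<close>

lemma displacement_negligible:
  assumes \<alpha>: "\<alpha> \<in> min_building_set W" "place W x0 \<in> \<alpha>" "\<not> \<beta> \<subseteq> \<alpha>"
  shows "(\<lambda>m. norm (nu \<alpha> (Y m - X m)) / norm (nu \<alpha> (X m - x0))) \<longlonglongrightarrow> 0"
  using \<alpha>(1) \<beta> \<alpha>(2) x0(2)
proof (cases rule: building_set_meet)
  case orthogonal
  have "nu \<alpha> (Y m - X m) = 0" for m
  proof -
    have "fst r \<bullet> (Y m - X m) = 0" if r: "r \<in> roots_through W \<alpha>" for r
    proof -
      have "fst r' \<bullet> fst r = 0" if "r' \<in> roots_through W \<beta>" for r'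
        using orthogonal r that by (metis inner_commute)
      then have "fst r \<in> tangent W \<beta>" by (simp add: tangent_def kernel_def)
      then show ?thesis by (rule orth)
    qed
    then have "Y m - X m \<in> tangent W \<alpha>" by (simp add: tangent_def kernel_def)
    then show ?thesis by (rule normal_part_subspace(4)[OF subspace_tangent])
  qed
  then show ?thesis by simp
next
  case (irreducible \<gamma>)
  let ?N = "\<lambda>m. norm (normal_part \<gamma> (place W (X m)))"
  let ?n = "\<lambda>m. norm (nu \<alpha> (X m - x0))"
  have \<gamma>i: "\<gamma> \<in> intersections W" using irreducible(1) by (simp add: min_building_set_def)
  have \<gamma>\<beta>: "\<not> \<beta> \<subseteq> \<gamma>" using irreducible(3) \<alpha>(3) by blast
  have s: "(\<lambda>m. spread m / ?N m) \<longlonglongrightarrow> 0"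
    by (rule spread_negligible[OF irreducible(1,4) \<gamma>\<beta> irreducible(2)])
  have Npos: "0 < ?N m" for m using generic[OF irreducible(1)] by simp
  obtain C1 where C1: "C1 > 0" "\<And>x. x \<in> coords W \<Longrightarrow> norm (normal_part \<gamma> (place W x)) \<le> C1 * norm (nu \<gamma> (x - x0))"
    by (rule normal_part_place_upper[OF \<gamma>i x0(1) irreducible(2)]) (rule that)
  let ?R = "roots_through W \<alpha> \<union> roots_through W \<beta>"
  have tan: "tangent W \<gamma> = kernel ?R" unfolding irreducible(5) by (auto simp: tangent_def kernel_def)
  obtain C2 where C2: "C2 > 0" "\<And>x. norm (normal_part (kernel ?R) x) \<le> C2 * (\<Sum>r\<in>?R. \<bar>fst r \<bullet> x\<bar>)"
    by (rule kernel_distance[of ?R]) (use finite_roots_through that in auto)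
  obtain C3 where C3: "C3 > 0" "\<And>m. norm (Y m - X m) \<le> C3 * spread m" by (rule displacement_bound) (rule that)
  define A where "A = (\<Sum>r\<in>roots_through W \<alpha>. norm (fst r)) + 1"
  have A: "A > 0" unfolding A_def by (intro add_nonneg_pos sum_nonneg) auto
  have N_le: "?N m \<le> C1 * C2 * A * ?n m + C1 * C2 * spread m" for m
  proof -
    let ?x = "X m - x0"
    have a: "(\<Sum>r\<in>roots_through W \<alpha>. \<bar>fst r \<bullet> ?x\<bar>) \<le> A * ?n m"
    proof -
      have "\<bar>fst r \<bullet> ?x\<bar> \<le> norm (fst r) * ?n m" if r: "r \<in> roots_through W \<alpha>" for r
      proof -
        have "fst r \<bullet> (?x - nu \<alpha> ?x) = 0" using normal_part_subspace(3)[OF subspace_tangent[of W \<alpha>], of ?x] r by (simp add: tangent_def kernel_def)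
        then have "fst r \<bullet> ?x = fst r \<bullet> nu \<alpha> ?x" by (simp add: inner_diff_right)
        then show ?thesis using Cauchy_Schwarz_ineq2[of "fst r" "nu \<alpha> ?x"] by simp
      qed
      then have "(\<Sum>r\<in>roots_through W \<alpha>. \<bar>fst r \<bullet> ?x\<bar>) \<le> (\<Sum>r\<in>roots_through W \<alpha>. norm (fst r) * ?n m)" by (intro sum_mono)
      also have "\<dots> \<le> A * ?n m" unfolding A_def sum_distrib_right[symmetric] by (intro mult_right_mono) auto
      finally show ?thesis .
    qed
    have "0 \<le> (\<Sum>r\<in>roots_through W \<alpha> \<inter> roots_through W \<beta>. \<bar>fst r \<bullet> ?x\<bar>)" by (simp add: sum_nonneg)
    then have "(\<Sum>r\<in>?R. \<bar>fst r \<bullet> ?x\<bar>) \<le> (\<Sum>r\<in>roots_through W \<alpha>. \<bar>fst r \<bullet> ?x\<bar>) + spread m"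
      using sum.union_inter[OF finite_roots_through finite_roots_through, of "\<lambda>r. \<bar>fst r \<bullet> ?x\<bar>" \<alpha> \<beta>]
      by linarith
    then have "C2 * (\<Sum>r\<in>?R. \<bar>fst r \<bullet> ?x\<bar>) \<le> C2 * (A * ?n m + spread m)"
      using a C2(1) by (intro mult_left_mono) auto
    then have "norm (nu \<gamma> ?x) \<le> C2 * (A * ?n m + spread m)" using C2(2)[of ?x] tan by simp
    then have "C1 * norm (nu \<gamma> ?x) \<le> C1 * (C2 * (A * ?n m + spread m))" using C1(1) by (intro mult_left_mono) auto
    then show ?thesis using C1(2)[OF XY(1)[of m]] by (simp add: algebra_simps)
  qed
  have "\<forall>\<^sub>F m in sequentially. spread m \<le> (1 / (2 * C1 * C2)) * ?N m"
    by (rule null_ratio_eventually[OF s Npos]) (use C1 C2 in simp)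
  \<comment> \<open>Half of the distance from \<open>\<gamma>\<close> absorbs the contribution of \<open>\<beta>\<close>.\<close>
  then have ev: "\<forall>\<^sub>F m in sequentially. ?N m \<le> (2 * C1 * C2 * A) * ?n m"
  proof eventually_elim
    case (elim m)
    have "C1 * C2 * spread m \<le> C1 * C2 * ((1 / (2 * C1 * C2)) * ?N m)" using elim C1(1) C2(1) by (intro mult_left_mono) auto
    also have "\<dots> = ?N m / 2" using C1(1) C2(1) by simp
    finally show ?case using N_le[of m] by (simp add: algebra_simps)
  qed
  let ?K = "2 * C1 * C2 * A"
  have K: "?K > 0" using C1(1) C2(1) A by simp
  show ?thesis
  proof (rule Lim_null_comparison)
    show "(\<lambda>m. C3 * ?K * (spread m / ?N m)) \<longlonglongrightarrow> 0" using tendsto_mult_right_zero[OF s] .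
    show "\<forall>\<^sub>F m in sequentially. norm (norm (nu \<alpha> (Y m - X m)) / ?n m) \<le> C3 * ?K * (spread m / ?N m)"
      using ev
    proof eventually_elim
      case (elim m)
      have n: "?n m > 0" using nu_nonzero[OF \<alpha>(1,2)] by simp
      have sp: "0 \<le> spread m" by (simp add: sum_nonneg)
      have "norm (nu \<alpha> (Y m - X m)) \<le> C3 * spread m" using normal_part_subspace(2)[OF subspace_tangent[of W \<alpha>], of "Y m - X m"] C3(2)[of m] by linarith
      then have "norm (nu \<alpha> (Y m - X m)) / ?n m \<le> C3 * spread m / ?n m" using n by (intro divide_right_mono) auto
      also have "\<dots> \<le> C3 * spread m / (?N m / ?K)"
      proof (rule divide_left_mono)
        show "?N m / ?K \<le> ?n m" using elim K by (simp add: divide_le_eq mult.commute)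
      qed (use C3(1) sp n Npos[of m] K in auto)
      finally show ?case using n by (simp add: mult_ac)
    qed
  qed
qed

definition sign :: "(complex^'n^'n) set \<Rightarrow> real" where
  "sign \<alpha> = (if \<beta> \<subseteq> \<alpha> then -1 else 1)"

text \<open>
The reflection in \<open>\<beta>\<close> acts on the normal space of a flat \<open>\<alpha> \<supseteq> \<beta>\<close> as \<open>-1\<close>; on that of any other
irreducible flat it is asymptotically the identity.
\<close>

lemma reflected_normal:
  assumes \<alpha>: "\<alpha> \<in> min_building_set W" "place W x0 \<in> \<alpha>"
  shows "(\<lambda>m. norm (nu \<alpha> (Y m - x0) - sign \<alpha> *\<^sub>R nu \<alpha> (X m - x0)) / norm (nu \<alpha> (X m - x0))) \<longlonglongrightarrow> 0"
proof (cases "\<beta> \<subseteq> \<alpha>")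
  case True
  note nu = normal_part_subspace[OF subspace_tangent[of W \<alpha>]]
  have "roots_through W \<alpha> \<subseteq> roots_through W \<beta>" using True unfolding roots_through_def by blast
  then have "tangent W \<beta> \<subseteq> tangent W \<alpha>" unfolding tangent_def kernel_def by blast
  then have "nu \<alpha> ((1 / 2) *\<^sub>R (X m + Y m) - x0) = 0" for m using mid nu(4) by blast
  then have "nu \<alpha> (2 *\<^sub>R ((1 / 2) *\<^sub>R (X m + Y m) - x0)) = 0" for m by (simp only: linear_scale[OF nu(1)] scaleR_zero_right)
  moreover have "2 *\<^sub>R ((1 / 2) *\<^sub>R (X m + Y m) - x0) = (Y m - x0) + (X m - x0)" for m by (simp add: algebra_simps scaleR_2)
  ultimately have "nu \<alpha> (Y m - x0) + nu \<alpha> (X m - x0) = 0" for m by (simp add: linear_add[OF nu(1), symmetric])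
  then show ?thesis using True by (simp add: sign_def)
next
  case False
  note nu = normal_part_subspace[OF subspace_tangent[of W \<alpha>]]
  have "nu \<alpha> (Y m - x0) - nu \<alpha> (X m - x0) = nu \<alpha> (Y m - X m)" for m by (simp add: linear_diff[OF nu(1), symmetric])
  then show ?thesis using displacement_negligible[OF \<alpha> False] False by (simp add: sign_def)
qed

text \<open>
Off \<open>\<alpha>\<close> the normal direction is continuous.  On \<open>\<alpha>\<close>, the estimate for the coordinates carries over to the
ambient space because the two normal parts are comparable there, and the sign is lost in the
projective space.
\<close>

theorem reflected_lines:
  assumes \<alpha>: "\<alpha> \<in> min_building_set W"
  shows "(\<lambda>m. line (normal_part \<alpha> (place W (Y m))) u) \<longlonglongrightarrow> l \<alpha> u"
proof (cases "place W x0 \<in> \<alpha>")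
  case False
  have \<alpha>i: "\<alpha> \<in> intersections W" using \<alpha> by (simp add: min_building_set_def)
  have nz: "normal_part \<alpha> (place W x0) \<noteq> 0"
    using flat_section[OF \<alpha>i x0(1)] normal_part_eq_0 intersections_nonempty[OF \<alpha>i] False by blast
  have c: "(\<lambda>m. normal_part \<alpha> (place W (Z m))) \<longlonglongrightarrow> normal_part \<alpha> (place W x0)" if "Z \<longlonglongrightarrow> x0" for Z
    by (rule continuous_on_tendsto_compose[OF continuous_normal_part[of UNIV]
          continuous_on_tendsto_compose[OF continuous_place[of UNIV] that]]) auto
  have "l \<alpha> u = line (normal_part \<alpha> (place W x0)) u"
    by (rule LIMSEQ_unique[OF lines[OF \<alpha>] continuous_line[OF c[OF X_lim] nz]])
  then show ?thesis using continuous_line[OF c[OF Y_lim] nz] by simp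
next
  case True
  have \<alpha>i: "\<alpha> \<in> intersections W" using \<alpha> by (simp add: min_building_set_def)
  let ?N = "\<lambda>m. normal_part \<alpha> (place W (X m))" and ?M = "\<lambda>m. normal_part \<alpha> (place W (Y m))"
  let ?n = "\<lambda>m. nu \<alpha> (X m - x0)" and ?n' = "\<lambda>m. nu \<alpha> (Y m - x0)"
  have eps: "sign \<alpha> \<in> {1, -1}" by (simp add: sign_def)
  obtain K where K: "K > 0" "\<And>x. x \<in> coords W \<Longrightarrow> (\<forall>r\<in>affine_roots W. \<bar>fst r \<bullet> (x - x0)\<bar> \<le> 1 / 2) \<Longrightarrow>
    norm (nu \<alpha> (x - x0)) \<le> K * norm (normal_part \<alpha> (place W x))"
    by (rule normal_part_place_lower[OF \<alpha>i x0(1) True]) (rule that)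
  obtain C where C: "C > 0" "\<And>x x' \<epsilon>. x \<in> coords W \<Longrightarrow> x' \<in> coords W \<Longrightarrow> \<epsilon> \<in> {1, -1} \<Longrightarrow>
    norm (normal_part \<alpha> (place W x') - \<epsilon> *\<^sub>R normal_part \<alpha> (place W x))
    \<le> C * (norm (nu \<alpha> (x' - x0) - \<epsilon> *\<^sub>R nu \<alpha> (x - x0)) + (norm (nu \<alpha> (x - x0)))\<^sup>2
        + 2 * (norm (x' - x0) + norm (x - x0)) * norm (nu \<alpha> (x - x0)))"
    by (rule normal_part_place_difference[OF \<alpha>i x0(1) True]) (rule that)
  show ?thesis
  proof (rule line_close_tendsto[OF lines[OF \<alpha>] generic[OF \<alpha>] eps])
    let ?b = "\<lambda>m. norm (?n' m - sign \<alpha> *\<^sub>R ?n m) / norm (?n m) + norm (?n m) + 2 * (norm (Y m - x0) + norm (X m - x0))"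
    have X0: "(\<lambda>m. X m - x0) \<longlonglongrightarrow> 0" "(\<lambda>m. Y m - x0) \<longlonglongrightarrow> 0" using X_lim Y_lim by (simp_all add: LIM_zero)
    have n0: "(\<lambda>m. norm (?n m)) \<longlonglongrightarrow> 0"
      by (rule Lim_null_comparison[OF always_eventually tendsto_norm_zero[OF X0(1)]])
        (simp add: normal_part_subspace(2)[OF subspace_tangent])
    have "?b \<longlonglongrightarrow> 0 + 0 + 2 * (0 + 0)"
      by (intro tendsto_add tendsto_mult tendsto_const reflected_normal[OF \<alpha> True] n0 tendsto_norm_zero X0)
    then have b0: "(\<lambda>m. C * K * ?b m) \<longlonglongrightarrow> 0" using tendsto_mult_right_zero by force
    show "(\<lambda>m. norm (?M m - sign \<alpha> *\<^sub>R ?N m) / norm (?N m)) \<longlonglongrightarrow> 0"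
    proof (rule Lim_null_comparison[OF _ b0])
      show "\<forall>\<^sub>F m in sequentially. norm (norm (?M m - sign \<alpha> *\<^sub>R ?N m) / norm (?N m)) \<le> C * K * ?b m"
        using near
      proof eventually_elim
        case (elim m)
        have n: "norm (?n m) > 0" using nu_nonzero[OF \<alpha> True] by simp
        have N: "norm (?N m) > 0" using generic[OF \<alpha>] by simp
        have "norm (?M m - sign \<alpha> *\<^sub>R ?N m) \<le> C * (norm (?n' m - sign \<alpha> *\<^sub>R ?n m) + (norm (?n m))\<^sup>2
          + 2 * (norm (Y m - x0) + norm (X m - x0)) * norm (?n m))" by (rule C(2)[OF XY(1) XY(2) eps])
        also have "\<dots> = C * (?b m * norm (?n m))" using n by (simp add: field_simps power2_eq_square)
        also have "\<dots> \<le> C * (?b m * (K * norm (?N m)))"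
          using K(2)[OF XY(1) elim] C(1) n by (intro mult_left_mono) (auto intro!: add_nonneg_nonneg)
        finally have "norm (?M m - sign \<alpha> *\<^sub>R ?N m) \<le> (C * K * ?b m) * norm (?N m)" by (simp add: mult.assoc mult.left_commute)
        then show ?case using N by (simp add: divide_le_eq)
      qed
    qed
  qed
qed

text \<open>
If \<open>x0\<close> lies on the wall, then a component of the wall is an irreducible flat that does not contain
\<open>\<beta>\<close>, as some tangent vector \<open>v\<close> of \<open>\<beta>\<close> is transverse to it.  So the displacement is eventually smaller
than the distance from the wall.
\<close>

theorem reflected_side:
  assumes r: "(a, c) \<in> affine_roots W" and s: "s \<in> {1, -1}" "s * c - k \<in> lattice W"
    and side: "\<And>m. k < s * (a \<bullet> X m)" and v: "v \<in> tangent W \<beta>" "a \<bullet> v \<noteq> 0"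
  shows "\<forall>\<^sub>F m in sequentially. k < s * (a \<bullet> Y m)"
proof -
  have lim: "(\<lambda>m. s * (a \<bullet> Z m)) \<longlonglongrightarrow> s * (a \<bullet> x0)" if "Z \<longlonglongrightarrow> x0" for Z
    by (intro tendsto_mult tendsto_inner tendsto_const that)
  have ge: "k \<le> s * (a \<bullet> x0)"
    by (rule LIMSEQ_le_const[OF lim[OF X_lim]]) (use side less_imp_le in blast)
  show ?thesis
  proof (cases "k = s * (a \<bullet> x0)")
    case False
    then have "k < s * (a \<bullet> x0)" using ge by simp
    then show ?thesis by (rule order_tendstoD(1)[OF lim[OF Y_lim]])
  next
    case True
    have "s * (s * (a \<bullet> x0) - s * c) \<in> lattice W"
      using s True lattice_diff_commute[of "s * c" k W] by (intro lattice_mult) auto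
    moreover have "s * (s * (a \<bullet> x0) - s * c) = a \<bullet> x0 - c" using s(1) by auto
    ultimately have w: "place W x0 \<in> wall W (a, c)" using place_in_wall[OF x0(1) r] by simp
    obtain \<alpha> where \<alpha>: "\<alpha> \<in> pieces W (wall W (a, c))" "place W x0 \<in> \<alpha>" by (rule piece_exists[OF w]) (rule that)
    note irr = wall_piece_irreducible[OF r \<alpha> x0(1)]
    have nb: "\<not> \<beta> \<subseteq> \<alpha>"
    proof
      assume "\<beta> \<subseteq> \<alpha>"
      then have "(a, c) \<in> roots_through W \<beta>" using r pieces_subset[OF \<alpha>(1)] by (auto simp: roots_through_def)
      then have "a \<bullet> v = 0" using v(1) kernelD unfolding tangent_def by metis
      then show False using v(2) by simp
    qed
    note nu = normal_part_subspace[OF subspace_tangent[of W \<alpha>]]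
    have au: "a \<bullet> x = a \<bullet> nu \<alpha> x" for x using nu(3)[of x] irr(2) by (simp add: inner_diff_right)
    have ker: "tangent W \<alpha> = kernel {(a, c)}" by (simp add: irr(2) kernel_def)
    obtain C where C: "C > 0" "\<And>x. norm (normal_part (kernel {(a, c)}) x) \<le> C * (\<Sum>r\<in>{(a, c)}. \<bar>fst r \<bullet> x\<bar>)"
      by (rule kernel_distance[of "{(a, c)}"]) (use that in auto)
    have a0: "norm a > 0" using root_nonzero[OF r] by simp
    \<comment> \<open>The displacement is to be at most half the distance from the wall.\<close>
    define e where "e = 1 / (2 * C * norm a)"
    have e: "e > 0" using C(1) a0 by (simp add: e_def)
    have "\<forall>\<^sub>F m in sequentially. norm (nu \<alpha> (Y m - X m)) \<le> e * norm (nu \<alpha> (X m - x0))"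
      by (rule null_ratio_eventually[OF displacement_negligible[OF irr(1) \<alpha>(2) nb] _ e])
        (use nu_nonzero[OF irr(1) \<alpha>(2)] in simp)
    then show ?thesis
    proof eventually_elim
      case (elim m)
      have "\<bar>a \<bullet> (Y m - X m)\<bar> \<le> norm a * norm (nu \<alpha> (Y m - X m))"
        unfolding au[of "Y m - X m"] by (rule Cauchy_Schwarz_ineq2)
      also have "\<dots> \<le> norm a * (e * norm (nu \<alpha> (X m - x0)))" using elim by (intro mult_left_mono) auto
      also have "\<dots> \<le> norm a * (e * (C * \<bar>a \<bullet> (X m - x0)\<bar>))"
        using C(2)[of "X m - x0"] e by (intro mult_left_mono) (auto simp: ker)
      also have "\<dots> = \<bar>a \<bullet> (X m - x0)\<bar> / 2" using C(1) a0 by (simp add: e_def)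
      finally have d: "\<bar>a \<bullet> (Y m - X m)\<bar> \<le> \<bar>a \<bullet> (X m - x0)\<bar> / 2" .
      have pos: "0 < s * (a \<bullet> X m) - s * (a \<bullet> x0)" using side[of m] True by simp
      have d': "\<bar>a \<bullet> Y m - a \<bullet> X m\<bar> \<le> \<bar>a \<bullet> X m - a \<bullet> x0\<bar> / 2" using d by (simp add: inner_diff_right)
      from s(1) have "s = 1 \<or> s = -1" by simp
      then show ?case
      proof
        assume s: "s = 1"
        then have "0 < a \<bullet> X m - a \<bullet> x0" using pos by simp
        moreover have "a \<bullet> X m - a \<bullet> Y m \<le> \<bar>a \<bullet> Y m - a \<bullet> X m\<bar>" by (simp add: abs_minus_commute)
        ultimately have "a \<bullet> x0 < a \<bullet> Y m" using d' by (simp add: abs_of_pos)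
        then show ?case using True s by simp
      next
        assume s: "s = -1"
        then have "0 < a \<bullet> x0 - a \<bullet> X m" using pos by simp
        moreover have "a \<bullet> Y m - a \<bullet> X m \<le> \<bar>a \<bullet> Y m - a \<bullet> X m\<bar>" by simp
        ultimately have "a \<bullet> Y m < a \<bullet> x0" using d' by (simp add: abs_of_neg)
        then show ?case using True s by simp
      qed
    qed
  qed
qed

end


section \<open>Particles, walls and brackets\<close>

fun position :: "'n particle \<Rightarrow> real^'n" where
  "position (Plus i) = axis i 1"
| "position (Minus i) = - axis i 1"

lemma pos_eq: "pos x a = position a \<bullet> x"
  by (cases a) (auto simp: axis_inner)

lemma label_opp [simp]: "label (opp a) = label a"
  by (cases a) auto

lemma opp_opp [simp]: "opp (opp a) = a"
  by (cases a) auto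

lemma position_opp: "position (opp a) = - position a"
  by (cases a) auto

lemma pos_opp: "pos x (opp a) = - pos x a"
  by (simp add: pos_eq position_opp)

lemma position_inner_same: "position a \<bullet> position a = 1"
  by (cases a) (auto simp: inner_axis_axis)

lemma position_inner_other: "label a \<noteq> label b \<Longrightarrow> position a \<bullet> position b = 0"
  by (cases a; cases b) (auto simp: inner_axis_axis)

text \<open>
The inequalities \<open>k < \<rho> \<bullet> x\<close> that bound a chamber: up to sign and to the lattice, \<open>\<rho> \<bullet> x = k\<close> is the
equation of a wall.
\<close>

definition wall_functional :: "coxeter \<Rightarrow> real^'n \<Rightarrow> real \<Rightarrow> bool" where
  "wall_functional W \<rho> k \<longleftrightarrow>
     (\<exists>a c s. (a, c) \<in> affine_roots W \<and> s \<in> {1, -1} \<and> \<rho> = s *\<^sub>R a \<and> s * c - k \<in> lattice W)"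

lemma difference_functional:
  fixes a b :: "'n::finite particle"
  assumes "label a \<noteq> label b" "W \<in> {TypeA, AffA} \<longrightarrow> a \<in> range Plus \<and> b \<in> range Plus" "k \<in> lattice W"
  shows "wall_functional W (position a - position b) k"
proof -
  have I: ?thesis if "(r, 0) \<in> affine_roots W" "s \<in> {1, -1}" "position a - position b = s *\<^sub>R r" for r s
    using that assms(3) unfolding wall_functional_def by (intro exI[of _ r] exI[of _ 0] exI[of _ s]) auto
  have m: "(axis i 1 - axis j 1, 0) \<in> affine_roots W" if "i \<noteq> j" for i j :: 'n
    using that by (auto simp: affine_roots_def)
  have p: "(axis i 1 + axis j 1, 0) \<in> affine_roots W" if "i \<noteq> j" "W \<notin> {TypeA, AffA}" for i j :: 'n
    using that by (auto simp: affine_roots_def)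
  show ?thesis
  proof (cases a; cases b)
    fix i j assume ab: "a = Plus i" "b = Plus j"
    then show ?thesis using I[OF m[of i j], of 1] assms(1) by simp
  next
    fix i j assume ab: "a = Plus i" "b = Minus j"
    then show ?thesis using I[OF p[of i j], of 1] assms(1,2) by auto
  next
    fix i j assume ab: "a = Minus i" "b = Plus j"
    then show ?thesis using I[OF p[of i j], of "-1"] assms(1,2) by auto
  next
    fix i j assume ab: "a = Minus i" "b = Minus j"
    then show ?thesis using I[OF m[of j i], of 1] assms(1) by auto
  qed
qed

lemma sum_functional:
  fixes a b :: "'n::finite particle"
  assumes "label a \<noteq> label b" "W \<notin> {TypeA, AffA}" "k \<in> lattice W"
  shows "wall_functional W (position a + position b) k"
  using difference_functional[of a "opp b" W k] assms by (simp add: position_opp)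

lemma wall_functional_minus: "wall_functional W \<rho> k \<Longrightarrow> wall_functional W (- \<rho>) (- k)"
proof -
  assume "wall_functional W \<rho> k"
  then obtain a c s where "(a, c) \<in> affine_roots W" "s \<in> {1, -1}" "\<rho> = s *\<^sub>R a" "s * c - k \<in> lattice W"
    unfolding wall_functional_def by blast
  then show ?thesis unfolding wall_functional_def
    using lattice_neg[of "s * c - k" W] by (intro exI[of _ a] exI[of _ c] exI[of _ "- s"]) auto
qed

lemma fixed_functional:
  fixes a :: "'n::finite particle"
  shows "fixed_at_0 W \<Longrightarrow> wall_functional W (position a) 0"
    "fixed_at_1 W \<Longrightarrow> wall_functional W (position a) 1"
proof -
  have "\<exists>s\<in>{1, -1}. position a = s *\<^sub>R axis (label a) 1" by (cases a) auto
  then obtain s where s: "s \<in> {1, -1}" "position a = s *\<^sub>R axis (label a) 1" by blast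
  show "wall_functional W (position a) 0" if "fixed_at_0 W"
    unfolding wall_functional_def using s that
    by (intro exI[of _ "axis (label a) 1"] exI[of _ 0] exI[of _ s]) (auto simp: affine_roots_def)
  show "wall_functional W (position a) 1" if "fixed_at_1 W"
  proof -
    have "s * 1 - 1 \<in> lattice W" using s(1) that by (auto simp: lattice_iff fixed_at_1_def toroidal_def intro: exI[of _ "-1"])
    then show ?thesis unfolding wall_functional_def using s that
      by (intro exI[of _ "axis (label a) 1"] exI[of _ 1] exI[of _ s]) (auto simp: affine_roots_def)
  qed
qed

text \<open>
  The bracket of the particles with the given labels, in a diagram whose ordering is given.  Flips
  do not change the labels in a bracket, but they may change signs.
\<close>

fun bracket_of :: "'n particle list \<Rightarrow> real option \<times> 'n set \<Rightarrow> 'n bracket" where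
  "bracket_of ps (None, M) = Off {a \<in> set ps. label a \<in> M}"
| "bracket_of ps (Some t, M) = Axis t {a \<in> set ps. label a \<in> M}"

fun equations :: "'n::finite bracket \<Rightarrow> ((real^'n) \<times> real) set" where
  "equations (Off S) = {(position a - position b, 0) | a b. a \<in> S \<and> b \<in> S}"
| "equations (Axis t S) = {(position a, t) | a. a \<in> S}"

lemma locus_eq: "locus W b = solutions W (equations b)"
proof (cases b)
  case (Off S)
  have "(\<forall>a\<in>S. \<forall>b\<in>S. same_pos W (pos x a) (pos x b)) \<longleftrightarrow> (\<forall>(a, c)\<in>equations (Off S). a \<bullet> x - c \<in> lattice W)" for x
    by (fastforce simp: same_pos_lattice pos_eq inner_diff_left)
  then show ?thesis by (simp add: Off solutions_def)
next
  case (Axis t S)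
  have "(\<forall>a\<in>S. same_pos W (pos x a) t) \<longleftrightarrow> (\<forall>(a, c)\<in>equations (Axis t S). a \<bullet> x - c \<in> lattice W)" for x
    by (fastforce simp: same_pos_lattice pos_eq)
  then show ?thesis by (simp add: Axis solutions_def)
qed

lemma balanced_difference:
  "W \<in> {TypeA, AffA} \<longrightarrow> a \<in> range Plus \<and> b \<in> range Plus \<Longrightarrow> balanced W (position a - position b)"
  by (cases a; cases b) (auto simp: balanced_def axis_def sum.distrib sum_subtractf sum_negf)

lemma balanced_position: "W \<notin> {TypeA, AffA} \<Longrightarrow> balanced W (position a)"
  by (cases a) (auto simp: balanced_def axis_def)

text \<open>
The conditions on \<open>x0\<close> hold exactly and not only up to the lattice, so the flat can be described in
coordinates around \<open>x0\<close>.  The equations of a bracket need not be roots of the type (as \<open>x\<^sub>i = 0\<close> is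
not for a bracket at an axis point without a fixed particle), but they are constant along the flat.
\<close>

lemma tangent_locus:
  fixes b :: "'n::finite bracket"
  assumes loc: "locus W b \<in> intersections W" and x0: "x0 \<in> coords W"
    and bal: "\<And>a c. (a, c) \<in> equations b \<Longrightarrow> balanced W a"
    and sph: "\<And>a c. (a, c) \<in> equations b \<Longrightarrow> \<not> toroidal W \<Longrightarrow> c = 0"
    and exact: "\<And>a c. (a, c) \<in> equations b \<Longrightarrow> a \<bullet> x0 = c"
  shows "place W x0 \<in> locus W b" "tangent W (locus W b) = kernel (equations b)"
proof -
  have mem: "place W x \<in> locus W b \<longleftrightarrow> (\<forall>(a, c)\<in>equations b. a \<bullet> x - c \<in> lattice W)" if "x \<in> coords W" for x
    unfolding locus_eq by (rule place_in_solutions[OF that bal])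
  show q: "place W x0 \<in> locus W b" unfolding mem[OF x0] using exact by auto
  have kin: "place W x \<in> locus W b" if x: "x \<in> coords W" "x - x0 \<in> kernel (equations b)" for x
  proof -
    have "a \<bullet> x - c \<in> lattice W" if "(a, c) \<in> equations b" for a c
      using kernelD[OF x(2) that] exact[OF that] by (simp add: inner_diff_right)
    then show ?thesis unfolding mem[OF x(1)] by blast
  qed
  have sphk: "x0 \<in> kernel (equations b)" if "\<not> toroidal W"
    using exact sph that unfolding kernel_def by force
  have onesk: "(\<chi> i. 1) \<in> kernel (equations b)" if W: "W = TypeA"
  proof -
    have "a \<bullet> (\<chi> i. 1) = 0" if "(a, c) \<in> equations b" for a c
      using bal[OF that] W by (simp add: balanced_def inner_ones)
    then show ?thesis unfolding kernel_def by force
  qed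
  show "tangent W (locus W b) = kernel (equations b)"
  proof
    show "kernel (equations b) \<subseteq> tangent W (locus W b)"
    proof
      fix v assume v: "v \<in> kernel (equations b)"
      have "a \<bullet> v = 0" if ac: "(a, c) \<in> roots_through W (locus W b)" for a c
      proof -
        have r: "(a, c) \<in> affine_roots W" "locus W b \<subseteq> wall W (a, c)" using ac by (auto simp: roots_through_def)
        have eq: "a \<bullet> x - c \<in> lattice W" if x: "x \<in> coords W" "x - x0 \<in> kernel (equations b)" for x
          using root_value[OF r(2,1) x(1) kin[OF x]] .
        show ?thesis
          by (rule functional_vanishes[OF subspace_kernel x0 sphk onesk balanced_root[OF r(1)] eq v])
      qed
      then show "v \<in> tangent W (locus W b)" by (force simp: tangent_def kernel_def)
    qed
    show "tangent W (locus W b) \<subseteq> kernel (equations b)"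
    proof
      fix v assume v: "v \<in> tangent W (locus W b)"
      have "a \<bullet> v = 0" if ac: "(a, c) \<in> equations b" for a c
      proof -
        have eq: "a \<bullet> x - c \<in> lattice W" if x: "x \<in> coords W" "x - x0 \<in> tangent W (locus W b)" for x
          using flat_mem[OF loc x0 q x] ac mem[OF x(1)] by blast
        have o: "W = TypeA \<Longrightarrow> (\<chi> i. 1) \<in> tangent W (locus W b)" by (rule ones_in_tangent) simp
        show ?thesis
          by (rule functional_vanishes[OF subspace_tangent x0 spherical_in_tangent[OF x0 q] o bal[OF ac] eq v])
      qed
      then show "v \<in> kernel (equations b)" by (force simp: kernel_def)
    qed
  qed
qed

section \<open>Chambers in terms of orderings\<close>

definition boundary_conditions :: "coxeter \<Rightarrow> 'n particle set \<Rightarrow> real^'n \<Rightarrow> bool" where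
  "boundary_conditions W P x \<longleftrightarrow>
     (W = AffA \<longrightarrow> (\<forall>a\<in>P. \<forall>b\<in>P. pos x b < pos x a + 2)) \<and>
     (W \<notin> {TypeA, AffA} \<longrightarrow> (if fixed_at_0 W then \<forall>a\<in>P. 0 < pos x a
        else \<forall>a\<in>P. \<forall>b\<in>P. a \<noteq> b \<longrightarrow> - pos x a < pos x b)) \<and>
     (W \<in> {AffB, AffC, AffD} \<longrightarrow> (if fixed_at_1 W then \<forall>a\<in>P. pos x a < 1
        else \<forall>a\<in>P. \<forall>b\<in>P. a \<noteq> b \<longrightarrow> pos x b < 2 - pos x a))"

definition ordered :: "coxeter \<Rightarrow> 'n particle list \<Rightarrow> real^'n \<Rightarrow> bool" where
  "ordered W ps x \<longleftrightarrow> sorted_wrt (\<lambda>a b. pos x a < pos x b) ps \<and> boundary_conditions W (set ps) x"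

text \<open>
The parameter \<open>K\<close> is a set of brackets, given by the labels of their particles.  By the last
condition a bracket off the axis lies inside or outside each bracket on the axis, so that its locus
survives the passage to mirror images on the axis bracket.
\<close>

definition admissible :: "coxeter \<Rightarrow> 'n::finite particle list \<Rightarrow> (real option \<times> 'n set) set \<Rightarrow> bool" where
  "admissible W ps K \<longleftrightarrow>
     distinct (map label ps) \<and> label ` set ps = UNIV \<and>
     (W \<in> {TypeA, AffA} \<longrightarrow> set ps \<subseteq> range Plus) \<and>
     (\<forall>k\<in>K. locus W (bracket_of ps k) \<in> min_building_set W) \<and>
     (\<forall>t M. (Some t, M) \<in> K \<longrightarrow> W \<notin> {TypeA, AffA} \<and> (t = 0 \<or> t = 1 \<and> toroidal W) \<and>
        (\<forall>M'. (None, M') \<in> K \<longrightarrow> M' \<subseteq> M \<or> M' \<inter> M = {}))"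

definition near_cell ::
    "coxeter \<Rightarrow> (complex^'n^'n) set list \<Rightarrow> 'n::finite particle list \<Rightarrow> (real option \<times> 'n set) set \<Rightarrow> real
      \<Rightarrow> (complex^'n^'n) bpoint set" where
  "near_cell W \<alpha>s ps K r = {p \<in> moduli_space W \<alpha>s. fst p \<in> place W `
     {x \<in> coords W. ordered W ps x \<and> (\<forall>k\<in>K. tight r x (bracket_of ps k))}}"

definition ordered_cell ::
    "coxeter \<Rightarrow> (complex^'n^'n) set list \<Rightarrow> 'n::finite particle list \<Rightarrow> (real option \<times> 'n set) set
      \<Rightarrow> (complex^'n^'n) bpoint set" where
  "ordered_cell W \<alpha>s ps K = {p \<in> moduli_space W \<alpha>s.
     (\<forall>r > 0. p \<in> closure (near_cell W \<alpha>s ps K r)) \<and>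
     (\<forall>k\<in>K. p \<in> divisor W \<alpha>s (locus W (bracket_of ps k)))}"

lemma sorted_wrt_pair:
  assumes "sorted_wrt P xs" "a \<in> set xs" "b \<in> set xs" "a \<noteq> b"
  shows "P a b \<or> P b a"
proof -
  obtain i j where "i < length xs" "j < length xs" "xs ! i = a" "xs ! j = b"
    using assms(2,3) by (metis in_set_conv_nth)
  then show ?thesis using sorted_wrt_nth_less[OF assms(1), of i j] sorted_wrt_nth_less[OF assms(1), of j i] assms(4)
    by (cases i j rule: linorder_cases) auto
qed

lemma orderedD:
  assumes "ordered W ps x"
  shows "sorted_wrt (\<lambda>a b. pos x a < pos x b) ps"
    "W = AffA \<Longrightarrow> a \<in> set ps \<Longrightarrow> b \<in> set ps \<Longrightarrow> pos x b < pos x a + 2"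
    "W \<notin> {TypeA, AffA} \<Longrightarrow> fixed_at_0 W \<Longrightarrow> a \<in> set ps \<Longrightarrow> 0 < pos x a"
    "W \<notin> {TypeA, AffA} \<Longrightarrow> \<not> fixed_at_0 W \<Longrightarrow> a \<in> set ps \<Longrightarrow> b \<in> set ps \<Longrightarrow> a \<noteq> b \<Longrightarrow> - pos x a < pos x b"
    "W \<in> {AffB, AffC, AffD} \<Longrightarrow> fixed_at_1 W \<Longrightarrow> a \<in> set ps \<Longrightarrow> pos x a < 1"
    "W \<in> {AffB, AffC, AffD} \<Longrightarrow> \<not> fixed_at_1 W \<Longrightarrow> a \<in> set ps \<Longrightarrow> b \<in> set ps \<Longrightarrow> a \<noteq> b \<Longrightarrow> pos x b < 2 - pos x a"
  using assms unfolding ordered_def boundary_conditions_def by (simp_all split: if_splits)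

locale configuration =
  fixes W :: coxeter and n :: nat and ps :: "'n::finite particle list"
  assumes rank: "min_rank W \<le> n" "CARD('n) = particles W n"
    and labels: "distinct (map label ps)" "label ` set ps = UNIV"
    and plus: "W \<in> {TypeA, AffA} \<longrightarrow> set ps \<subseteq> range Plus"
begin

lemma card_ps: "card (set ps) = CARD('n)"
proof -
  have "inj_on label (set ps)" using labels(1) by (simp add: distinct_map)
  then show ?thesis using card_image labels(2) by metis
qed

lemma label_inj: "a \<in> set ps \<Longrightarrow> b \<in> set ps \<Longrightarrow> label a = label b \<Longrightarrow> a = b"
  using labels(1) by (auto simp: distinct_map inj_on_def)

lemma another:
  assumes "finite S" "card S < CARD('n)"
  shows "\<exists>c\<in>set ps. c \<notin> S"
proof (rule ccontr)
  assume "\<not> ?thesis"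
  then have "set ps \<subseteq> S" by blast
  then show False using card_mono[of S "set ps"] assms card_ps by simp
qed

text \<open>
For \<open>AffD\<close>, where no particle is fixed, the distance of two particles is bounded by comparing both
with a third one.
\<close>

lemma pair_bounds:
  assumes o: "ordered W ps x" and ab: "a \<in> set ps" "b \<in> set ps" "a \<noteq> b"
  shows "pos x a \<noteq> pos x b" "toroidal W \<Longrightarrow> pos x b - pos x a < 2"
    "W \<notin> {TypeA, AffA} \<Longrightarrow> 0 < pos x a + pos x b"
    "toroidal W \<Longrightarrow> W \<noteq> AffA \<Longrightarrow> pos x a + pos x b < 2"
proof -
  note B = orderedD[OF o]
  show "pos x a \<noteq> pos x b" using sorted_wrt_pair[OF B(1) ab] by auto
  show sum0: "0 < pos x a + pos x b" if "W \<notin> {TypeA, AffA}"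
  proof (cases "fixed_at_0 W")
    case True
    then have "0 < pos x a" "0 < pos x b" using B(3)[OF that] ab by blast+
    then show ?thesis by simp
  next
    case False
    then have "- pos x a < pos x b" using B(4)[OF that _ ab] by blast
    then show ?thesis by simp
  qed
  show "pos x a + pos x b < 2" if t: "toroidal W" "W \<noteq> AffA"
  proof -
    have W: "W \<in> {AffB, AffC, AffD}" using t by (auto simp: toroidal_def)
    show ?thesis
    proof (cases "fixed_at_1 W")
      case True
      then have "pos x a < 1" "pos x b < 1" using B(5)[OF W] ab by blast+
      then show ?thesis by simp
    next
      case False
      then have "pos x b < 2 - pos x a" using B(6)[OF W _ ab] by blast
      then show ?thesis by simp
    qed
  qed
  show "pos x b - pos x a < 2" if t: "toroidal W"
  proof -
    consider "W = AffA" | "W \<in> {AffB, AffC}" | "W = AffD" using t by (auto simp: toroidal_def)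
    then show ?thesis
    proof cases
      case 1
      then have "pos x b < pos x a + 2" using B(2) ab by blast
      then show ?thesis by simp
    next
      case 2
      then have "pos x b < 1" using B(5)[of b] ab by (auto simp: fixed_at_1_def)
      moreover have "0 < pos x a + pos x b" using sum0 2 by auto
      ultimately show ?thesis by simp
    next
      case 3
      have "card {a, b} \<le> 2" by (simp add: card_insert_le_m1)
      moreover have "2 < CARD('n)" using rank 3 by (simp add: min_rank_def particles_def)
      ultimately obtain c where c: "c \<in> set ps" "c \<noteq> a" "c \<noteq> b" using another[of "{a, b}"] by auto
      have f: "\<not> fixed_at_0 W" "\<not> fixed_at_1 W" "W \<notin> {TypeA, AffA}" "W \<in> {AffB, AffC, AffD}"
        using 3 by (simp_all add: fixed_at_0_def fixed_at_1_def)
      have "- pos x a < pos x c" by (rule B(4)[OF f(3,1) ab(1) c(1) c(2)[symmetric]])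
      moreover have "pos x b < 2 - pos x c" by (rule B(6)[OF f(4,2) c(1) ab(2) c(3)])
      ultimately show ?thesis by simp
    qed
  qed
qed

lemma exists_particle: "\<exists>a\<in>set ps. \<exists>s\<in>{1, -1}. (W \<in> {TypeA, AffA} \<longrightarrow> s = 1) \<and> label a = i \<and> x $ i = s * pos x a"
proof -
  have "i \<in> label ` set ps" using labels(2) by simp
  then obtain a where a: "a \<in> set ps" "label a = i" by auto
  show ?thesis
  proof (cases a)
    case (Plus j)
    then show ?thesis using a by (intro bexI[of _ a] bexI[of _ 1]) auto
  next
    case (Minus j)
    then have "W \<notin> {TypeA, AffA}" using plus a(1) by auto
    then show ?thesis using a Minus by (intro bexI[of _ a] bexI[of _ "-1"]) auto
  qed
qed

lemma single_bounds:
  assumes o: "ordered W ps x" and a: "a \<in> set ps"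
  shows "fixed_at_0 W \<Longrightarrow> 0 < pos x a" "fixed_at_1 W \<Longrightarrow> pos x a < 1" "fixed_at_1 W \<Longrightarrow> - 1 < pos x a"
    "toroidal W \<Longrightarrow> W \<noteq> AffA \<Longrightarrow> \<bar>pos x a\<bar> \<le> 2"
proof -
  note B = orderedD[OF o]
  show f0: "0 < pos x a" if "fixed_at_0 W"
    using B(3)[OF _ that a] that by (auto simp: fixed_at_0_def)
  show f1: "pos x a < 1" if "fixed_at_1 W"
    using B(5)[OF _ that a] that by (auto simp: fixed_at_1_def)
  show "- 1 < pos x a" if f: "fixed_at_1 W"
  proof (cases "fixed_at_0 W")
    case True
    then show ?thesis using f0 by simp
  next
    case False
    then have "2 \<le> CARD('n)" "W = AffB" using rank f by (auto simp: fixed_at_1_def fixed_at_0_def min_rank_def particles_def)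
    then obtain b where b: "b \<in> set ps" "b \<noteq> a" using another[of "{a}"] by auto
    then have "0 < pos x a + pos x b" "pos x b < 1"
      using pair_bounds(3)[OF o a b(1) b(2)[symmetric]] B(5)[OF _ f b(1)] \<open>W = AffB\<close> by simp_all
    then show ?thesis by simp
  qed
  show "\<bar>pos x a\<bar> \<le> 2" if t: "toroidal W" "W \<noteq> AffA"
  proof (cases "CARD('n) = 1")
    case True
    then have "W = AffC" using rank t by (auto simp: toroidal_def min_rank_def particles_def)
    then show ?thesis using f0 f1 by (auto simp: fixed_at_0_def fixed_at_1_def)
  next
    case False
    then have "1 < CARD('n)" using zero_less_card_finite[where 'a='n] by linarith
    then obtain b where b: "b \<in> set ps" "b \<noteq> a" using another[of "{a}"] by auto
    have "W \<notin> {TypeA, AffA}" using t by (auto simp: toroidal_def)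
    then show ?thesis
      using pair_bounds[OF o a b(1) b(2)[symmetric]] pair_bounds(2)[OF o b(1) a b(2)] t by (auto simp: abs_le_iff)
  qed
qed

text \<open>The open chambers avoid all the walls; this is where the lower bound on the rank enters.\<close>

lemma ordered_generic:
  assumes o: "ordered W ps x" and r: "(a, c) \<in> affine_roots W"
  shows "a \<bullet> x - c \<notin> lattice W"
proof -
  have nz: "s \<notin> lattice W" if "s \<noteq> 0" "toroidal W \<Longrightarrow> \<bar>s\<bar> < 2" for s
    using that lattice_discrete[of s W] by (cases "toroidal W") (auto simp: lattice_iff)
  have pairs: "s * pos x a - t * pos x b \<notin> lattice W" and pairs': "W \<notin> {TypeA, AffA} \<Longrightarrow> s * pos x a + t * pos x b \<notin> lattice W"
    if p: "a \<in> set ps" "b \<in> set ps" "a \<noteq> b" "s \<in> {1, -1}" "t \<in> {1, -1}" "W \<in> {TypeA, AffA} \<longrightarrow> s = 1 \<and> t = 1" for a b s t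
  proof -
    have d: "pos x a - pos x b \<notin> lattice W"
      using pair_bounds(1)[OF o p(1-3)] pair_bounds(2)[OF o p(1-3)] pair_bounds(2)[OF o p(2,1) p(3)[symmetric]]
      by (intro nz) auto
    have sm: "pos x a + pos x b \<notin> lattice W" if "W \<notin> {TypeA, AffA}"
      using pair_bounds(3)[OF o p(1-3) that] pair_bounds(4)[OF o p(1-3)] that by (intro nz) auto
    have sts: "s = t \<or> s = - t" using p(4,5) by auto
    have neg: "u * v \<in> lattice W \<longleftrightarrow> v \<in> lattice W" if "u \<in> {1, -1}" for u v :: real using that by auto
    have e1: "s * pos x a - t * pos x b = s * (pos x a - pos x b)" "s * pos x a + t * pos x b = s * (pos x a + pos x b)" if "s = t"
      using that by (simp_all add: algebra_simps)
    have e2: "s * pos x a - t * pos x b = s * (pos x a + pos x b)" "s * pos x a + t * pos x b = s * (pos x a - pos x b)" if "s = - t"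
      using that by (simp_all add: algebra_simps)
    have st1: "W \<in> {TypeA, AffA} \<Longrightarrow> s = t" using p(6) by simp
    show "s * pos x a - t * pos x b \<notin> lattice W"
    proof (cases "s = t")
      case True
      then show ?thesis using d e1(1) neg[OF p(4)] by metis
    next
      case False
      then have "s = - t" "W \<notin> {TypeA, AffA}" using sts st1 by blast+
      then show ?thesis using sm e2(1) neg[OF p(4)] by metis
    qed
    show "s * pos x a + t * pos x b \<notin> lattice W" if "W \<notin> {TypeA, AffA}"
      using sts e1(2) e2(2) d sm[OF that] neg[OF p(4)] by metis
  qed
  from r show ?thesis
  proof (cases rule: affine_roots_cases)
    case (minus i j)
    obtain a' s where a': "a' \<in> set ps" "s \<in> {1, -1}" "W \<in> {TypeA, AffA} \<longrightarrow> s = 1" "label a' = i" "x $ i = s * pos x a'"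
      using exists_particle by blast
    obtain b' t where b': "b' \<in> set ps" "t \<in> {1, -1}" "W \<in> {TypeA, AffA} \<longrightarrow> t = 1" "label b' = j" "x $ j = t * pos x b'"
      using exists_particle by blast
    have "a' \<noteq> b'" using a' b' minus(1) by auto
    from pairs[OF a'(1) b'(1) this a'(2) b'(2)] a' b' minus show ?thesis by (simp add: inner_diff_left axis_inner)
  next
    case (plus i j)
    obtain a' s where a': "a' \<in> set ps" "s \<in> {1, -1}" "W \<in> {TypeA, AffA} \<longrightarrow> s = 1" "label a' = i" "x $ i = s * pos x a'"
      using exists_particle by blast
    obtain b' t where b': "b' \<in> set ps" "t \<in> {1, -1}" "W \<in> {TypeA, AffA} \<longrightarrow> t = 1" "label b' = j" "x $ j = t * pos x b'"
      using exists_particle by blast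
    have "a' \<noteq> b'" using a' b' plus(1) by auto
    from pairs'[OF a'(1) b'(1) this a'(2) b'(2) _ plus(2)] a' b' plus show ?thesis by (simp add: inner_add_left axis_inner)
  next
    case (zero i)
    obtain a' s where a': "a' \<in> set ps" "s \<in> {1, -1}" "label a' = i" "x $ i = s * pos x a'"
      using exists_particle by blast
    have "0 < pos x a'" using single_bounds(1)[OF o a'(1)] zero by simp
    moreover have "pos x a' < 1" if "toroidal W"
      using single_bounds(2)[OF o a'(1)] zero that by (auto simp: fixed_at_0_def fixed_at_1_def toroidal_def)
    ultimately show ?thesis using zero a' by (intro nz) (auto simp: axis_inner)
  next
    case (one i)
    obtain a' s where a': "a' \<in> set ps" "s \<in> {1, -1}" "label a' = i" "x $ i = s * pos x a'"
      using exists_particle by blast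
    have "pos x a' < 1" "- 1 < pos x a'" using single_bounds(2,3)[OF o a'(1)] one by simp_all
    then have lt: "x $ i < 1" "- 1 < x $ i" using a'(2,4) by auto
    then have "x $ i - 1 \<noteq> 0" "\<bar>x $ i - 1\<bar> < 2" by auto
    then show ?thesis using one by (intro nz) (auto simp: axis_inner)
  qed
qed

lemma ordered_off_flats:
  assumes o: "ordered W ps x" and x: "x \<in> coords W" and \<alpha>: "\<alpha> \<in> intersections W"
  shows "place W x \<notin> affine hull \<alpha>"
proof
  assume h: "place W x \<in> affine hull \<alpha>"
  obtain a c where ac: "(a, c) \<in> affine_roots W" "\<alpha> \<subseteq> wall W (a, c)" using roots_through_nonempty[OF \<alpha>] by blast
  have "place W x \<in> wall W (a, c)" by (rule affine_hull_in_wall[OF ac x h])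
  then show False using ordered_generic[OF o ac(1)] place_in_wall[OF x ac(1)] by simp
qed

lemma ordered_normal_part:
  assumes "ordered W ps x" "x \<in> coords W" "\<alpha> \<in> intersections W"
  shows "normal_part \<alpha> (place W x) \<noteq> 0"
  using ordered_off_flats[OF assms] normal_part_eq_0 intersections_nonempty[OF assms(3)] by blast

end


section \<open>Flipping a bracket\<close>

lemma tendsto_of_dist:
  fixes F :: "nat \<Rightarrow> 'b::metric_space"
  assumes "\<And>m. dist (F m) y < e m" "e \<longlonglongrightarrow> 0"
  shows "F \<longlonglongrightarrow> y"
proof -
  have "(\<lambda>m. dist (F m) y) \<longlonglongrightarrow> 0"
    by (rule Lim_null_comparison[OF always_eventually assms(2)]) (simp add: assms(1) less_imp_le)
  then show ?thesis by (rule tendsto_dist_iff[THEN iffD2])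
qed

lemma closed_coords: "closed (coords W :: (real^'n) set)"
proof (cases "toroidal W")
  case False
  have "coords W = {x :: real^'n. norm x = 1} \<inter> {x. W = TypeA \<longrightarrow> x \<bullet> (\<chi> i. 1) = 0}"
    using coords_spherical[OF False] by auto
  moreover have "closed {x :: real^'n. norm x = 1}" by (intro closed_Collect_eq continuous_intros)
  moreover have "closed {x :: real^'n. W = TypeA \<longrightarrow> x \<bullet> (\<chi> i. 1) = 0}"
    by (cases "W = TypeA") (auto intro!: closed_Collect_eq continuous_intros)
  ultimately show ?thesis by (simp add: closed_Int)
qed (simp add: coords_def)

text \<open>
At a generic point of \<open>\<beta>\<close> the direction normal to \<open>\<gamma>\<close> is spanned by the normal part of a point of \<open>\<beta>\<close>, which
satisfies the linear parts of the equations of \<open>\<beta>\<close>.  This is a closed condition, so it holds on the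
whole divisor.
\<close>

lemma divisor_tangential:
  fixes \<beta> \<gamma> :: "(complex^'n^'n) set" and f :: "complex^'n^'n \<Rightarrow> complex" and k :: complex
  assumes \<alpha>s: "distinct \<alpha>s" "set \<alpha>s = min_building_set W"
    and p: "p \<in> divisor W \<alpha>s \<beta>"
    and \<beta>: "\<beta> \<in> intersections W" and \<gamma>: "\<gamma> \<in> min_building_set W" "\<gamma> \<subseteq> \<beta>" "\<not> \<beta> \<subseteq> \<gamma>"
    and x0: "x0 \<in> coords W" "place W x0 \<in> \<gamma>"
    and ac: "(a, c) \<in> roots_through W \<beta>"
    and f: "linear f" "\<And>x. norm (f (place W x) - k) = defect W (a \<bullet> x - c)"
  shows "f (snd p \<gamma> u) = 0"
proof -
  have \<gamma>i: "\<gamma> \<in> intersections W" using \<gamma>(1) by (simp add: min_building_set_def)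
  have rt: "(a, c) \<in> affine_roots W" "\<beta> \<subseteq> wall W (a, c)" "\<gamma> \<subseteq> wall W (a, c)"
    using ac \<gamma>(2) by (auto simp: roots_through_def)
  obtain R where R: "R \<subseteq> affine_roots W" "R \<noteq> {}" "\<gamma> \<in> pieces W (\<Inter>(wall W ` R))" "\<gamma> \<noteq> {}"
    by (rule intersectionsE[OF \<gamma>i]) (rule that)
  obtain S where S: "\<beta> \<in> pieces W (\<Inter>(wall W ` S))"
    by (rule intersectionsE[OF \<beta>]) (rule that)
  have "\<not> \<beta> \<subseteq> \<Inter>(wall W ` R)"
  proof
    assume sub: "\<beta> \<subseteq> \<Inter>(wall W ` R)"
    show False
    proof (cases "toroidal W")
      case True
      have "place W x0 \<in> \<beta>" using x0(2) \<gamma>(2) by blast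
      then have "\<beta> \<subseteq> \<gamma>" using pieces_maximal[OF R(3) True pieces_connected[OF S True] sub _ x0(2)] by blast
      then show False using \<gamma>(3) by simp
    next
      case False
      then show False using R(3) sub \<gamma>(3) by (simp add: pieces_spherical)
    qed
  qed
  \<comment> \<open>A wall that contains \<open>\<gamma>\<close> but not \<open>\<beta>\<close>: the generic points of \<open>\<beta>\<close> lie off it, hence off the hull of \<open>\<gamma>\<close>.\<close>
  then obtain b d where bd: "(b, d) \<in> R" "\<not> \<beta> \<subseteq> wall W (b, d)" by auto
  have br: "(b, d) \<in> affine_roots W" "\<gamma> \<subseteq> wall W (b, d)" using bd(1) R(1) pieces_subset[OF R(3)] by blast+
  have hb: "wall W (b, d) \<in> hyperplanes W" using br(1) by (auto simp: hyperplanes_eq)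
  let ?C = "{q::(complex^'n^'n) bpoint. f (snd q \<gamma> u) = 0}"
  have cf: "continuous_on UNIV f" using f(1) by (simp add: linear_continuous_on linear_conv_bounded_linear)
  have "continuous_on UNIV (\<lambda>q::(complex^'n^'n) bpoint. f (snd q \<gamma> u))"
    using continuous_on_compose2[OF cf continuous_entry] by simp
  then have cl: "closed ?C" by (intro closed_Collect_eq continuous_on_const)
  have "{p \<in> moduli_space W \<alpha>s. fst p \<in> \<beta> \<and> (\<forall>h\<in>hyperplanes W. \<not> \<beta> \<subseteq> h \<longrightarrow> fst p \<notin> h)} \<subseteq> ?C"
  proof
    fix q assume "q \<in> {p \<in> moduli_space W \<alpha>s. fst p \<in> \<beta> \<and> (\<forall>h\<in>hyperplanes W. \<not> \<beta> \<subseteq> h \<longrightarrow> fst p \<notin> h)}"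
    then have q: "q \<in> moduli_space W \<alpha>s" "fst q \<in> \<beta>" "fst q \<notin> wall W (b, d)" using hb bd(2) by auto
    obtain y where y: "y \<in> coords W" "fst q = place W y" using flat_points[OF \<beta> q(2)] by blast
    have nz: "normal_part \<gamma> (fst q) \<noteq> 0"
    proof
      assume "normal_part \<gamma> (fst q) = 0"
      then have "place W y \<in> affine hull \<gamma>" using normal_part_eq_0 R(4) y(2) by metis
      then show False using affine_hull_in_wall[OF br y(1)] q(3) y(2) by simp
    qed
    have "snd q \<gamma> = line (normal_part \<gamma> (fst q))"
      using iterated_blow_up_direction[of "fst q" "snd q"] q(1) \<alpha>s \<gamma>(1) nz unfolding moduli_space_def by simp
    moreover have "f (normal_part \<gamma> (fst q)) = f (fst q) - k"
      by (rule wall_function_normal_part(1)[OF \<gamma>i x0 rt(1,3) f])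
    moreover have "f (fst q) = k"
    proof -
      have "place W x0 \<in> \<beta>" using x0(2) \<gamma>(2) by blast
      from wall_function_normal_part(2)[OF \<beta> x0(1) this rt(1,2) f] q(2) show ?thesis by (simp add: hull_inc)
    qed
    ultimately show "q \<in> ?C" by (simp add: line_def linear_scale[OF f(1)])
  qed
  then have "divisor W \<alpha>s \<beta> \<subseteq> ?C" unfolding divisor_def by (rule closure_minimal[OF _ cl])
  then show ?thesis using p by blast
qed

context configuration
begin

lemma bracket_particles: "M = label ` S \<Longrightarrow> S \<subseteq> set ps \<Longrightarrow> {a \<in> set ps. label a \<in> M} = S"
  using label_inj by blast

text \<open>
Up to rotation in the case \<open>AffA\<close>, the order conditions bound the coordinates.  This is what makes
the coordinates, and not only the points of the complex, converge.
\<close>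

lemma bounded_representative:
  assumes o: "ordered W ps x" and x: "x \<in> coords W" and K: "\<forall>t M. (Some t, M) \<in> K \<longrightarrow> W \<notin> {TypeA, AffA}"
    and t: "\<forall>k\<in>K. tight r x (bracket_of ps k)"
  shows "\<exists>y\<in>coords W. place W y = place W x \<and> ordered W ps y \<and> (\<forall>k\<in>K. tight r y (bracket_of ps k)) \<and> norm y \<le> 2 * CARD('n)"
proof -
  have nb: "norm y \<le> 2 * CARD('n)" if "\<And>i. \<bar>y $ i\<bar> \<le> 2" for y :: "real^'n"
    using norm_le_l1_cart[of y] sum_mono[of UNIV "\<lambda>i. \<bar>y $ i\<bar>" "\<lambda>_. 2"] that by simp
  consider "\<not> toroidal W" | "toroidal W" "W \<noteq> AffA" | "W = AffA" by blast
  then show ?thesis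
  proof cases
    case 1
    then have "norm x = 1" using x coords_spherical by blast
    moreover have "1 \<le> 2 * real CARD('n)" using zero_less_card_finite[where 'a='n] by linarith
    ultimately show ?thesis using o x t by (intro bexI[of _ x]) auto
  next
    case 2
    have "\<bar>x $ i\<bar> \<le> 2" for i
    proof -
      obtain a s where a: "a \<in> set ps" "s \<in> {1, -1}" "x $ i = s * pos x a" using exists_particle by blast
      then show ?thesis using single_bounds(4)[OF o a(1) 2] by auto
    qed
    then show ?thesis using o x t nb by (intro bexI[of _ x]) auto
  next
    case 3
    obtain i0 :: 'n where True by blast
    \<comment> \<open>Rotate an arbitrary particle to the position \<open>0\<close>.\<close>
    define y where "y = x - (x $ i0) *\<^sub>R (\<chi> i. 1)"
    have yi: "y $ i = x $ i - x $ i0" for i by (simp add: y_def)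
    have py: "pos y a = pos x a - x $ i0" if "a \<in> set ps" for a
    proof -
      obtain i where "a = Plus i" using plus 3 \<open>a \<in> set ps\<close> by blast
      then show ?thesis by (simp add: yi)
    qed
    have "\<bar>y $ i\<bar> \<le> 2" for i
    proof -
      obtain a s where a: "a \<in> set ps" "s = (1::real)" "x $ i = s * pos x a" using exists_particle[of i x] 3 by auto
      obtain b t where b: "b \<in> set ps" "t = (1::real)" "x $ i0 = t * pos x b" using exists_particle[of i0 x] 3 by auto
      have "toroidal W" using 3 by (simp add: toroidal_def)
      then show ?thesis using pair_bounds(2)[OF o a(1) b(1)] pair_bounds(2)[OF o b(1) a(1)] a b yi[of i]
        by (cases "a = b") auto
    qed
    then have "norm y \<le> 2 * CARD('n)" by (rule nb)
    moreover have "place W y = place W x"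
      using 3 by (simp add: vec_eq_iff place_nth coord_entry_def yi)
    moreover have "ordered W ps y"
    proof -
      have "sorted_wrt (\<lambda>a b. pos y a < pos y b) ps"
        by (rule sorted_wrt_mono_rel[OF _ orderedD(1)[OF o]]) (simp add: py)
      moreover have "boundary_conditions W (set ps) y"
        using o 3 by (simp add: ordered_def boundary_conditions_def py)
      ultimately show ?thesis by (simp add: ordered_def)
    qed
    moreover have "tight r y (bracket_of ps k)" if k: "k \<in> K" for k
    proof -
      obtain M where "k = (None, M)" using K k 3 by (cases k; cases "fst k") auto
      then show ?thesis using t k py by fastforce
    qed
    ultimately show ?thesis using 3 by (intro bexI[of _ y]) (auto simp: coords_def toroidal_def)
  qed
qed

lemma bracket_equations:
  assumes adm: "admissible W ps K" and k: "k \<in> K" and ac: "(a, c) \<in> equations (bracket_of ps k)"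
  shows "balanced W a" "\<not> toroidal W \<Longrightarrow> c = 0"
proof -
  have "balanced W a \<and> (\<not> toroidal W \<longrightarrow> c = 0)"
  proof (cases "fst k")
    case None
    then have kk: "k = (None, snd k)" by (cases k) auto
    then obtain p q where pq: "p \<in> set ps" "q \<in> set ps" "a = position p - position q" "c = 0"
      using ac by (cases k) auto
    have "W \<in> {TypeA, AffA} \<longrightarrow> p \<in> range Plus \<and> q \<in> range Plus" using plus pq by blast
    then show ?thesis using balanced_difference pq by simp
  next
    case (Some t)
    then have kk: "(Some t, snd k) \<in> K" using k by (cases k) auto
    have w: "W \<notin> {TypeA, AffA}" "t = 0 \<or> t = 1 \<and> toroidal W" using adm kk unfolding admissible_def by blast+
    obtain p where "a = position p" "c = t" using ac Some by (cases k) auto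
    then show ?thesis using w balanced_position by auto
  qed
  then show "balanced W a" "\<not> toroidal W \<Longrightarrow> c = 0" by auto
qed

text \<open>
By compactness the coordinates of approximating configurations may be taken to converge.  Since the
particles of a bracket come close together as real numbers, and not only on the circle, the limit
satisfies the equations of the brackets exactly.
\<close>

lemma cell_sequence:
  fixes \<alpha>s :: "(complex^'n^'n) set list"
  assumes \<alpha>s: "distinct \<alpha>s" "set \<alpha>s = min_building_set W" and adm: "admissible W ps K"
    and p: "p \<in> ordered_cell W \<alpha>s ps K"
  obtains X x0 where "\<And>m. X m \<in> coords W" "\<And>m. ordered W ps (X m)" "X \<longlonglongrightarrow> x0" "x0 \<in> coords W"
    "place W x0 = fst p"
    "\<And>\<alpha> u. \<alpha> \<in> min_building_set W \<Longrightarrow> (\<lambda>m. line (normal_part \<alpha> (place W (X m))) u) \<longlonglongrightarrow> snd p \<alpha> u"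
    "\<And>k a c. k \<in> K \<Longrightarrow> (a, c) \<in> equations (bracket_of ps k) \<Longrightarrow> a \<bullet> x0 = c"
proof -
  define e where "e = (\<lambda>m. inverse (real (Suc m)))"
  have e: "0 < e m" for m by (simp add: e_def)
  let ?L = "\<lambda>\<alpha> x. line (normal_part \<alpha> (place W x))"
  have "\<exists>x. x \<in> coords W \<and> ordered W ps x \<and> (\<forall>k\<in>K. tight (e m) x (bracket_of ps k)) \<and> norm x \<le> 2 * CARD('n) \<and>
      dist (place W x) (fst p) < e m \<and> (\<forall>\<alpha>\<in>set \<alpha>s. \<forall>u\<in>Basis. dist (?L \<alpha> x u) (snd p \<alpha> u) < e m)" for m
  proof -
    have "p \<in> closure (near_cell W \<alpha>s ps K (e m))" using p e by (simp add: ordered_cell_def)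
    from closure_bpoint_approx[OF this, of "set \<alpha>s" Basis "e m"] e
    obtain z l where zl: "(z, l) \<in> near_cell W \<alpha>s ps K (e m)" "dist z (fst p) < e m"
      "\<forall>\<alpha>\<in>set \<alpha>s. \<forall>u\<in>Basis. dist (l \<alpha> u) (snd p \<alpha> u) < e m" by auto
    then obtain x where x: "x \<in> coords W" "ordered W ps x" "\<forall>k\<in>K. tight (e m) x (bracket_of ps k)" "z = place W x"
      by (auto simp: near_cell_def)
    have "\<forall>t M. (Some t, M) \<in> K \<longrightarrow> W \<notin> {TypeA, AffA}" using adm unfolding admissible_def by blast
    from bounded_representative[OF x(2,1) this x(3)]
    obtain y where y: "y \<in> coords W" "place W y = place W x" "ordered W ps y" "\<forall>k\<in>K. tight (e m) y (bracket_of ps k)"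
      "norm y \<le> 2 * CARD('n)" by blast
    have "l \<alpha> = ?L \<alpha> y" if "\<alpha> \<in> set \<alpha>s" for \<alpha>
    proof -
      have "\<alpha> \<in> intersections W" using that \<alpha>s(2) by (simp add: min_building_set_def)
      from ordered_normal_part[OF y(3,1) this] have "normal_part \<alpha> z \<noteq> 0" using y(2) x(4) by simp
      moreover have "(z, l) \<in> iterated_blow_up (complex_of W) \<alpha>s" using zl(1) by (simp add: near_cell_def moduli_space_def)
      ultimately show ?thesis using iterated_blow_up_direction[OF _ \<alpha>s(1) that] y(2) x(4) by simp
    qed
    then show ?thesis using y zl x(4) by (intro exI[of _ y]) simp
  qed
  then obtain X where X: "\<And>m. X m \<in> coords W" "\<And>m. ordered W ps (X m)" "\<And>m k. k \<in> K \<Longrightarrow> tight (e m) (X m) (bracket_of ps k)"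
    "\<And>m. norm (X m) \<le> 2 * CARD('n)" "\<And>m. dist (place W (X m)) (fst p) < e m"
    "\<And>m \<alpha> u. \<alpha> \<in> set \<alpha>s \<Longrightarrow> u \<in> Basis \<Longrightarrow> dist (?L \<alpha> (X m) u) (snd p \<alpha> u) < e m"
    by metis
  have "bounded (range X)" using X(4) by (auto simp: bounded_iff)
  from bounded_imp_convergent_subsequence[OF this]
  obtain x0 r where r: "strict_mono r" "(X \<circ> r) \<longlonglongrightarrow> x0" by blast
  define Z where "Z = X \<circ> r"
  have e0: "(\<lambda>m. e (r m)) \<longlonglongrightarrow> 0"
    using LIMSEQ_subseq_LIMSEQ[OF LIMSEQ_inverse_real_of_nat r(1)] by (simp add: comp_def e_def)
  have Zx: "Z \<longlonglongrightarrow> x0" using r(2) by (simp add: Z_def)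
  have x0c: "x0 \<in> coords W" by (rule Lim_in_closed_set[OF closed_coords _ _ Zx]) (simp_all add: Z_def X(1))
  have "(\<lambda>m. place W (Z m)) \<longlonglongrightarrow> place W x0"
    by (rule continuous_on_tendsto_compose[OF continuous_place[of UNIV] Zx]) auto
  moreover have "(\<lambda>m. place W (Z m)) \<longlonglongrightarrow> fst p" by (rule tendsto_of_dist[OF _ e0]) (simp add: Z_def X(5))
  ultimately have pl: "place W x0 = fst p" by (rule LIMSEQ_unique)
  have lin: "linear (snd p \<alpha>)" for \<alpha>
    using iterated_blow_up_linear[of "fst p" "snd p" "complex_of W" \<alpha>s \<alpha>] p by (simp add: ordered_cell_def moduli_space_def)
  have lines: "(\<lambda>m. ?L \<alpha> (Z m) u) \<longlonglongrightarrow> snd p \<alpha> u" if \<alpha>: "\<alpha> \<in> min_building_set W" for \<alpha> u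
  proof -
    have rep: "F u = (\<Sum>b\<in>Basis. (u \<bullet> b) *\<^sub>R F b)" if "linear F" for F :: "complex^'n^'n \<Rightarrow> complex^'n^'n"
    proof -
      have "F u = F (\<Sum>b\<in>Basis. (u \<bullet> b) *\<^sub>R b)" by (simp add: euclidean_representation)
      then show ?thesis by (simp add: linear_sum[OF that] linear_scale[OF that])
    qed
    have "(\<lambda>m. ?L \<alpha> (Z m) b) \<longlonglongrightarrow> snd p \<alpha> b" if "b \<in> Basis" for b
      by (rule tendsto_of_dist[OF _ e0]) (use X(6)[of \<alpha> b] \<alpha> \<alpha>s(2) that in \<open>simp add: Z_def\<close>)
    then have "(\<lambda>m. \<Sum>b\<in>Basis. (u \<bullet> b) *\<^sub>R ?L \<alpha> (Z m) b) \<longlonglongrightarrow> (\<Sum>b\<in>Basis. (u \<bullet> b) *\<^sub>R snd p \<alpha> b)"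
      by (intro tendsto_sum tendsto_scaleR tendsto_const)
    then show ?thesis unfolding rep[OF lin, symmetric] rep[OF linear_line, symmetric] .
  qed
  have exact: "a \<bullet> x0 = c" if k: "k \<in> K" and ac: "(a, c) \<in> equations (bracket_of ps k)" for k a c
  proof -
    have "\<bar>a \<bullet> Z m - c\<bar> < e (r m)" for m
    proof -
      have t: "tight (e (r m)) (Z m) (bracket_of ps k)" using X(3)[OF k] by (simp add: Z_def)
      show ?thesis
      proof (cases "bracket_of ps k")
        case (Off S)
        then obtain p q where "p \<in> S" "q \<in> S" "a = position p - position q" "c = 0" using ac by auto
        then show ?thesis using t Off by (auto simp: pos_eq inner_diff_left)
      next
        case (Axis t' S)
        then obtain p where "p \<in> S" "a = position p" "c = t'" using ac by auto
        then show ?thesis using t Axis by (auto simp: pos_eq)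
      qed
    qed
    then have "(\<lambda>m. a \<bullet> Z m) \<longlonglongrightarrow> c" by (intro tendsto_of_dist[OF _ e0]) (simp add: dist_real_def)
    moreover have "(\<lambda>m. a \<bullet> Z m) \<longlonglongrightarrow> a \<bullet> x0" by (intro tendsto_inner tendsto_const Zx)
    ultimately show ?thesis by (rule LIMSEQ_unique[rotated])
  qed
  show ?thesis
    by (rule that[of Z x0]) (simp_all add: X(1,2) Z_def[symmetric] Zx x0c pl lines exact, simp_all add: Z_def X(1,2))
qed

lemma reflected_degeneration:
  fixes \<alpha>s :: "(complex^'n^'n) set list"
  assumes \<alpha>s: "distinct \<alpha>s" "set \<alpha>s = min_building_set W" and adm: "admissible W ps K"
    and p: "p \<in> ordered_cell W \<alpha>s ps K" and k: "k \<in> K"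
    and X: "\<And>m. X m \<in> coords W" "\<And>m. ordered W ps (X m)" "X \<longlonglongrightarrow> x0" "x0 \<in> coords W"
    and lines: "\<And>\<alpha> u. \<alpha> \<in> min_building_set W \<Longrightarrow> (\<lambda>m. line (normal_part \<alpha> (place W (X m))) u) \<longlonglongrightarrow> snd p \<alpha> u"
    and exact: "\<And>k a c. k \<in> K \<Longrightarrow> (a, c) \<in> equations (bracket_of ps k) \<Longrightarrow> a \<bullet> x0 = c"
  defines "\<beta> \<equiv> locus W (bracket_of ps k)"
  defines "Y \<equiv> \<lambda>m. X m - 2 *\<^sub>R normal_part (tangent W \<beta>) (X m - x0)"
  shows "degeneration W \<beta> x0 X Y (snd p)" "tangent W \<beta> = kernel (equations (bracket_of ps k))"
proof -
  let ?nu = "normal_part (tangent W \<beta>)"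
  note nu = normal_part_subspace[OF subspace_tangent[of W \<beta>]]
  have \<beta>m: "\<beta> \<in> min_building_set W" using adm k by (simp add: admissible_def \<beta>_def)
  then have \<beta>i: "\<beta> \<in> intersections W" by (simp add: min_building_set_def)
  note tl = tangent_locus[OF \<beta>i[unfolded \<beta>_def] X(4) bracket_equations(1)[OF adm k] bracket_equations(2)[OF adm k] exact[OF k]]
  have x0\<beta>: "place W x0 \<in> \<beta>" and tan: "tangent W \<beta> = kernel (equations (bracket_of ps k))"
    using tl by (simp_all add: \<beta>_def)
  show "tangent W \<beta> = kernel (equations (bracket_of ps k))" by (rule tan)
  have mid: "(1 / 2) *\<^sub>R (X m + Y m) - x0 \<in> tangent W \<beta>" for m
  proof -
    have "(1 / 2) *\<^sub>R (X m + Y m) - x0 = (X m - x0) - ?nu (X m - x0)"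
      by (simp add: Y_def algebra_simps scaleR_2[symmetric])
    then show ?thesis by (simp only: nu(3))
  qed
  have orth: "v \<bullet> (Y m - X m) = 0" if "v \<in> tangent W \<beta>" for v m
    using nu(5)[OF that, of "X m - x0"] by (simp add: Y_def inner_commute)
  have Yc: "Y m \<in> coords W" for m
  proof (cases "toroidal W")
    case True
    then show ?thesis by (rule coords_toroidal)
  next
    case False
    have x0V: "x0 \<in> tangent W \<beta>" by (rule spherical_in_tangent[OF X(4) x0\<beta> False])
    have "2 *\<^sub>R (((1 / 2) *\<^sub>R (X m + Y m) - x0) + x0) \<in> tangent W \<beta>"
      by (intro subspace_scale subspace_add subspace_tangent mid x0V)
    then have "X m + Y m \<in> tangent W \<beta>" by simp
    from orth[OF this, of m] have "Y m \<bullet> Y m = X m \<bullet> X m" by (simp add: algebra_simps inner_commute)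
    then have n: "norm (Y m) = norm (X m)" by (simp add: norm_eq_sqrt_inner)
    have "Y m \<bullet> (\<chi> i. 1) = X m \<bullet> (\<chi> i. 1)" if "W = TypeA"
      using orth[OF ones_in_tangent, of m] that by (simp add: inner_diff_right inner_commute)
    then show ?thesis using X(1)[of m] n coords_spherical[OF False, of "X m"] coords_spherical[OF False, of "Y m"] by simp
  qed
  show "degeneration W \<beta> x0 X Y (snd p)"
  proof
    show "normal_part \<alpha> (place W (X m)) \<noteq> 0" if "\<alpha> \<in> min_building_set W" for \<alpha> m
      using ordered_normal_part[OF X(2,1)] that by (simp add: min_building_set_def)
    have div: "p \<in> divisor W \<alpha>s \<beta>" using p k by (simp add: ordered_cell_def \<beta>_def)
    show "f (snd p \<gamma> u) = 0"
      if "\<gamma> \<in> min_building_set W" "\<gamma> \<subseteq> \<beta>" "\<not> \<beta> \<subseteq> \<gamma>" "place W x0 \<in> \<gamma>" "(a, c) \<in> roots_through W \<beta>" "linear f"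
        "\<And>x::real^'n. norm (f (place W x) - (k::complex)) = defect W (a \<bullet> x - c)" for \<gamma> a c f k u
      by (rule divisor_tangential[OF \<alpha>s div \<beta>i that(1-3) X(4) that(4-7)])
  qed (use \<beta>m X x0\<beta> Yc lines mid orth in auto)
qed

lemma closure_near_cellI:
  fixes \<alpha>s :: "(complex^'n^'n) set list"
  assumes \<alpha>s: "set \<alpha>s = min_building_set W"
    and p: "p \<in> moduli_space W \<alpha>s" and Z: "\<And>m. Z m \<in> coords W"
    and near: "\<forall>\<^sub>F m in sequentially. ordered W ps (Z m) \<and> (\<forall>k\<in>K. tight r (Z m) (bracket_of ps k))"
    and lim: "(\<lambda>m. place W (Z m)) \<longlonglongrightarrow> fst p"
      "\<And>\<alpha> u. \<alpha> \<in> min_building_set W \<Longrightarrow> (\<lambda>m. line (normal_part \<alpha> (place W (Z m))) u) \<longlonglongrightarrow> snd p \<alpha> u"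
  shows "p \<in> closure (near_cell W \<alpha>s ps K r)"
proof (rule closure_bpointI[OF lim(1)])
  let ?l = "\<lambda>m \<alpha>. if \<alpha> \<in> set \<alpha>s then line (normal_part \<alpha> (place W (Z m))) else (\<lambda>_. 0)"
  show "(\<lambda>m. ?l m \<alpha> u) \<longlonglongrightarrow> snd p \<alpha> u" for \<alpha> u
  proof (cases "\<alpha> \<in> set \<alpha>s")
    case True
    then show ?thesis using lim(2) \<alpha>s by simp
  next
    case False
    then have "snd p \<alpha> = (\<lambda>_. 0)"
      using iterated_blow_up_off_centres[of "fst p" "snd p"] p by (simp add: moduli_space_def)
    then show ?thesis using False by simp
  qed
  show "\<forall>\<^sub>F m in sequentially. (place W (Z m), ?l m) \<in> near_cell W \<alpha>s ps K r"
    using near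
  proof eventually_elim
    case (elim m)
    have "place W (Z m) \<notin> \<alpha>" if "\<alpha> \<in> set \<alpha>s" for \<alpha>
      using ordered_off_flats[of "Z m" \<alpha>] elim Z that \<alpha>s by (auto simp: min_building_set_def hull_inc)
    then have "(place W (Z m), ?l m) \<in> moduli_space W \<alpha>s" unfolding moduli_space_def
      using Z by (intro iterated_blow_up_generic) (auto simp: complex_of_def)
    then show ?case using elim Z[of m] by (auto simp: near_cell_def)
  qed
qed

lemma eventually_tight:
  assumes Z: "Z \<longlonglongrightarrow> x0" and r: "0 < r" and K: "finite K"
    and exact: "\<And>k a c. k \<in> K \<Longrightarrow> (a, c) \<in> equations (bracket_of ps k) \<Longrightarrow> a \<bullet> x0 = c"
  shows "\<forall>\<^sub>F m in sequentially. \<forall>k\<in>K. tight r (Z m) (bracket_of ps k)"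
proof (rule eventually_ball_finite[OF K], rule ballI)
  fix k assume k: "k \<in> K"
  let ?E = "equations (bracket_of ps k)"
  have ev: "\<forall>\<^sub>F m in sequentially. \<bar>a \<bullet> Z m - c\<bar> < r" if "(a, c) \<in> ?E" for a c
  proof -
    have "(\<lambda>m. \<bar>a \<bullet> Z m - c\<bar>) \<longlonglongrightarrow> \<bar>a \<bullet> x0 - c\<bar>" by (intro tendsto_intros Z)
    then have "(\<lambda>m. \<bar>a \<bullet> Z m - c\<bar>) \<longlonglongrightarrow> 0" using exact[OF k that] by simp
    then show ?thesis using r by (rule order_tendstoD(2))
  qed
  show "\<forall>\<^sub>F m in sequentially. tight r (Z m) (bracket_of ps k)"
  proof (cases "fst k")
    case None
    define S where "S = {a \<in> set ps. label a \<in> snd k}"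
    have b: "bracket_of ps k = Off S" using None by (cases k) (auto simp: S_def)
    have "finite S" by (simp add: S_def)
    have "\<forall>\<^sub>F m in sequentially. \<forall>a\<in>S. \<forall>b\<in>S. \<bar>pos (Z m) a - pos (Z m) b\<bar> < r"
      using ev b by (intro eventually_ball_finite \<open>finite S\<close> ballI) (fastforce simp: pos_eq inner_diff_left)
    then show ?thesis by (simp add: b)
  next
    case (Some t)
    define S where "S = {a \<in> set ps. label a \<in> snd k}"
    have b: "bracket_of ps k = Axis t S" using Some by (cases k) (auto simp: S_def)
    have "finite S" by (simp add: S_def)
    have "\<forall>\<^sub>F m in sequentially. \<forall>a\<in>S. \<bar>pos (Z m) a - t\<bar> < r"
      using ev b by (intro eventually_ball_finite \<open>finite S\<close> ballI) (fastforce simp: pos_eq)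
    then show ?thesis by (simp add: b)
  qed
qed

end


lemma bracket_of_cong: "set ps = set qs \<Longrightarrow> bracket_of ps k = bracket_of qs k"
  by (cases k; cases "fst k") auto

lemma bracket_of_segment:
  assumes "configuration W n ps" "set L \<subseteq> set ps"
  shows "bracket_of ps (None, label ` set L) = Off (set L)" "bracket_of ps (Some t, label ` set L) = Axis t (set L)"
  using configuration.bracket_particles[OF assms(1) refl assms(2)] by simp_all

declare bracket_of.simps [simp del]

text \<open>
The configurations are reflected in the flat of the bracket.  A tangent vector \<open>v\<close> of this flat moves all
particles of the bracket in the same direction and no other ones.  A wall that involves exactly one
particle of the bracket, or the sum of two of them, is transverse to \<open>v\<close>, so its side is kept.  Walls
without particles of the bracket are not affected, and differences inside the bracket change sign.
\<close>

lemma off_flip_subset: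
  fixes \<alpha>s :: "(complex^'n^'n) set list"
  assumes conf: "configuration W n (A @ L @ C)"
    and \<alpha>s: "distinct \<alpha>s" "set \<alpha>s = min_building_set W" and adm: "admissible W (A @ L @ C) K"
    and K: "finite K" "(None, label ` set L) \<in> K"
  shows "ordered_cell W \<alpha>s (A @ L @ C) K \<subseteq> ordered_cell W \<alpha>s (A @ rev L @ C) K"
proof
  fix p assume p: "p \<in> ordered_cell W \<alpha>s (A @ L @ C) K"
  let ?ps = "A @ L @ C" and ?qs = "A @ rev L @ C"
  interpret configuration W n ?ps by (rule conf)
  interpret c': configuration W n ?qs
    using rank labels plus by unfold_locales (auto simp: rev_map[symmetric])
  have br: "bracket_of ?qs k = bracket_of ?ps k" for k by (rule bracket_of_cong) auto
  obtain X x0 where X: "\<And>m. X m \<in> coords W" "\<And>m. ordered W ?ps (X m)" "X \<longlonglongrightarrow> x0" "x0 \<in> coords W"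
    and pl: "place W x0 = fst p"
    and lines: "\<And>\<alpha> u. \<alpha> \<in> min_building_set W \<Longrightarrow> (\<lambda>m. line (normal_part \<alpha> (place W (X m))) u) \<longlonglongrightarrow> snd p \<alpha> u"
    and exact: "\<And>k a c. k \<in> K \<Longrightarrow> (a, c) \<in> equations (bracket_of ?ps k) \<Longrightarrow> a \<bullet> x0 = c"
    by (rule cell_sequence[OF \<alpha>s adm p]) (rule that)
  define \<beta> where "\<beta> = locus W (bracket_of ?ps (None, label ` set L))"
  define Y where "Y = (\<lambda>m. X m - 2 *\<^sub>R normal_part (tangent W \<beta>) (X m - x0))"
  have rd: "degeneration W \<beta> x0 X Y (snd p)"
    "tangent W \<beta> = kernel (equations (bracket_of ?ps (None, label ` set L)))"
    unfolding \<beta>_def Y_def by (rule reflected_degeneration[OF \<alpha>s adm p K(2) X lines exact], assumption+)+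
  interpret D: degeneration W \<beta> x0 X Y "snd p" by (rule rd(1))
  have b0: "bracket_of ?ps (None, label ` set L) = Off (set L)" by (rule bracket_of_segment(1)[OF conf]) auto
  have tan: "tangent W \<beta> = kernel (equations (Off (set L)))" using rd(2) unfolding b0 .
  have ker: "v \<in> tangent W \<beta> \<longleftrightarrow> (\<forall>a\<in>set L. \<forall>b\<in>set L. position a \<bullet> v = position b \<bullet> v)" for v
    unfolding tan kernel_def by (fastforce simp: inner_diff_left)
  have orth: "position a \<bullet> position b = (if a = b then 1 else 0)" if "a \<in> set ?ps" "b \<in> set ?ps" for a b
    using label_inj[OF that] position_inner_other[of a b] position_inner_same[of a] by auto
  define v where "v = (\<Sum>a\<in>set L. position a)"
  have pv: "position b \<bullet> v = (if b \<in> set L then 1 else 0)" if "b \<in> set ?ps" for b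
  proof -
    have "position b \<bullet> v = (\<Sum>a\<in>set L. if b = a then 1 else 0)"
      unfolding v_def inner_sum_right using orth[OF that] by (intro sum.cong refl) auto
    then show ?thesis by simp
  qed
  have vt: "v \<in> tangent W \<beta>" unfolding ker using pv by auto
  have out: "position c \<bullet> Y m = position c \<bullet> X m" if "c \<in> set ?ps" "c \<notin> set L" for c m
  proof -
    have "position a \<bullet> position c = 0" if "a \<in> set L" for a
      using orth[of a c] that \<open>c \<in> set ?ps\<close> \<open>c \<notin> set L\<close> by auto
    then have "position c \<in> tangent W \<beta>" unfolding ker by simp
    from D.orth[OF this, of m] show ?thesis by (simp add: inner_diff_right)
  qed
  have in_x0: "position a \<bullet> x0 = position b \<bullet> x0" if "a \<in> set L" "b \<in> set L" for a b
  proof -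
    have "(position a - position b, 0) \<in> equations (bracket_of ?ps (None, label ` set L))"
      unfolding b0 using that by auto
    from exact[OF K(2) this] show ?thesis by (simp add: inner_diff_left)
  qed
  have flip: "pos (Y m) a - pos (Y m) b = - (pos (X m) a - pos (X m) b)" if "a \<in> set L" "b \<in> set L" for a b m
  proof -
    have "position a \<bullet> ((1 / 2) *\<^sub>R (X m + Y m) - x0) = position b \<bullet> ((1 / 2) *\<^sub>R (X m + Y m) - x0)"
      using D.mid[of m] that unfolding ker by blast
    then show ?thesis using in_x0[OF that] by (simp add: pos_eq inner_diff_right inner_add_right field_simps)
  qed
  \<comment> \<open>The three ways in which an inequality of the chamber survives the reflection.\<close>
  have persist: "\<forall>\<^sub>F m in sequentially. k < \<rho> \<bullet> Y m"
    if \<rho>: "wall_functional W \<rho> k" "\<And>m. k < \<rho> \<bullet> X m" "k < \<rho> \<bullet> x0 \<or> \<rho> \<bullet> v \<noteq> 0 \<or> (\<forall>m. \<rho> \<bullet> Y m = \<rho> \<bullet> X m)" for \<rho> k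
  proof -
    consider "k < \<rho> \<bullet> x0" | "\<rho> \<bullet> v \<noteq> 0" | "\<forall>m. \<rho> \<bullet> Y m = \<rho> \<bullet> X m" using \<rho>(3) by blast
    then show ?thesis
    proof cases
      case 1
      have "(\<lambda>m. \<rho> \<bullet> Y m) \<longlonglongrightarrow> \<rho> \<bullet> x0" by (intro tendsto_inner tendsto_const D.Y_lim)
      then show ?thesis using 1 by (rule order_tendstoD(1))
    next
      case 2
      obtain a c s where acs: "(a, c) \<in> affine_roots W" "s \<in> {1, -1}" "\<rho> = s *\<^sub>R a" "s * c - k \<in> lattice W"
        using \<rho>(1) unfolding wall_functional_def by blast
      have "\<forall>\<^sub>F m in sequentially. k < s * (a \<bullet> Y m)"
        by (rule D.reflected_side[OF acs(1,2,4) _ vt]) (use \<rho>(2) 2 acs(3) in auto)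
      then show ?thesis by (simp add: acs(3))
    next
      case 3
      then show ?thesis using \<rho>(2) by simp
    qed
  qed
  \<comment> \<open>Two particles of the bracket have the same limit, so a bound below \<open>0\<close> on their difference is strict in the limit.\<close>
  have diff: "\<forall>\<^sub>F m in sequentially. k < pos (Y m) b - pos (Y m) a"
    if ab: "a \<in> set ?ps" "b \<in> set ?ps" "a \<noteq> b" "k \<in> lattice W" "\<And>m. k < pos (X m) b - pos (X m) a"
      "a \<in> set L \<Longrightarrow> b \<in> set L \<Longrightarrow> k < 0" for a b k
  proof -
    have wf: "wall_functional W (position b - position a) k"
    proof (rule difference_functional)
      show "label b \<noteq> label a" using label_inj[OF ab(1,2)] ab(3) by metis
      show "W \<in> {TypeA, AffA} \<longrightarrow> b \<in> range Plus \<and> a \<in> range Plus" using plus ab(1,2) by (meson subsetD)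
    qed (rule ab(4))
    have disj: "k < (position b - position a) \<bullet> x0 \<or> (position b - position a) \<bullet> v \<noteq> 0 \<or>
        (\<forall>m. (position b - position a) \<bullet> Y m = (position b - position a) \<bullet> X m)"
    proof (cases "a \<in> set L \<longleftrightarrow> b \<in> set L")
      case False
      then have "(position b - position a) \<bullet> v \<noteq> 0"
        unfolding inner_diff_left pv[OF ab(1)] pv[OF ab(2)] by auto
      then show ?thesis by blast
    next
      case True
      show ?thesis
      proof (cases "a \<in> set L")
        case l: True
        then have "k < (position b - position a) \<bullet> x0"
          using in_x0[of a b] ab(6) True by (simp add: inner_diff_left)
        then show ?thesis by blast
      next
        case l: False
        then have "\<forall>m. (position b - position a) \<bullet> Y m = (position b - position a) \<bullet> X m"
          using out[OF ab(1)] out[OF ab(2)] True by (simp add: inner_diff_left)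
        then show ?thesis by blast
      qed
    qed
    have "\<forall>\<^sub>F m in sequentially. k < (position b - position a) \<bullet> Y m"
      by (rule persist[OF wf _ disj]) (use ab(5) in \<open>simp add: pos_eq inner_diff_left\<close>)
    then show ?thesis by (simp add: pos_eq inner_diff_left)
  qed
  have sum: "\<forall>\<^sub>F m in sequentially. k < s * (pos (Y m) a + pos (Y m) b)"
    if ab: "a \<in> set ?ps" "b \<in> set ?ps" "a \<noteq> b" "W \<notin> {TypeA, AffA}" "k \<in> lattice W" "s \<in> {1, -1}"
      "\<And>m. k < s * (pos (X m) a + pos (X m) b)" for a b k s
  proof -
    have "wall_functional W (position a + position b) (s * k)"
    proof (rule sum_functional[OF _ ab(4)])
      show "label a \<noteq> label b" using label_inj[OF ab(1,2)] ab(3) by metis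
      show "s * k \<in> lattice W" using ab(5,6) by auto
    qed
    then have wf: "wall_functional W (s *\<^sub>R (position a + position b)) k"
      using wall_functional_minus[of W "position a + position b" "s * k"] ab(6) by (elim insertE) auto
    have disj: "k < (s *\<^sub>R (position a + position b)) \<bullet> x0 \<or> (s *\<^sub>R (position a + position b)) \<bullet> v \<noteq> 0 \<or>
        (\<forall>m. (s *\<^sub>R (position a + position b)) \<bullet> Y m = (s *\<^sub>R (position a + position b)) \<bullet> X m)"
    proof (cases "a \<in> set L \<or> b \<in> set L")
      case True
      then have "(s *\<^sub>R (position a + position b)) \<bullet> v \<noteq> 0" using ab(6)
        unfolding inner_scaleR_left inner_add_left pv[OF ab(1)] pv[OF ab(2)] by auto
      then show ?thesis by blast
    next
      case False
      then show ?thesis using out[OF ab(1)] out[OF ab(2)] by (simp add: inner_add_left)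
    qed
    have "\<forall>\<^sub>F m in sequentially. k < (s *\<^sub>R (position a + position b)) \<bullet> Y m"
      by (rule persist[OF wf _ disj]) (use ab(7) in \<open>simp add: pos_eq inner_add_left\<close>)
    then show ?thesis by (simp add: pos_eq inner_add_left)
  qed
  have single: "\<forall>\<^sub>F m in sequentially. k < s * pos (Y m) c"
    if c: "c \<in> set ?ps" "wall_functional W (s *\<^sub>R position c) k" "s \<noteq> 0" "\<And>m. k < s * pos (X m) c" for c k s
  proof -
    have disj: "k < (s *\<^sub>R position c) \<bullet> x0 \<or> (s *\<^sub>R position c) \<bullet> v \<noteq> 0 \<or>
        (\<forall>m. (s *\<^sub>R position c) \<bullet> Y m = (s *\<^sub>R position c) \<bullet> X m)"
      using pv[OF c(1)] out[OF c(1)] c(3) by (cases "c \<in> set L") auto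
    have "\<forall>\<^sub>F m in sequentially. k < (s *\<^sub>R position c) \<bullet> Y m"
      by (rule persist[OF c(2) _ disj]) (use c(4) in \<open>simp add: pos_eq\<close>)
    then show ?thesis by (simp add: pos_eq)
  qed
  have two: "- 2 \<in> lattice W" if "toroidal W" using that by (auto simp: lattice_iff intro!: exI[of _ "-1"])
  have O: "sorted_wrt (\<lambda>a b. pos (X m) a < pos (X m) b) ?ps" for m by (rule orderedD(1)[OF X(2)])
  have sorted_ev: "\<forall>\<^sub>F m in sequentially. sorted_wrt (\<lambda>a b. pos (Y m) a < pos (Y m) b) ?qs"
  proof -
    have dist: "distinct ?ps" using labels(1) by (simp add: distinct_map del: map_append)
    have cross: "\<forall>\<^sub>F m in sequentially. \<forall>a\<in>P. \<forall>b\<in>Q. pos (Y m) a < pos (Y m) b"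
      if PQ: "finite P" "finite Q" "P \<subseteq> set ?ps" "Q \<subseteq> set ?ps" "P \<inter> Q = {}" "P \<inter> set L = {} \<or> Q \<inter> set L = {}"
        "\<And>m a b. a \<in> P \<Longrightarrow> b \<in> Q \<Longrightarrow> pos (X m) a < pos (X m) b" for P Q
    proof (intro eventually_ball_finite PQ(1,2) ballI)
      fix a b assume ab: "a \<in> P" "b \<in> Q"
      then have "a \<noteq> b" "\<not> (a \<in> set L \<and> b \<in> set L)" using PQ(5,6) by blast+
      then have "\<forall>\<^sub>F m in sequentially. 0 < pos (Y m) b - pos (Y m) a"
        by (intro diff) (use ab PQ(3,4,7) in auto)
      then show "\<forall>\<^sub>F m in sequentially. pos (Y m) a < pos (Y m) b" by (rule eventually_mono) simp
    qed
    have 1: "\<forall>\<^sub>F m in sequentially. \<forall>a\<in>set A. \<forall>b\<in>set L. pos (Y m) a < pos (Y m) b"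
      by (rule cross) (use dist O in \<open>auto simp: sorted_wrt_append\<close>)
    have 2: "\<forall>\<^sub>F m in sequentially. \<forall>a\<in>set L. \<forall>b\<in>set C. pos (Y m) a < pos (Y m) b"
      by (rule cross) (use dist O in \<open>auto simp: sorted_wrt_append\<close>)
    have same: "pos (Y m) a = pos (X m) a" if "a \<in> set A \<union> set C" for a m
      using out[of a m] that dist by (auto simp: pos_eq)
    show ?thesis using 1 2
    proof eventually_elim
      case (elim m)
      have sA: "sorted_wrt (\<lambda>a b. pos (Y m) a < pos (Y m) b) A" and sC: "sorted_wrt (\<lambda>a b. pos (Y m) a < pos (Y m) b) C"
        and AC: "\<forall>a\<in>set A. \<forall>c\<in>set C. pos (Y m) a < pos (Y m) c"
        using O[of m] sorted_wrt_mono_rel[of A "\<lambda>a b. pos (X m) a < pos (X m) b" "\<lambda>a b. pos (Y m) a < pos (Y m) b"]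
          sorted_wrt_mono_rel[of C "\<lambda>a b. pos (X m) a < pos (X m) b" "\<lambda>a b. pos (Y m) a < pos (Y m) b"]
        by (simp_all add: sorted_wrt_append same)
      have "sorted_wrt (\<lambda>a b. pos (Y m) b < pos (Y m) a) L"
      proof (rule sorted_wrt_mono_rel)
        show "sorted_wrt (\<lambda>a b. pos (X m) a < pos (X m) b) L" using O[of m] by (simp add: sorted_wrt_append)
        show "pos (Y m) b < pos (Y m) a" if "a \<in> set L" "b \<in> set L" "pos (X m) a < pos (X m) b" for a b
          using flip[OF that(1,2), of m] that(3) by linarith
      qed
      then have sL: "sorted_wrt (\<lambda>a b. pos (Y m) a < pos (Y m) b) (rev L)" by (simp add: sorted_wrt_rev)
      show ?case using sA sC AC sL elim by (auto simp: sorted_wrt_append)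
    qed
  qed
  have bd1: "\<forall>\<^sub>F m in sequentially. W = AffA \<longrightarrow> (\<forall>a\<in>set ?ps. \<forall>b\<in>set ?ps. pos (Y m) b < pos (Y m) a + 2)"
  proof (cases "W = AffA")
    case True
    have "\<forall>\<^sub>F m in sequentially. \<forall>a\<in>set ?ps. \<forall>b\<in>set ?ps. pos (Y m) b < pos (Y m) a + 2"
    proof (intro eventually_ball_finite finite_set ballI)
      fix a b assume ab: "a \<in> set ?ps" "b \<in> set ?ps"
      show "\<forall>\<^sub>F m in sequentially. pos (Y m) b < pos (Y m) a + 2"
      proof (cases "a = b")
        case False
        have "\<forall>\<^sub>F m in sequentially. - 2 < pos (Y m) a - pos (Y m) b"
        proof (rule diff[OF ab(2,1) False[symmetric]])
          show "- 2 \<in> lattice W" using two True by (simp add: toroidal_def)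
          show "- 2 < pos (X m) a - pos (X m) b" for m using orderedD(2)[OF X(2)[of m] True ab] by simp
        qed simp
        then show ?thesis by (rule eventually_mono) simp
      qed simp
    qed
    then show ?thesis by (rule eventually_mono) simp
  qed simp
  have bd2: "\<forall>\<^sub>F m in sequentially. W \<notin> {TypeA, AffA} \<longrightarrow> (if fixed_at_0 W then \<forall>a\<in>set ?ps. 0 < pos (Y m) a
        else \<forall>a\<in>set ?ps. \<forall>b\<in>set ?ps. a \<noteq> b \<longrightarrow> - pos (Y m) a < pos (Y m) b)"
  proof (cases "W \<notin> {TypeA, AffA}")
    case W: True
    show ?thesis
    proof (cases "fixed_at_0 W")
      case True
      have "\<forall>\<^sub>F m in sequentially. \<forall>a\<in>set ?ps. 0 < pos (Y m) a"
      proof (intro eventually_ball_finite finite_set ballI)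
        fix a assume a: "a \<in> set ?ps"
        have "\<forall>\<^sub>F m in sequentially. 0 < 1 * pos (Y m) a"
          by (rule single[OF a]) (use fixed_functional(1)[OF True] orderedD(3)[OF X(2) W True a] in simp_all)
        then show "\<forall>\<^sub>F m in sequentially. 0 < pos (Y m) a" by simp
      qed
      then show ?thesis using True by simp
    next
      case False
      have "\<forall>\<^sub>F m in sequentially. \<forall>a\<in>set ?ps. \<forall>b\<in>set ?ps. a \<noteq> b \<longrightarrow> - pos (Y m) a < pos (Y m) b"
      proof (intro eventually_ball_finite finite_set ballI)
        fix a b assume ab: "a \<in> set ?ps" "b \<in> set ?ps"
        show "\<forall>\<^sub>F m in sequentially. a \<noteq> b \<longrightarrow> - pos (Y m) a < pos (Y m) b"
        proof (cases "a = b")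
          case ne: False
          have "0 < 1 * (pos (X m) a + pos (X m) b)" for m using orderedD(4)[OF X(2)[of m] W False ab ne] by simp
          then have "\<forall>\<^sub>F m in sequentially. 0 < 1 * (pos (Y m) a + pos (Y m) b)"
            by (intro sum[OF ab ne W]) auto
          then show ?thesis by (rule eventually_mono) simp
        qed simp
      qed
      then show ?thesis using False by simp
    qed
  qed simp
  have bd3: "\<forall>\<^sub>F m in sequentially. W \<in> {AffB, AffC, AffD} \<longrightarrow> (if fixed_at_1 W then \<forall>a\<in>set ?ps. pos (Y m) a < 1
        else \<forall>a\<in>set ?ps. \<forall>b\<in>set ?ps. a \<noteq> b \<longrightarrow> pos (Y m) b < 2 - pos (Y m) a)"
  proof (cases "W \<in> {AffB, AffC, AffD}")
    case W: True
    show ?thesis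
    proof (cases "fixed_at_1 W")
      case True
      have "\<forall>\<^sub>F m in sequentially. \<forall>a\<in>set ?ps. pos (Y m) a < 1"
      proof (intro eventually_ball_finite finite_set ballI)
        fix a assume a: "a \<in> set ?ps"
        have "\<forall>\<^sub>F m in sequentially. - 1 < - 1 * pos (Y m) a"
          by (rule single[OF a])
            (use wall_functional_minus[OF fixed_functional(2)[OF True, of a]] orderedD(5)[OF X(2) W True a] in simp_all)
        then show "\<forall>\<^sub>F m in sequentially. pos (Y m) a < 1" by simp
      qed
      then show ?thesis by (rule eventually_mono) (use True in auto)
    next
      case False
      have "\<forall>\<^sub>F m in sequentially. \<forall>a\<in>set ?ps. \<forall>b\<in>set ?ps. a \<noteq> b \<longrightarrow> pos (Y m) b < 2 - pos (Y m) a"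
      proof (intro eventually_ball_finite finite_set ballI)
        fix a b assume ab: "a \<in> set ?ps" "b \<in> set ?ps"
        show "\<forall>\<^sub>F m in sequentially. a \<noteq> b \<longrightarrow> pos (Y m) b < 2 - pos (Y m) a"
        proof (cases "a = b")
          case ne: False
          have "- 2 < - 1 * (pos (X m) a + pos (X m) b)" for m using orderedD(6)[OF X(2)[of m] W False ab ne] by simp
          moreover have "- 2 \<in> lattice W" "W \<notin> {TypeA, AffA}" using W two by (auto simp: toroidal_def)
          ultimately have "\<forall>\<^sub>F m in sequentially. - 2 < - 1 * (pos (Y m) a + pos (Y m) b)"
            by (intro sum[OF ab ne]) auto
          then show ?thesis by (rule eventually_mono) simp
        qed simp
      qed
      then show ?thesis by (rule eventually_mono) (use False in auto)
    qed
  qed simp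
  have ord_ev: "\<forall>\<^sub>F m in sequentially. ordered W ?qs (Y m)"
    using sorted_ev bd1 bd2 bd3
    by eventually_elim (simp add: ordered_def boundary_conditions_def insert_commute Un_commute Un_left_commute)
  have "p \<in> closure (near_cell W \<alpha>s ?qs K r)" if r: "0 < r" for r
  proof (rule c'.closure_near_cellI[OF \<alpha>s(2), of p Y])
    show "p \<in> moduli_space W \<alpha>s" using p by (simp add: ordered_cell_def)
    have "\<forall>\<^sub>F m in sequentially. \<forall>k\<in>K. tight r (Y m) (bracket_of ?qs k)"
      by (rule c'.eventually_tight[OF D.Y_lim r K(1)]) (use exact br in simp)
    with ord_ev show "\<forall>\<^sub>F m in sequentially. ordered W ?qs (Y m) \<and> (\<forall>k\<in>K. tight r (Y m) (bracket_of ?qs k))"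
      by (rule eventually_conj)
    show "(\<lambda>m. place W (Y m)) \<longlonglongrightarrow> fst p" unfolding pl[symmetric]
      by (rule continuous_on_tendsto_compose[OF continuous_place[of UNIV] D.Y_lim]) auto
  qed (use D.XY D.reflected_lines in auto)
  then show "p \<in> ordered_cell W \<alpha>s ?qs K" using p by (simp add: ordered_cell_def br)
qed

text \<open>
On the positions, the reflection in the axis point \<open>t\<close> replaces \<open>s\<close> by \<open>2 t - s\<close>, which is the position
\<open>- s\<close> of the mirror image up to a full turn.  So the reflected configurations are represented by
changing the signs \<open>\<sigma>\<close> of the coordinates in the bracket, and they lie in the new chamber by renaming the
particles with \<open>\<theta>\<close>.
\<close>

lemma axis_flip_subset:
  fixes \<alpha>s :: "(complex^'n^'n) set list"
  assumes conf: "configuration W n (A @ L @ C)"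
    and \<alpha>s: "distinct \<alpha>s" "set \<alpha>s = min_building_set W" and adm: "admissible W (A @ L @ C) K"
    and K: "finite K" "(Some t, label ` set L) \<in> K"
  shows "ordered_cell W \<alpha>s (A @ L @ C) K \<subseteq> ordered_cell W \<alpha>s (A @ map opp L @ C) K"
    "admissible W (A @ map opp L @ C) K"
proof -
  let ?ps = "A @ L @ C" and ?qs = "A @ map opp L @ C"
  define M where "M = label ` set L"
  define \<theta> where "\<theta> = (\<lambda>a. if label a \<in> M then opp a else a)"
  define \<sigma> :: "real^'n \<Rightarrow> real^'n" where "\<sigma> = (\<lambda>x. \<chi> i. if i \<in> M then - x $ i else x $ i)"
  interpret configuration W n ?ps by (rule conf)
  have W: "W \<notin> {TypeA, AffA}" "t = 0 \<or> t = 1 \<and> toroidal W" and lam: "\<And>M'. (None, M') \<in> K \<Longrightarrow> M' \<subseteq> M \<or> M' \<inter> M = {}"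
    using adm K(2) unfolding admissible_def M_def by blast+
  have two_t: "2 * t \<in> lattice W" using W(2) by (auto simp: lattice_iff intro: exI[of _ 1])
  have lab\<theta> [simp]: "label (\<theta> a) = label a" for a by (simp add: \<theta>_def)
  have \<theta>\<theta>: "\<theta> (\<theta> a) = a" for a by (simp add: \<theta>_def)
  have inj: "inj \<theta>" by (rule injI) (metis \<theta>\<theta>)
  have pos\<sigma>: "pos (\<sigma> x) (\<theta> a) = pos x a" for x a by (cases a) (auto simp: \<sigma>_def \<theta>_def)
  have qs: "?qs = map \<theta> ?ps"
  proof -
    have "map \<theta> A = A" "map \<theta> C = C"
      using labels(1) unfolding map_append distinct_append \<theta>_def M_def by (force intro!: map_idI)+
    moreover have "map \<theta> L = map opp L" by (simp add: \<theta>_def M_def)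
    ultimately show ?thesis by simp
  qed
  interpret c': configuration W n ?qs
  proof
    have "map label ?qs = map label ?ps" by simp
    then show "distinct (map label ?qs)" "label ` set ?qs = UNIV" using labels by (metis, metis list.set_map)
  qed (use rank W in auto)
  have br: "bracket_of ?qs (None, M') = Off (\<theta> ` {a \<in> set ?ps. label a \<in> M'})"
    "bracket_of ?qs (Some t', M') = Axis t' (\<theta> ` {a \<in> set ?ps. label a \<in> M'})" for t' M'
    unfolding qs by (auto simp: bracket_of.simps)
  have ord: "ordered W ?qs (\<sigma> x) \<longleftrightarrow> ordered W ?ps x" for x
  proof -
    have "sorted_wrt (\<lambda>a b. pos (\<sigma> x) a < pos (\<sigma> x) b) ?qs \<longleftrightarrow> sorted_wrt (\<lambda>a b. pos x a < pos x b) ?ps"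
      unfolding qs by (simp only: sorted_wrt_map pos\<sigma>)
    moreover have "boundary_conditions W (set ?qs) (\<sigma> x) \<longleftrightarrow> boundary_conditions W (set ?ps) x"
      unfolding qs set_map boundary_conditions_def by (simp only: ball_simps pos\<sigma> inj_eq[OF inj])
    ultimately show ?thesis by (simp add: ordered_def)
  qed
  have tig: "tight r (\<sigma> x) (bracket_of ?qs k) \<longleftrightarrow> tight r x (bracket_of ?ps k)" for r x k
  proof (cases k)
    case (Pair o' M')
    show ?thesis unfolding Pair
      by (cases o'; simp only: br; simp only: bracket_of.simps tight.simps ball_simps pos\<sigma>)
  qed
  have img: "(\<forall>a\<in>\<theta> ` S. P a) \<longleftrightarrow> (\<forall>a\<in>S. P (\<theta> a))" for S P by blast
  have loc: "locus W (bracket_of ?qs k) = locus W (bracket_of ?ps k)" if k: "k \<in> K" for k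
  proof (cases k)
    case (Pair o' M')
    let ?S = "{a \<in> set ?ps. label a \<in> M'}"
    show ?thesis
    proof (cases o')
      case None
      have "same_pos W (pos x (\<theta> a)) (pos x (\<theta> b)) \<longleftrightarrow> same_pos W (pos x a) (pos x b)" if "a \<in> ?S" "b \<in> ?S" for x a b
      proof -
        have "label a \<in> M \<longleftrightarrow> label b \<in> M" using lam[of M'] k Pair None that by blast
        then show ?thesis using lattice_neg_iff[of "pos x a - pos x b" W]
          by (auto simp: \<theta>_def same_pos_lattice pos_opp)
      qed
      then have "(\<forall>a\<in>\<theta> ` ?S. \<forall>b\<in>\<theta> ` ?S. same_pos W (pos x a) (pos x b)) \<longleftrightarrow> (\<forall>a\<in>?S. \<forall>b\<in>?S. same_pos W (pos x a) (pos x b))" for x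
        unfolding img by (intro ball_cong refl)
      then show ?thesis unfolding Pair None br unfolding bracket_of.simps locus.simps by (simp only:)
    next
      case (Some t')
      have w: "t' = 0 \<or> t' = 1 \<and> toroidal W" using adm k Pair Some unfolding admissible_def by blast
      then have t2: "2 * t' \<in> lattice W" by (auto simp: lattice_iff intro: exI[of _ 1])
      have neg: "- s - t' \<in> lattice W \<longleftrightarrow> s - t' \<in> lattice W" for s
      proof -
        have "- s - t' = - (s - t') - 2 * t'" by simp
        then show ?thesis using lattice_diff[OF _ t2, of "- (s - t')"] lattice_diff[OF _ t2, of "- (- s - t')"]
          by (metis (no_types, lifting) lattice_neg_iff add_diff_cancel_right' diff_add_cancel lattice_add t2)
      qed
      have "same_pos W (pos x (\<theta> a)) t' \<longleftrightarrow> same_pos W (pos x a) t'" for x a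
        by (simp add: \<theta>_def same_pos_lattice pos_opp neg)
      then show ?thesis unfolding Pair Some br unfolding bracket_of.simps locus.simps img by (simp only:)
    qed
  qed
  show adm': "admissible W ?qs K"
    using adm c'.labels W unfolding admissible_def by (simp add: loc del: set_append map_append)
  show "ordered_cell W \<alpha>s ?ps K \<subseteq> ordered_cell W \<alpha>s ?qs K"
  proof
    fix p assume p: "p \<in> ordered_cell W \<alpha>s ?ps K"
    obtain X x0 where X: "\<And>m. X m \<in> coords W" "\<And>m. ordered W ?ps (X m)" "X \<longlonglongrightarrow> x0" "x0 \<in> coords W"
      and pl: "place W x0 = fst p"
      and lines: "\<And>\<alpha> u. \<alpha> \<in> min_building_set W \<Longrightarrow> (\<lambda>m. line (normal_part \<alpha> (place W (X m))) u) \<longlonglongrightarrow> snd p \<alpha> u"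
      and exact: "\<And>k a c. k \<in> K \<Longrightarrow> (a, c) \<in> equations (bracket_of ?ps k) \<Longrightarrow> a \<bullet> x0 = c"
      by (rule cell_sequence[OF \<alpha>s adm p]) (rule that)
    define \<beta> where "\<beta> = locus W (bracket_of ?ps (Some t, label ` set L))"
    define Y where "Y = (\<lambda>m. X m - 2 *\<^sub>R normal_part (tangent W \<beta>) (X m - x0))"
    have rd: "degeneration W \<beta> x0 X Y (snd p)"
      "tangent W \<beta> = kernel (equations (bracket_of ?ps (Some t, label ` set L)))"
      unfolding \<beta>_def Y_def by (rule reflected_degeneration[OF \<alpha>s adm p K(2) X lines exact], assumption+)+
    interpret D: degeneration W \<beta> x0 X Y "snd p" by (rule rd(1))
    have b0: "bracket_of ?ps (Some t, label ` set L) = Axis t (set L)" by (rule bracket_of_segment(2)[OF conf]) auto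
    have tan: "tangent W \<beta> = kernel (equations (Axis t (set L)))" using rd(2) unfolding b0 .
    have ker: "v \<in> tangent W \<beta> \<longleftrightarrow> (\<forall>a\<in>set L. position a \<bullet> v = 0)" for v
      unfolding tan kernel_def by fastforce
    have same: "place W (\<sigma> (X m)) = place W (Y m)" for m
    proof (rule place_eqI)
      fix i
      show "\<sigma> (X m) $ i - Y m $ i \<in> lattice W"
      proof (cases "i \<in> M")
        case True
        then obtain a where a: "a \<in> set L" "label a = i" by (auto simp: M_def)
        have "(position a, t) \<in> equations (bracket_of ?ps (Some t, label ` set L))" unfolding b0 using a by auto
        then have "position a \<bullet> x0 = t" by (rule exact[OF K(2)])
        moreover have "position a \<bullet> ((1 / 2) *\<^sub>R (X m + Y m) - x0) = 0" using D.mid[of m] a unfolding ker by blast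
        ultimately have "pos (Y m) a = 2 * t - pos (X m) a"
          by (simp add: pos_eq inner_diff_right inner_add_right field_simps)
        then have "- X m $ i - Y m $ i = - (2 * t) \<or> - X m $ i - Y m $ i = 2 * t" using a(2) by (cases a) auto
        then show ?thesis using True two_t by (auto simp: \<sigma>_def)
      next
        case False
        have "axis i 1 \<in> tangent W \<beta>" unfolding ker
        proof
          fix a assume "a \<in> set L"
          then have "label a \<noteq> i" using False by (auto simp: M_def)
          then show "position a \<bullet> axis i 1 = 0" by (cases a) (auto simp: inner_axis_axis)
        qed
        from D.orth[OF this, of m] show ?thesis using False by (simp add: \<sigma>_def inner_diff_right axis_inner)
      qed
    qed
    have Zc: "\<sigma> (X m) \<in> coords W" for m
    proof (cases "toroidal W")
      case True
      then show ?thesis by (rule coords_toroidal)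
    next
      case False
      have "norm (\<sigma> (X m)) = norm (X m)" unfolding norm_vec_def
        by (intro L2_set_cong refl) (simp add: \<sigma>_def)
      then show ?thesis using X(1)[of m] W coords_spherical[OF False, of "X m"] coords_spherical[OF False, of "\<sigma> (X m)"] by simp
    qed
    have "p \<in> closure (near_cell W \<alpha>s ?qs K r)" if r: "0 < r" for r
    proof (rule c'.closure_near_cellI[OF \<alpha>s(2), of p "\<lambda>m. \<sigma> (X m)"])
      show "p \<in> moduli_space W \<alpha>s" using p by (simp add: ordered_cell_def)
      have "\<forall>\<^sub>F m in sequentially. \<forall>k\<in>K. tight r (X m) (bracket_of ?ps k)"
        by (rule eventually_tight[OF X(3) r K(1) exact])
      then show "\<forall>\<^sub>F m in sequentially. ordered W ?qs (\<sigma> (X m)) \<and> (\<forall>k\<in>K. tight r (\<sigma> (X m)) (bracket_of ?qs k))"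
        by (simp only: tig ord X(2) simp_thms)
      show "(\<lambda>m. place W (\<sigma> (X m))) \<longlonglongrightarrow> fst p" unfolding pl[symmetric] same
        by (rule continuous_on_tendsto_compose[OF continuous_place[of UNIV] D.Y_lim]) auto
      show "(\<lambda>m. line (normal_part \<alpha> (place W (\<sigma> (X m)))) u) \<longlonglongrightarrow> snd p \<alpha> u" if "\<alpha> \<in> min_building_set W" for \<alpha> u
        unfolding same by (rule D.reflected_lines[OF that])
    qed (rule Zc)
    then show "p \<in> ordered_cell W \<alpha>s ?qs K" using p loc by (simp add: ordered_cell_def del: set_append)
  qed
qed


section \<open>Moves on orderings\<close>

text \<open>
The flips of a single bracket on the level of orderings.  They keep the labels in every bracket, so
\<open>K\<close> is the same for all the orderings that can be reached.
\<close>

inductive flip_move :: "(real option \<times> 'n set) set \<Rightarrow> 'n particle list \<Rightarrow> 'n particle list \<Rightarrow> bool"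
  for K where
  off: "(None, label ` set L) \<in> K \<Longrightarrow> flip_move K (A @ L @ C) (A @ rev L @ C)"
| axis: "(Some t, label ` set L) \<in> K \<Longrightarrow> flip_move K (A @ L @ C) (A @ map opp L @ C)"

lemma image_label_opp [simp]: "label ` opp ` S = label ` S"
  by (simp add: image_image)

text \<open>
The opposite inclusion comes from the opposite move, as both moves are involutions.
\<close>

lemma flip_move_cell:
  fixes \<alpha>s :: "(complex^'n^'n) set list"
  assumes m: "flip_move K ps qs" and conf: "configuration W n ps"
    and \<alpha>s: "distinct \<alpha>s" "set \<alpha>s = min_building_set W" and adm: "admissible W ps K" and K: "finite K"
  shows "configuration W n qs \<and> admissible W qs K \<and> ordered_cell W \<alpha>s qs K = ordered_cell W \<alpha>s ps K"
  using m
proof cases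
  case (off L A C)
  note conf' = conf[unfolded off(1)] and adm' = adm[unfolded off(1)]
  have br: "bracket_of (A @ rev L @ C) k = bracket_of (A @ L @ C) k" for k by (rule bracket_of_cong) auto
  have c2: "configuration W n (A @ rev L @ C)"
    using conf' unfolding configuration_def by (auto simp: rev_map[symmetric])
  have a2: "admissible W (A @ rev L @ C) K"
    using adm' unfolding admissible_def by (auto simp: rev_map[symmetric] br)
  have k2: "(None, label ` set (rev L)) \<in> K" using off(3) by simp
  have "ordered_cell W \<alpha>s (A @ rev L @ C) K \<subseteq> ordered_cell W \<alpha>s (A @ rev (rev L) @ C) K"
    by (rule off_flip_subset[OF c2 \<alpha>s a2 K k2])
  then show ?thesis unfolding off(1,2)
    using c2 a2 off_flip_subset[OF conf' \<alpha>s adm' K off(3)] by auto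
next
  case (axis t L A C)
  note conf' = conf[unfolded axis(1)] and adm' = adm[unfolded axis(1)]
  have W: "W \<notin> {TypeA, AffA}" using adm' axis(3) unfolding admissible_def by blast
  have eq: "map label (A @ map opp L @ C) = map label (A @ L @ C)" by simp
  have c2: "configuration W n (A @ map opp L @ C)"
    using conf' W unfolding configuration_def eq list.set_map[symmetric] by simp
  note f = axis_flip_subset[OF conf' \<alpha>s adm' K axis(3)]
  have k2: "(Some t, label ` set (map opp L)) \<in> K" using axis(3) by (simp add: image_image)
  have "ordered_cell W \<alpha>s (A @ map opp L @ C) K \<subseteq> ordered_cell W \<alpha>s (A @ map opp (map opp L) @ C) K"
    by (rule axis_flip_subset(1)[OF c2 \<alpha>s f(2) K k2])
  then show ?thesis unfolding axis(1,2) using c2 f by (auto simp: comp_def)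
qed

lemma flip_moves_cell:
  fixes \<alpha>s :: "(complex^'n^'n) set list"
  assumes "(flip_move K)\<^sup>*\<^sup>* ps qs" "configuration W n ps"
    "distinct \<alpha>s" "set \<alpha>s = min_building_set W" "admissible W ps K" "finite K"
  shows "configuration W n qs \<and> admissible W qs K \<and> ordered_cell W \<alpha>s qs K = ordered_cell W \<alpha>s ps K"
  using assms(1)
proof induction
  case base
  then show ?case using assms by simp
next
  case (step qs rs)
  then show ?case using flip_move_cell[OF step(2) _ assms(3,4) _ assms(6)] by metis
qed

lemma flip_move_context: "flip_move K ps qs \<Longrightarrow> flip_move K (A @ ps @ C) (A @ qs @ C)"
proof (induction rule: flip_move.induct)
  case (off L A' C')
  from flip_move.off[OF off, of "A @ A'" "C' @ C"] show ?case by simp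
next
  case (axis t L A' C')
  from flip_move.axis[OF axis, of "A @ A'" "C' @ C"] show ?case by simp
qed

lemma flip_moves_context: "(flip_move K)\<^sup>*\<^sup>* ps qs \<Longrightarrow> (flip_move K)\<^sup>*\<^sup>* (A @ ps @ C) (A @ qs @ C)"
proof (induction rule: rtranclp_induct)
  case (step qs rs)
  from step(3) flip_move_context[OF step(2)] show ?case by (rule rtranclp.rtrancl_into_rtrancl)
qed simp

text \<open>
Seen from the axis point \<open>1\<close>, an ordering is reversed and its particles are replaced by their mirror
images.  This makes the moves at the axis point \<open>0\<close> available at \<open>1\<close>.
\<close>

lemma flip_move_mirror: "flip_move K ps qs \<Longrightarrow> flip_move K (rev (map opp ps)) (rev (map opp qs))"
proof (induction rule: flip_move.induct)
  case (off L A C)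
  have "(None, label ` set (rev (map opp L))) \<in> K" using off by (simp add: image_image)
  from flip_move.off[OF this, of "rev (map opp C)" "rev (map opp A)"] show ?case by (simp add: rev_map)
next
  case (axis t L A C)
  have "(Some t, label ` set (rev (map opp L))) \<in> K" using axis by (simp add: image_image)
  from flip_move.axis[OF this, of "rev (map opp C)" "rev (map opp A)"] show ?case by (simp add: rev_map)
qed

lemma flip_moves_mirror: "(flip_move K)\<^sup>*\<^sup>* ps qs \<Longrightarrow> (flip_move K)\<^sup>*\<^sup>* (rev (map opp ps)) (rev (map opp qs))"
proof (induction rule: rtranclp_induct)
  case (step qs rs)
  from step(3) flip_move_mirror[OF step(2)] show ?case by (rule rtranclp.rtrancl_into_rtrancl)
qed simp


section \<open>Flips of nested bracketings\<close>

fun label_bracket :: "'n bracket \<Rightarrow> real option \<times> 'n set" where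
  "label_bracket (Off S) = (None, label ` S)"
| "label_bracket (Axis t S) = (Some t, label ` S)"

abbreviation node_labels :: "'n node \<Rightarrow> (real option \<times> 'n set) set" where
  "node_labels N \<equiv> label_bracket ` node_brackets N"

abbreviation item_leaves :: "'n node list \<Rightarrow> 'n particle list" where
  "item_leaves ns \<equiv> concat (map leaves ns)"

abbreviation flipped_items :: "'n node list \<Rightarrow> 'n node list \<Rightarrow> bool" where
  "flipped_items \<equiv> list_all2 (\<lambda>N N'. N' \<in> node_flips N)"

lemma in_listset_iff: "ys \<in> listset As \<longleftrightarrow> list_all2 (\<lambda>A y. y \<in> A) As ys"
  by (induction As arbitrary: ys) (auto simp: set_Cons_def list_all2_Cons1)

lemma in_node_flips: "N' \<in> node_flips (Br ns) \<longleftrightarrow> (\<exists>ms. flipped_items ns ms \<and> (N' = Br ms \<or> N' = Br (rev ms)))"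
  by (auto simp: in_listset_iff list_all2_map1)

lemma in_center_flips:
  "d \<in> center_flips (AxisBr c ns) \<longleftrightarrow>
     (\<exists>c'\<in>center_flips c. \<exists>ms. flipped_items ns ms \<and> (d = AxisBr c' ms \<or> d = AxisBr c' (map mirror ms)))"
  unfolding center_flips.simps UN_iff Bex_def in_listset_iff list_all2_map1 insert_iff empty_iff by blast

lemma leaves_mirror: "leaves (mirror N) = rev (map opp (leaves N))"
proof (induction N)
  case (Br ns)
  then have e: "map (\<lambda>N. leaves (mirror N)) ns = map (\<lambda>N. rev (map opp (leaves N))) ns" by simp
  have "leaves (mirror (Br ns)) = concat (rev (map (\<lambda>N. leaves (mirror N)) ns))" by (simp add: rev_map comp_def)
  also have "\<dots> = rev (map opp (leaves (Br ns)))"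
    unfolding e by (simp add: rev_concat rev_map map_concat comp_def)
  finally show ?case .
qed simp

lemma item_leaves_mirror: "item_leaves (rev (map mirror ns)) = rev (map opp (item_leaves ns))"
  using leaves_mirror[of "Br ns"] by simp

lemma node_labels_Br: "node_labels (Br ns) = insert (None, label ` set (item_leaves ns)) (\<Union>(node_labels ` set ns))"
  by auto

lemma node_labels_mirror: "node_labels (mirror N) = node_labels N"
proof (induction N)
  case (Br ns)
  have "(\<Union>(node_labels ` set (rev (map mirror ns)))) = (\<Union>(node_labels ` set ns))"
    using Br by auto
  moreover have "label ` set (item_leaves (rev (map mirror ns))) = label ` set (item_leaves ns)"
    unfolding item_leaves_mirror by (simp add: image_image image_UN)
  ultimately show ?case unfolding mirror.simps node_labels_Br by (simp only:)
qed simp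

lemma node_flips_invariants:
  "N' \<in> node_flips N \<Longrightarrow> set (leaves N') = set (leaves N) \<and> node_brackets N' = node_brackets N \<and> (proper_node N' \<longleftrightarrow> proper_node N)"
proof (induction N arbitrary: N')
  case (Br ns)
  from Br(2) obtain ms where ms: "flipped_items ns ms" "N' = Br ms \<or> N' = Br (rev ms)" unfolding in_node_flips by blast
  have "set (item_leaves ms) = set (item_leaves ns) \<and> (\<Union>(set (map node_brackets ms))) = (\<Union>(set (map node_brackets ns)))
      \<and> ((\<forall>N\<in>set ms. proper_node N) \<longleftrightarrow> (\<forall>N\<in>set ns. proper_node N)) \<and> length ms = length ns"
  proof -
    have "list_all2 (\<lambda>N N'. set (leaves N') = set (leaves N) \<and> node_brackets N' = node_brackets N \<and>
        (proper_node N' \<longleftrightarrow> proper_node N)) ns ms"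
      by (rule list.rel_mono_strong[OF ms(1)]) (use Br(1) in blast)
    then show ?thesis by (induction rule: list_all2_induct) simp_all
  qed
  then show ?case using ms(2) by auto
qed simp

lemma flipped_items_invariants:
  assumes "flipped_items ns ms"
  shows "set (item_leaves ms) = set (item_leaves ns)" "(\<Union>N\<in>set ms. node_brackets N) = (\<Union>N\<in>set ns. node_brackets N)"
    "(\<forall>N\<in>set ms. proper_node N) \<longleftrightarrow> (\<forall>N\<in>set ns. proper_node N)" "ms = [] \<longleftrightarrow> ns = []"
proof -
  have "set (item_leaves ms) = set (item_leaves ns) \<and> (\<Union>N\<in>set ms. node_brackets N) = (\<Union>N\<in>set ns. node_brackets N)
      \<and> ((\<forall>N\<in>set ms. proper_node N) \<longleftrightarrow> (\<forall>N\<in>set ns. proper_node N)) \<and> (ms = [] \<longleftrightarrow> ns = [])"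
    using assms by (induction rule: list_all2_induct) (simp_all add: node_flips_invariants)
  then show "set (item_leaves ms) = set (item_leaves ns)" "(\<Union>N\<in>set ms. node_brackets N) = (\<Union>N\<in>set ns. node_brackets N)"
    "(\<forall>N\<in>set ms. proper_node N) \<longleftrightarrow> (\<forall>N\<in>set ns. proper_node N)" "ms = [] \<longleftrightarrow> ns = []"
    by blast+
qed

lemma reverse_item: "node_labels N \<subseteq> K \<Longrightarrow> (flip_move K)\<^sup>*\<^sup>* (rev (leaves N)) (leaves N)"
proof (cases N)
  case (Br ns)
  assume "node_labels N \<subseteq> K"
  then have "(None, label ` set (rev (leaves N))) \<in> K" using Br by auto
  from flip_move.off[OF this, of "[]" "[]"] show ?thesis by simp
qed simp

lemma moves_items:
  assumes "list_all2 (\<lambda>ps qs. (flip_move K)\<^sup>*\<^sup>* ps qs) xss yss"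
  shows "(flip_move K)\<^sup>*\<^sup>* (concat xss) (concat yss)"
  using assms
proof (induction rule: list_all2_induct)
  case (Cons x xs y ys)
  have "(flip_move K)\<^sup>*\<^sup>* (x @ concat xs) (y @ concat xs)" using flip_moves_context[OF Cons(1), of "[]" "concat xs"] by simp
  also have "(flip_move K)\<^sup>*\<^sup>* (y @ concat xs) (y @ concat ys)" using flip_moves_context[OF Cons(3), of y "[]"] by simp
  finally show ?case by simp
qed simp

lemma reverse_items:
  assumes "\<And>N. N \<in> set ns \<Longrightarrow> node_labels N \<subseteq> K"
  shows "(flip_move K)\<^sup>*\<^sup>* (concat (map (\<lambda>N. rev (leaves N)) ns)) (item_leaves ns)"
  by (rule moves_items, unfold list_all2_map1 list_all2_map2, rule list.rel_refl_strong, rule reverse_item, rule assms)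

text \<open>
Reversing the segment of a bracket also reverses the segments of its items, each of which is a
particle or a bracket and can be reversed back.
\<close>

lemma node_flip_moves: "N' \<in> node_flips N \<Longrightarrow> node_labels N \<subseteq> K \<Longrightarrow> (flip_move K)\<^sup>*\<^sup>* (leaves N) (leaves N')"
proof (induction N arbitrary: N')
  case (Br ns)
  from Br(2) obtain ms where ms: "flipped_items ns ms" "N' = Br ms \<or> N' = Br (rev ms)" unfolding in_node_flips by blast
  have sub: "node_labels N \<subseteq> K" if "N \<in> set ns" for N using Br(3) that by auto
  have "list_all2 (\<lambda>ps qs. (flip_move K)\<^sup>*\<^sup>* ps qs) (map leaves ns) (map leaves ms)"
    unfolding list_all2_map1 list_all2_map2
    by (rule list.rel_mono_strong[OF ms(1)]) (use Br(1) sub in blast)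
  then have m1: "(flip_move K)\<^sup>*\<^sup>* (item_leaves ns) (item_leaves ms)" by (rule moves_items)
  have "(\<Union>N\<in>set ms. node_labels N) = label_bracket ` (\<Union>N\<in>set ms. node_brackets N)" by blast
  also have "\<dots> \<subseteq> K" unfolding flipped_items_invariants(2)[OF ms(1)] using sub by blast
  finally have sub': "node_labels N \<subseteq> K" if "N \<in> set ms" for N using that by blast
  have "(None, label ` set (item_leaves ms)) \<in> K"
    using Br(3) unfolding flipped_items_invariants(1)[OF ms(1)] by auto
  from flip_move.off[OF this, of "[]" "[]"]
  have "flip_move K (item_leaves ms) (concat (map (\<lambda>N. rev (leaves N)) (rev ms)))"
    by (simp add: rev_concat rev_map comp_def)
  moreover have "(flip_move K)\<^sup>*\<^sup>* (concat (map (\<lambda>N. rev (leaves N)) (rev ms))) (item_leaves (rev ms))"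
    by (rule reverse_items) (use sub' in simp)
  ultimately have "(flip_move K)\<^sup>*\<^sup>* (item_leaves ms) (item_leaves (rev ms))" by (rule converse_rtranclp_into_rtranclp)
  with m1 have "(flip_move K)\<^sup>*\<^sup>* (item_leaves ns) (item_leaves (rev ms))" by (rule rtranclp_trans)
  with m1 show ?case using ms(2) by auto
qed simp

lemma flipped_items_moves:
  assumes "flipped_items ns ms" "\<And>N. N \<in> set ns \<Longrightarrow> node_labels N \<subseteq> K"
  shows "(flip_move K)\<^sup>*\<^sup>* (item_leaves ns) (item_leaves ms)"
  by (rule moves_items, unfold list_all2_map1 list_all2_map2, rule list.rel_mono_strong[OF assms(1)])
    (use node_flip_moves assms(2) in blast)

abbreviation half_leaves :: "'n center \<Rightarrow> 'n particle list" where
  "half_leaves c \<equiv> item_leaves (center_half c)"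

definition center_labels :: "real \<Rightarrow> 'n center \<Rightarrow> (real option \<times> 'n set) set" where
  "center_labels t c = (\<lambda>S. (Some t, label ` S)) ` axis_halves c \<union> (\<Union>N\<in>set (center_half c). node_labels N)"

lemma center_labels_AxisBr:
  "center_labels t (AxisBr c ns) =
     insert (Some t, label ` set (half_leaves c @ item_leaves ns)) (center_labels t c \<union> (\<Union>N\<in>set ns. node_labels N))"
  by (auto simp: center_labels_def)

lemma flipped_items_labels: "flipped_items ns ms \<Longrightarrow> (\<Union>N\<in>set ms. node_labels N) = (\<Union>N\<in>set ns. node_labels N)"
  using arg_cong[OF flipped_items_invariants(2), of ns ms "image label_bracket"] by (simp add: image_UN)

lemma center_flips_invariants:
  "c' \<in> center_flips c \<Longrightarrow> label ` set (half_leaves c') = label ` set (half_leaves c) \<and> center_labels t c' = center_labels t c \<and>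
     (has_fixed c' \<longleftrightarrow> has_fixed c) \<and> (proper_center c \<longrightarrow> proper_center c')"
proof (induction c arbitrary: c')
  case (AxisBr c ns)
  from AxisBr(2) obtain d ms where d: "d \<in> center_flips c" "flipped_items ns ms" "c' = AxisBr d ms \<or> c' = AxisBr d (map mirror ms)"
    unfolding in_center_flips by blast
  note I = AxisBr(1)[OF d(1)] and F = flipped_items_invariants[OF d(2)] flipped_items_labels[OF d(2)]
  have pm: "proper_node (mirror N) \<longleftrightarrow> proper_node N" for N :: "'a node" by (induction N) auto
  have lm: "label ` set (item_leaves (map mirror ms)) = label ` set (item_leaves ms)"
    by (auto simp: leaves_mirror image_image image_UN)
  have E: "label ` set (half_leaves d @ item_leaves ms') = label ` set (half_leaves c @ item_leaves ns) \<and>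
      (\<Union>N\<in>set ms'. node_labels N) = (\<Union>N\<in>set ns. node_labels N) \<and>
      ((\<forall>N\<in>set ms'. proper_node N) \<longleftrightarrow> (\<forall>N\<in>set ns. proper_node N)) \<and> (ms' = [] \<longleftrightarrow> ns = [])"
    if "ms' = ms \<or> ms' = map mirror ms" for ms'
    using that
  proof
    assume "ms' = ms"
    then show ?thesis using F I by (simp only: set_append image_Un)
  next
    assume m: "ms' = map mirror ms"
    have "label ` set (half_leaves d @ item_leaves (map mirror ms)) = label ` set (half_leaves c @ item_leaves ns)"
      unfolding set_append image_Un lm F(1) using I by (simp only:)
    moreover have "(\<Union>N\<in>set (map mirror ms). node_labels N) = (\<Union>N\<in>set ms. node_labels (mirror N))" by simp
    then have "(\<Union>N\<in>set (map mirror ms). node_labels N) = (\<Union>N\<in>set ns. node_labels N)"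
      unfolding node_labels_mirror F(5) .
    moreover have "(\<forall>N\<in>set (map mirror ms). proper_node N) \<longleftrightarrow> (\<forall>N\<in>set ns. proper_node N)"
      unfolding F(3)[symmetric] by (simp add: pm)
    ultimately show ?thesis unfolding m using F(4) by (simp only: map_is_Nil_conv simp_thms)
  qed
  obtain ms' where m: "c' = AxisBr d ms'" "ms' = ms \<or> ms' = map mirror ms" using d(3) by blast
  note I3 = I[THEN conjunct2, THEN conjunct2, THEN conjunct1] and I4 = I[THEN conjunct2, THEN conjunct2, THEN conjunct2]
  note E1 = E[OF m(2), THEN conjunct1] and E2 = E[OF m(2), THEN conjunct2, THEN conjunct1]
    and E3 = E[OF m(2), THEN conjunct2, THEN conjunct2]
  have "label ` set (half_leaves c') = label ` set (half_leaves (AxisBr c ns))"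
    unfolding m(1) center_half.simps map_append concat_append by (rule E1)
  moreover have "center_labels t c' = center_labels t (AxisBr c ns)"
    unfolding m(1) center_labels_AxisBr E1 E2 using I by (simp only:)
  moreover have "proper_center (AxisBr c ns) \<longrightarrow> proper_center c'" unfolding m(1) proper_center.simps using E3 I4 by simp
  moreover have "has_fixed c' \<longleftrightarrow> has_fixed (AxisBr c ns)" unfolding m(1) has_fixed.simps by (rule I3)
  ultimately show ?case by blast
qed simp_all

text \<open>
A flip of the segment of a symmetric bracket also passes to the mirror image of the bracket's centre
and leaves the leaves of each item in their order.  The centre is flipped back, and reversing each
segment of an item turns it into the segment of the mirror image of the item.
\<close>

lemma center_flip_moves:
  "c' \<in> center_flips c \<Longrightarrow> center_labels t c \<subseteq> K \<Longrightarrow> (flip_move K)\<^sup>*\<^sup>* (half_leaves c) (half_leaves c')"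
proof (induction c arbitrary: c')
  case (AxisBr c ns)
  from AxisBr(2) obtain d ms where d: "d \<in> center_flips c" "flipped_items ns ms" "c' = AxisBr d ms \<or> c' = AxisBr d (map mirror ms)"
    unfolding in_center_flips by blast
  have K: "(Some t, label ` set (half_leaves c @ item_leaves ns)) \<in> K" "center_labels t c \<subseteq> K" "(\<Union>N\<in>set ns. node_labels N) \<subseteq> K"
    using AxisBr(3) unfolding center_labels_AxisBr by blast+
  have ld: "label ` set (half_leaves d) = label ` set (half_leaves c)" "center_labels t d = center_labels t c"
    using center_flips_invariants[OF d(1), of t] by (simp_all only: simp_thms)
  have "(flip_move K)\<^sup>*\<^sup>* (half_leaves c @ item_leaves ns) (half_leaves d @ item_leaves ns)"
    using flip_moves_context[OF AxisBr(1)[OF d(1) K(2)], of "[]" "item_leaves ns"] by simp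
  also have "(flip_move K)\<^sup>*\<^sup>* (half_leaves d @ item_leaves ns) (half_leaves d @ item_leaves ms)"
  proof -
    have "node_labels N \<subseteq> K" if "N \<in> set ns" for N using K(3) that by blast
    from flip_moves_context[OF flipped_items_moves[OF d(2) this], of "half_leaves d" "[]"] show ?thesis by simp
  qed
  finally have m1: "(flip_move K)\<^sup>*\<^sup>* (half_leaves c @ item_leaves ns) (half_leaves d @ item_leaves ms)" .
  have "(Some t, label ` set (half_leaves d @ item_leaves ms)) \<in> K"
    using K(1) by (simp only: set_append image_Un ld flipped_items_invariants(1)[OF d(2)])
  from flip_move.axis[OF this, of "[]" "[]"]
  have m2: "flip_move K (half_leaves d @ item_leaves ms) (map opp (half_leaves d) @ map opp (item_leaves ms))" by simp
  have m3: "(flip_move K)\<^sup>*\<^sup>* (map opp (half_leaves d)) (half_leaves d)"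
  proof (cases d)
    case (AxisBr e ls)
    then have "(Some t, label ` set (half_leaves d)) \<in> center_labels t d" by (simp add: center_labels_def)
    then have "(Some t, label ` set (map opp (half_leaves d))) \<in> K" using ld(2) K(2) by (auto simp: image_image)
    from flip_move.axis[OF this, of "[]" "[]"] show ?thesis by (simp add: comp_def)
  qed simp_all
  have m4: "(flip_move K)\<^sup>*\<^sup>* (concat (map (\<lambda>N. rev (leaves N)) (map mirror ms))) (item_leaves (map mirror ms))"
  proof (rule reverse_items)
    fix N assume "N \<in> set (map mirror ms)"
    then obtain N' where "N' \<in> set ms" "N = mirror N'" by auto
    then show "node_labels N \<subseteq> K" using K(3)[folded flipped_items_labels[OF d(2)]] node_labels_mirror[of N'] by blast
  qed
  have e: "concat (map (\<lambda>N. rev (leaves N)) (map mirror ms)) = map opp (item_leaves ms)"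
    by (simp add: leaves_mirror map_concat comp_def)
  note m1
  also note r_into_rtranclp[of "flip_move K", OF m2]
  also have "(flip_move K)\<^sup>*\<^sup>* (map opp (half_leaves d) @ map opp (item_leaves ms)) (half_leaves d @ map opp (item_leaves ms))"
    using flip_moves_context[OF m3, of "[]" "map opp (item_leaves ms)"] by simp
  also have "(flip_move K)\<^sup>*\<^sup>* (half_leaves d @ map opp (item_leaves ms)) (half_leaves d @ item_leaves (map mirror ms))"
    using flip_moves_context[OF m4[unfolded e], of "half_leaves d" "[]"] by simp
  finally show ?case using m1 d(3) by auto
qed simp_all


text \<open>
One diagram arises from the other by flips of its brackets; the outermost component, which is not a
bracket, is left alone.
\<close>

fun flipped :: "'n diagram \<Rightarrow> 'n diagram \<Rightarrow> bool" where
  "flipped (Lin ns) (Lin ms) = flipped_items ns ms"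
| "flipped (Circ ns) (Circ ms) = flipped_items ns ms"
| "flipped (SymLin c ns) (SymLin d ms) = (d \<in> center_flips c \<and> flipped_items ns ms)"
| "flipped (SymCirc c ns e) (SymCirc d ms f) = (d \<in> center_flips c \<and> flipped_items ns ms \<and> f \<in> center_flips e)"
| "flipped _ _ = False"

lemma labels_Lin: "label_bracket ` brackets (Lin ns) = (\<Union>N\<in>set ns. node_labels N)"
  and labels_Circ: "label_bracket ` brackets (Circ ns) = (\<Union>N\<in>set ns. node_labels N)"
  by (simp_all add: brackets_def image_UN)

lemma labels_SymLin: "label_bracket ` brackets (SymLin c ns) = center_labels 0 c \<union> (\<Union>N\<in>set ns. node_labels N)"
  by (auto simp: brackets_def center_labels_def image_UN image_Un image_image)

lemma labels_SymCirc:
  "label_bracket ` brackets (SymCirc c ns d) = center_labels 0 c \<union> (\<Union>N\<in>set ns. node_labels N) \<union> center_labels 1 d"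
proof -
  have A: "label_bracket ` axis_brackets (SymCirc c ns d) =
      (\<lambda>S. (Some 0, label ` S)) ` axis_halves c \<union> (\<lambda>S. (Some 1, label ` S)) ` axis_halves d"
    by (simp add: image_Un image_image)
  have B: "label_bracket ` (\<Union>N\<in>set (half (SymCirc c ns d)). node_brackets N) =
      (\<Union>N\<in>set (center_half c). node_labels N) \<union> (\<Union>N\<in>set ns. node_labels N) \<union> (\<Union>N\<in>set (center_half d). node_labels N)"
    by (simp add: image_UN image_Un node_labels_mirror Un_assoc)
  show ?thesis unfolding brackets_def image_Un A B center_labels_def by (simp only: Un_assoc Un_commute Un_left_commute)
qed

lemma ordering_SymCirc: "ordering (SymCirc c ns d) = half_leaves c @ item_leaves ns @ rev (map opp (half_leaves d))"
  unfolding ordering_def half.simps map_append concat_append item_leaves_mirror ..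

lemma flipped_brackets:
  assumes "flipped G G'"
  shows "label_bracket ` brackets G' = label_bracket ` brackets G" "proper G \<Longrightarrow> proper G'"
    "diagram_of_type W G \<Longrightarrow> diagram_of_type W G'"
proof -
  have c: "center_labels t d = center_labels t c" "has_fixed d = has_fixed c" "proper_center c \<Longrightarrow> proper_center d"
    if "d \<in> center_flips c" for c d t
    using center_flips_invariants[OF that, of t] by (simp_all only: simp_thms)
  note f = flipped_items_labels flipped_items_invariants(3)
  have "label_bracket ` brackets G' = label_bracket ` brackets G \<and> (proper G \<longrightarrow> proper G') \<and>
      (diagram_of_type W G \<longrightarrow> diagram_of_type W G')"
  proof (cases "(G, G')" rule: flipped.cases)
    case (1 ns ms)
    then have "flipped_items ns ms" using assms by simp
    from f[OF this] 1 show ?thesis by (simp only: prod.inject labels_Lin proper.simps diagram_of_type.simps simp_thms)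
  next
    case (2 ns ms)
    then have "flipped_items ns ms" using assms by simp
    from f[OF this] 2 show ?thesis by (simp only: prod.inject labels_Circ proper.simps diagram_of_type.simps simp_thms)
  next
    case (3 u ns v ms)
    then have h: "flipped_items ns ms" "v \<in> center_flips u" using assms by simp_all
    have G: "G = SymLin u ns" "G' = SymLin v ms" using 3 by simp_all
    show ?thesis unfolding G labels_SymLin proper.simps diagram_of_type.simps f[OF h(1)] c(1,2)[OF h(2)]
      using c(3)[OF h(2)] by blast
  next
    case (4 u ns w v ms z)
    then have h: "flipped_items ns ms" "v \<in> center_flips u" "z \<in> center_flips w" using assms by simp_all
    have G: "G = SymCirc u ns w" "G' = SymCirc v ms z" using 4 by simp_all
    show ?thesis unfolding G labels_SymCirc proper.simps diagram_of_type.simps f[OF h(1)] c(1,2)[OF h(2)] c(1,2)[OF h(3)]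
      using c(3)[OF h(2)] c(3)[OF h(3)] by blast
  qed (use assms in simp_all)
  then show "label_bracket ` brackets G' = label_bracket ` brackets G" "proper G \<Longrightarrow> proper G'"
    "diagram_of_type W G \<Longrightarrow> diagram_of_type W G'" by (simp_all only: simp_thms)
qed

lemma flipped_moves:
  assumes "flipped G G'" "label_bracket ` brackets G \<subseteq> K"
  shows "(flip_move K)\<^sup>*\<^sup>* (ordering G) (ordering G')"
proof -
  have items: "(flip_move K)\<^sup>*\<^sup>* (item_leaves ns) (item_leaves ms)"
    if "flipped_items ns ms" "(\<Union>N\<in>set ns. node_labels N) \<subseteq> K" for ns ms
    by (rule flipped_items_moves[OF that(1)]) (use that(2) in blast)
  have sym: "(flip_move K)\<^sup>*\<^sup>* (half_leaves c @ item_leaves ns) (half_leaves d @ item_leaves ms)"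
    if "d \<in> center_flips c" "flipped_items ns ms" "center_labels 0 c \<subseteq> K" "(\<Union>N\<in>set ns. node_labels N) \<subseteq> K" for c d ns ms
    using moves_items[of K "[half_leaves c, item_leaves ns]" "[half_leaves d, item_leaves ms]"]
      center_flip_moves[OF that(1,3)] items[OF that(2,4)] by simp
  show ?thesis
  proof (cases "(G, G')" rule: flipped.cases)
    case (1 ns ms)
    then show ?thesis using assms items by (simp add: ordering_def labels_Lin)
  next
    case (2 ns ms)
    then show ?thesis using assms items by (simp add: ordering_def labels_Circ)
  next
    case (3 c ns d ms)
    then show ?thesis using assms sym by (simp add: ordering_def labels_SymLin)
  next
    case (4 c ns e d ms f)
    have "(flip_move K)\<^sup>*\<^sup>* (half_leaves e) (half_leaves f)"
      by (rule center_flip_moves[of _ _ 1]) (use assms 4 in \<open>simp_all add: labels_SymCirc\<close>)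
    from flip_moves_mirror[OF this]
    show ?thesis using 4 assms sym[of d c ns ms] moves_items[of K "[half_leaves c @ item_leaves ns, rev (map opp (half_leaves e))]"
        "[half_leaves d @ item_leaves ms, rev (map opp (half_leaves f))]"]
      by (simp add: ordering_SymCirc labels_SymCirc)
  qed (use assms in simp_all)
qed


section \<open>The flip action on a composition\<close>

lemma node_flips_mirror: "N' \<in> node_flips N \<Longrightarrow> mirror N' \<in> node_flips (mirror N)"
proof (induction N arbitrary: N')
  case (Br ns)
  from Br(2) obtain ms where ms: "flipped_items ns ms" "N' = Br ms \<or> N' = Br (rev ms)" unfolding in_node_flips by blast
  have "list_all2 (\<lambda>N N'. mirror N' \<in> node_flips (mirror N)) ns ms"
    by (rule list.rel_mono_strong[OF ms(1)]) (use Br(1) in blast)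
  then have f: "flipped_items (rev (map mirror ns)) (rev (map mirror ms))" by (simp add: list_all2_map1 list_all2_map2)
  have "mirror N' = Br (rev (map mirror ms)) \<or> mirror N' = Br (rev (rev (map mirror ms)))" using ms(2) by (auto simp: rev_map)
  then show ?case unfolding mirror.simps(2) in_node_flips using f by blast
qed simp

lemma in_flips:
  "D \<in> flips (Lin ns) \<longleftrightarrow> (\<exists>ms. flipped_items ns ms \<and> (D = Lin ms \<or> D = Lin (rev ms)))"
  "D \<in> flips (SymLin c ns) \<longleftrightarrow>
     (\<exists>c'\<in>center_flips c. \<exists>ms. flipped_items ns ms \<and> (D = SymLin c' ms \<or> D = SymLin c' (map mirror ms)))"
  unfolding flips.simps UN_iff Bex_def in_listset_iff list_all2_map1 insert_iff empty_iff by blast+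

definition flipped_insertions :: "('n slot \<Rightarrow> 'n diagram option) \<Rightarrow> ('n slot \<Rightarrow> 'n diagram option) \<Rightarrow> bool" where
  "flipped_insertions s s' \<longleftrightarrow>
     (\<forall>i. s i = None \<and> s' i = None \<or>
       (\<exists>D D'. s i = Some D \<and> s' i = Some D' \<and> insertable i D \<and> D' \<in> flips D))"

lemma flipped_insertions_map_of:
  assumes "list_all2 insertable js Gs" "list_all2 (\<lambda>G G'. G' \<in> flips G) Gs Gs'"
  shows "flipped_insertions (map_of (zip js Gs)) (map_of (zip js Gs'))"
  using assms
proof (induction js Gs arbitrary: Gs' rule: list_all2_induct)
  case Nil
  then show ?case by (simp add: flipped_insertions_def)
next
  case (Cons j js G Gs)
  then obtain G' Gs'' where G': "Gs' = G' # Gs''" "G' \<in> flips G" "list_all2 (\<lambda>G G'. G' \<in> flips G) Gs Gs''"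
    by (auto simp: list_all2_Cons1)
  from Cons(3)[OF G'(3)] show ?case using G'(1,2) Cons(1) unfolding flipped_insertions_def by simp
qed

lemma subst_pt_flips:
  assumes s: "flipped_insertions s s'"
  shows "subst_pt s' a \<in> node_flips (subst_pt s a)"
proof -
  have "s (Movable (label a)) = None \<and> s' (Movable (label a)) = None \<or>
      (\<exists>ns ms. s (Movable (label a)) = Some (Lin ns) \<and> s' (Movable (label a)) = Some (Lin ms) \<and> Br ms \<in> node_flips (Br ns))"
  proof (cases "s (Movable (label a))")
    case None
    then show ?thesis using s unfolding flipped_insertions_def by (metis option.distinct(1))
  next
    case (Some D)
    then obtain D' where D': "s' (Movable (label a)) = Some D'" "insertable (Movable (label a)) D" "D' \<in> flips D"
      using s unfolding flipped_insertions_def by (metis option.distinct(1) option.inject)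
    then obtain ns where ns: "D = Lin ns" by auto
    then obtain ms where "flipped_items ns ms" "D' = Lin ms \<or> D' = Lin (rev ms)" using D'(3) in_flips(1) by blast
    then show ?thesis using Some D'(1) ns in_node_flips by metis
  qed
  then show ?thesis
  proof
    assume "s (Movable (label a)) = None \<and> s' (Movable (label a)) = None"
    then show ?thesis by (cases a) auto
  next
    assume "\<exists>ns ms. s (Movable (label a)) = Some (Lin ns) \<and> s' (Movable (label a)) = Some (Lin ms) \<and> Br ms \<in> node_flips (Br ns)"
    then obtain ns ms where n: "s (Movable (label a)) = Some (Lin ns)" "s' (Movable (label a)) = Some (Lin ms)" "Br ms \<in> node_flips (Br ns)"
      by blast
    then show ?thesis using node_flips_mirror[OF n(3)] by (cases a) (simp_all del: node_flips.simps mirror.simps)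
  qed
qed

lemma subst_node_flips:
  assumes s: "flipped_insertions s s'"
  shows "subst_node s' N \<in> node_flips (subst_node s N)"
proof (induction N)
  case (Pt a)
  then show ?case using subst_pt_flips[OF s] by simp
next
  case (Br ns)
  have "flipped_items (map (subst_node s) ns) (map (subst_node s') ns)"
    unfolding list_all2_map1 list_all2_map2 by (rule list.rel_refl_strong) (rule Br)
  then show ?case unfolding subst_node.simps in_node_flips by blast
qed

lemma subst_items_flips:
  "flipped_insertions s s' \<Longrightarrow> flipped_items (map (subst_node s) ns) (map (subst_node s') ns)"
  unfolding list_all2_map1 list_all2_map2 by (rule list.rel_refl_strong) (rule subst_node_flips)

lemma subst_center_flips:
  assumes s: "flipped_insertions s s'" and i: "i \<in> {FixedAt0, FixedAt1}"
  shows "subst_center s' i c \<in> center_flips (subst_center s i c)"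
proof (induction c)
  case Fixed
  show ?case
  proof (cases "s i")
    case None
    then have "s' i = None" using s unfolding flipped_insertions_def by (metis option.distinct(1))
    then show ?thesis using None by simp
  next
    case (Some D)
    then obtain D' where D': "s' i = Some D'" "insertable i D" "D' \<in> flips D"
      using s unfolding flipped_insertions_def by (metis option.distinct(1) option.inject)
    then obtain c ns where ns: "D = SymLin c ns" using i by auto
    then obtain c' ms where c': "c' \<in> center_flips c" "flipped_items ns ms" "D' = SymLin c' ms \<or> D' = SymLin c' (map mirror ms)"
      using D'(3) in_flips(2) by blast
    then obtain ms' where m: "D' = SymLin c' ms'" "ms' = ms \<or> ms' = map mirror ms" by blast
    have "AxisBr c' ms' \<in> center_flips (AxisBr c ns)" unfolding in_center_flips using c' m(2) by blast
    then show ?thesis using Some D'(1) ns m(1) by simp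
  qed
next
  case (AxisBr c ns)
  show ?case unfolding subst_center.simps in_center_flips using AxisBr subst_items_flips[OF s] by blast
qed simp

text \<open>
The outermost component of an inserted diagram becomes a bracket of the composition, so its flip is
a flip of brackets there.  An insertion at a particle \<open>Minus i\<close> is mirrored, and flips commute with mirror images.
\<close>

lemma composition_flips:
  assumes "list_all2 insertable js Gs" "list_all2 (\<lambda>G G'. G' \<in> flips G) Gs Gs'"
  shows "flipped (composition H (zip js Gs)) (composition H (zip js Gs'))"
  unfolding composition_def
  using flipped_insertions_map_of[OF assms] by (cases H) (simp_all add: subst_items_flips subst_center_flips)


section \<open>Cells of nested bracketings\<close>

lemma node_brackets_subset: "b \<in> node_brackets N \<Longrightarrow> \<exists>S. b = Off S \<and> S \<subseteq> set (leaves N)"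
proof (induction N arbitrary: b)
  case (Br ns)
  then show ?case by fastforce
qed simp

lemma axis_halves_prefix: "S \<in> axis_halves c \<Longrightarrow> \<exists>hs hs'. center_half c = hs @ hs' \<and> S = set (item_leaves hs)"
proof (induction c)
  case (AxisBr c ns)
  show ?case
  proof (cases "S \<in> axis_halves c")
    case True
    then obtain hs hs' where "center_half c = hs @ hs'" "S = set (item_leaves hs)" using AxisBr(1) by blast
    then show ?thesis by (intro exI[of _ hs] exI[of _ "hs' @ ns"]) simp
  next
    case False
    then have "S = set (item_leaves (center_half c @ ns))" using AxisBr(2) by simp
    then show ?thesis by (intro exI[of _ "center_half c @ ns"] exI[of _ "[]"]) simp
  qed
qed simp_all

text \<open>
A bracket on the axis consists of consecutive items of the half.  For the axis point \<open>1\<close> the particles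
in \<open>axis_halves\<close> lie beyond \<open>1\<close>; the half contains their mirror images.
\<close>

lemma axis_brackets_segment:
  assumes "b \<in> axis_brackets G"
  shows "\<exists>t hs ls rs. b = Axis t (set (item_leaves hs)) \<and> half G = ls @ hs @ rs \<and> (t = 0 \<or> t = 1 \<and> (\<exists>c ns d. G = SymCirc c ns d))"
proof -
  have zero: "\<exists>t hs ls rs. b = Axis t (set (item_leaves hs)) \<and> half G = ls @ hs @ rs \<and> (t = 0 \<or> t = 1 \<and> (\<exists>c ns d. G = SymCirc c ns d))"
    if z: "S \<in> axis_halves c" "b = Axis 0 S" "half G = center_half c @ ns" for S c ns
  proof -
    obtain hs hs' where "center_half c = hs @ hs'" "S = set (item_leaves hs)" using axis_halves_prefix[OF z(1)] by blast
    then show ?thesis using z by (intro exI[of _ 0] exI[of _ hs] exI[of _ "[]"] exI[of _ "hs' @ ns"]) simp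
  qed
  show ?thesis
  proof (cases G)
    case (SymLin c ns)
    then show ?thesis using assms zero by auto
  next
    case (SymCirc c ns d)
    then consider S where "S \<in> axis_halves c" "b = Axis 0 S" | S where "S \<in> axis_halves d" "b = Axis 1 (opp ` S)"
      using assms by auto
    then show ?thesis
    proof cases
      case 1
      then show ?thesis using zero SymCirc by simp
    next
      case 2
      obtain hs hs' where h: "center_half d = hs @ hs'" "S = set (item_leaves hs)" using axis_halves_prefix[OF 2(1)] by blast
      have "set (item_leaves (rev (map mirror hs))) = opp ` S" unfolding item_leaves_mirror h(2) by simp
      moreover have "half G = (center_half c @ ns @ rev (map mirror hs')) @ rev (map mirror hs) @ []" using SymCirc h(1) by simp
      ultimately show ?thesis using 2(2) SymCirc by metis
    qed
  qed (use assms in simp_all)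
qed

lemma brackets_subset: "b \<in> brackets G \<Longrightarrow> \<exists>S. S \<subseteq> set (ordering G) \<and> (b = Off S \<or> (\<exists>t. b = Axis t S))"
  unfolding brackets_def ordering_def using node_brackets_subset[of b] axis_brackets_segment[of b G] by fastforce

lemma bracket_of_label_bracket:
  assumes d: "distinct (map label (ordering G))" and b: "b \<in> brackets G"
  shows "bracket_of (ordering G) (label_bracket b) = b"
proof -
  obtain S where S: "S \<subseteq> set (ordering G)" "b = Off S \<or> (\<exists>t. b = Axis t S)" using brackets_subset[OF b] by blast
  have "{a \<in> set (ordering G). label a \<in> label ` S} = S"
    using S(1) d by (auto simp: distinct_map dest: inj_onD)
  then show ?thesis using S(2) by (auto simp: bracket_of.simps)
qed

lemma brackets_bracket_of:
  assumes "distinct (map label (ordering G))"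
  shows "brackets G = bracket_of (ordering G) ` label_bracket ` brackets G"
  using bracket_of_label_bracket[OF assms] by (simp add: image_image)

lemma finite_brackets: "finite (brackets G)"
proof -
  have n: "finite (node_brackets N)" for N :: "'a node" by (induction N) auto
  have c: "finite (axis_halves c)" for c :: "'a center" by (induction c) auto
  show ?thesis unfolding brackets_def by (cases G) (auto simp: n c)
qed

lemma nested_configuration:
  fixes G :: "'n::finite diagram"
  assumes "min_rank W \<le> n" "CARD('n) = particles W n" "nested_bracketing W G"
  shows "configuration W n (ordering G)"
  using assms unfolding configuration_def nested_bracketing_def by blast

text \<open>
Since a bracket on the axis consists of whole items, it contains or avoids every bracket inside an
item.
\<close>

lemma nested_admissible:
  assumes G: "nested_bracketing W G"
  shows "admissible W (ordering G) (label_bracket ` brackets G)"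
proof -
  have d: "distinct (map label (ordering G))" and ty: "diagram_of_type W G" using G by (simp_all add: nested_bracketing_def)
  have axis: "W \<notin> {TypeA, AffA} \<and> (t = 0 \<or> t = 1 \<and> toroidal W) \<and>
      (\<forall>M'. (None, M') \<in> label_bracket ` brackets G \<longrightarrow> M' \<subseteq> M \<or> M' \<inter> M = {})"
    if tM0: "(Some t, M) \<in> label_bracket ` brackets G" for t M
  proof -
    obtain b where b: "b \<in> brackets G" "label_bracket b = (Some t, M)" using tM0 by (metis imageE)
    have "b \<in> axis_brackets G"
    proof (rule ccontr)
      assume "b \<notin> axis_brackets G"
      then obtain S where "b = Off S" using b(1) node_brackets_subset unfolding brackets_def by blast
      then show False using b(2) by simp
    qed
    then have ne: "axis_brackets G \<noteq> {}" by blast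
    from axis_brackets_segment[OF \<open>b \<in> axis_brackets G\<close>]
    obtain t' hs ls rs where h: "b = Axis t' (set (item_leaves hs))" "half G = ls @ hs @ rs"
      "t' = 0 \<or> t' = 1 \<and> (\<exists>c ns d. G = SymCirc c ns d)" by blast
    have tM: "t' = t" "M = label ` set (item_leaves hs)" using b(2) h(1) by auto
    have "W \<notin> {TypeA, AffA}" using ne ty by (cases G) auto
    moreover have "t = 0 \<or> t = 1 \<and> toroidal W" using h(3) ty tM by (auto simp: toroidal_def)
    moreover have "M' \<subseteq> M \<or> M' \<inter> M = {}" if M': "(None, M') \<in> label_bracket ` brackets G" for M'
    proof -
      obtain b' where b': "b' \<in> brackets G" "label_bracket b' = (None, M')" using M' by (metis imageE)
      have "b' \<notin> axis_brackets G"
      proof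
        assume "b' \<in> axis_brackets G"
        from axis_brackets_segment[OF this] show False using b'(2) by auto
      qed
      then obtain N where N: "N \<in> set (half G)" "b' \<in> node_brackets N" using b'(1) unfolding brackets_def by blast
      obtain S where S: "b' = Off S" "S \<subseteq> set (leaves N)" using node_brackets_subset[OF N(2)] by blast
      have "M' = label ` S" using b'(2) S(1) by auto
      have o: "map label (ordering G) = map label (item_leaves ls) @ map label (item_leaves hs) @ map label (item_leaves rs)"
        by (simp add: ordering_def h(2))
      show ?thesis
      proof (cases "N \<in> set hs")
        case True
        then have "S \<subseteq> set (item_leaves hs)" using S(2) by auto
        then show ?thesis using \<open>M' = label ` S\<close> tM(2) by blast
      next
        case False
        then have "S \<subseteq> set (item_leaves ls) \<union> set (item_leaves rs)" using S(2) N(1) h(2) by auto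
        moreover have "(label ` set (item_leaves ls) \<union> label ` set (item_leaves rs)) \<inter> label ` set (item_leaves hs) = {}"
          using d unfolding o distinct_append set_append set_map by blast
        ultimately show ?thesis using \<open>M' = label ` S\<close> tM(2) by blast
      qed
    qed
    ultimately show ?thesis by blast
  qed
  have loc: "locus W (bracket_of (ordering G) k) \<in> min_building_set W" if "k \<in> label_bracket ` brackets G" for k
    using that G bracket_of_label_bracket[OF d] unfolding nested_bracketing_def by fastforce
  have g: "label ` set (ordering G) = UNIV" "W \<in> {TypeA, AffA} \<longrightarrow> set (ordering G) \<subseteq> range Plus"
    using G unfolding nested_bracketing_def by - (elim conjE, assumption)+
  show ?thesis unfolding admissible_def by (intro conjI d g ballI allI impI loc) (use axis in \<open>metis\<close>)+
qed

lemma nth_pairs_iff: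
  assumes "distinct ps"
  shows "(\<forall>j<length ps. \<forall>k<length ps. j \<noteq> k \<longrightarrow> P (ps ! j) (ps ! k)) \<longleftrightarrow> (\<forall>a\<in>set ps. \<forall>b\<in>set ps. a \<noteq> b \<longrightarrow> P a b)"
  unfolding all_set_conv_all_nth using nth_eq_iff_index_eq[OF assms] by blast

lemma in_order_iff:
  assumes ty: "diagram_of_type W G" and d: "distinct (ordering G)"
  shows "in_order G x \<longleftrightarrow> ordered W (ordering G) x"
proof -
  define ps where "ps = ordering G"
  have d: "distinct ps" using d by (simp add: ps_def)
  have 0: "ordered_at_0 fixd (map (pos x) ps) \<longleftrightarrow> (if fixd then \<forall>a\<in>set ps. 0 < pos x a
      else \<forall>a\<in>set ps. \<forall>b\<in>set ps. a \<noteq> b \<longrightarrow> - pos x a < pos x b)" for fixd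
    using nth_pairs_iff[OF d, of "\<lambda>a b. - pos x a < pos x b"] by (simp add: ordered_at_0_def)
  have 1: "ordered_at_1 fixd (map (pos x) ps) \<longleftrightarrow> (if fixd then \<forall>a\<in>set ps. pos x a < 1
      else \<forall>a\<in>set ps. \<forall>b\<in>set ps. a \<noteq> b \<longrightarrow> pos x b < 2 - pos x a)" for fixd
    using nth_pairs_iff[OF d, of "\<lambda>a b. pos x b < 2 - pos x a"] by (simp add: ordered_at_1_def)
  have "boundary_order G (map (pos x) ps) \<longleftrightarrow> boundary_conditions W (set ps) x"
    using ty unfolding boundary_conditions_def
    by (cases G) (auto simp: 0 1 fixed_at_0_def fixed_at_1_def)
  then show ?thesis unfolding in_order_def ordered_def Let_def sorted_wrt_map ps_def[symmetric] by (simp only:)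
qed

lemma cell_eq_ordered_cell:
  assumes ty: "diagram_of_type W G" and d: "distinct (map label (ordering G))"
  shows "cell W \<alpha>s G = ordered_cell W \<alpha>s (ordering G) (label_bracket ` brackets G)"
proof -
  have "distinct (ordering G)" using d by (simp add: distinct_map)
  note io = in_order_iff[OF ty this]
  have bq: "(\<forall>k\<in>label_bracket ` brackets G. P (bracket_of (ordering G) k)) \<longleftrightarrow> (\<forall>b\<in>brackets G. P b)" for P
    using bracket_of_label_bracket[OF d] by simp
  have "chamber_near W \<alpha>s G r = near_cell W \<alpha>s (ordering G) (label_bracket ` brackets G) r" for r
    unfolding chamber_near_def near_cell_def io bq ..
  then show ?thesis unfolding cell_def ordered_cell_def
    using bq[of "\<lambda>b. p \<in> divisor W \<alpha>s (locus W b)" for p] by (simp only:)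
qed

theorem theorem5p7:
  fixes W :: coxeter and n :: nat
    and \<alpha>s :: "(complex^'n^'n) set list"
    and H :: "'n::finite diagram" and js :: "'n slot list" and Gs Gs' :: "'n diagram list"
  assumes "min_rank W \<le> n" and "CARD('n) = particles W n"
    and "blow_up_order W \<alpha>s"
    and "distinct js" and "set js \<subseteq> slots H" and "list_all2 insertable js Gs"
    and "nested_bracketing W (composition H (zip js Gs))"
    and "list_all2 (\<lambda>G G'. G' \<in> flips G) Gs Gs'"
  shows "nested_bracketing W (composition H (zip js Gs')) \<and>
         cell W \<alpha>s (composition H (zip js Gs')) = cell W \<alpha>s (composition H (zip js Gs))"
proof -
  let ?G = "composition H (zip js Gs)" and ?G' = "composition H (zip js Gs')"
  let ?K = "label_bracket ` brackets ?G"
  have f: "flipped ?G ?G'" by (rule composition_flips[OF assms(6,8)])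
  note fb = flipped_brackets[OF f]
  have \<alpha>s: "distinct \<alpha>s" "set \<alpha>s = min_building_set W" using assms(3) by (simp_all add: blow_up_order_def)
  have G: "diagram_of_type W ?G" "distinct (map label (ordering ?G))" "proper ?G" using assms(7) by (simp_all add: nested_bracketing_def)
  have "finite ?K" by (simp add: finite_brackets)
  from flip_moves_cell[OF flipped_moves[OF f order_refl] nested_configuration[OF assms(1,2,7)] \<alpha>s nested_admissible[OF assms(7)] this]
  have conf: "configuration W n (ordering ?G')" and adm: "admissible W (ordering ?G') ?K"
    and eq: "ordered_cell W \<alpha>s (ordering ?G') ?K = ordered_cell W \<alpha>s (ordering ?G) ?K" by blast+
  have d': "distinct (map label (ordering ?G'))" by (rule configuration.labels(1)[OF conf])
  have br': "brackets ?G' = bracket_of (ordering ?G') ` ?K" using brackets_bracket_of[OF d'] unfolding fb(1) .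
  have "label ` set (ordering ?G') = UNIV" "W \<in> {TypeA, AffA} \<longrightarrow> set (ordering ?G') \<subseteq> range Plus"
    "\<forall>k\<in>?K. locus W (bracket_of (ordering ?G') k) \<in> min_building_set W"
    using adm unfolding admissible_def by - (elim conjE, assumption)+
  then have "nested_bracketing W ?G'" unfolding nested_bracketing_def br'
    using fb(2)[OF G(3)] fb(3)[OF G(1)] d' by (simp only: simp_thms ball_simps)
  moreover have "cell W \<alpha>s ?G' = cell W \<alpha>s ?G"
    unfolding cell_eq_ordered_cell[OF fb(3)[OF G(1)] d'] cell_eq_ordered_cell[OF G(1,2)] fb(1) by (rule eq)
  ultimately show ?thesis by blast
qed

end
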